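(* Let $f\in H$ be time-independent. Then the semigroup $S(t)$ on $\mathcal H$ possesses a connected global attractor $\mathcal A$, which is bounded in $\mathcal H^2=H^4\times H^2$. Moreover, $\mathcal A$ coincides with the unstable manifold of the set $\mathcal S$ of stationary points of $S(t)$: $$\mathcal A=\Big\{z(0):\ z \text{ is a complete bounded trajectory of } S(t) \text{ with } \lim_{t\to\infty}\operatorname{dist}_{\mathcal H}(z(-t),\mathcal S)=0\Big\}.$$
   Context: $H=L^2(\Omega,\mu)$ is a real Hilbert space of (classes of) real functions, with inner product $\langle\cdot,\cdot\rangle$ and norm $\|\cdot\|$; $u^+=\max(u,0)$ pointwise. $A$ is a strictly positive selfadjoint operator on $H$ with compact inverse, first eigenvalue $\lambda_1>0$; for $r\in\mathbb R$, $H^r=\mathcal D(A^{r/4})$, $\|u\|_r=\|A^{r/4}u\|$; $\mathcal H^r=H^{r+2}\times H^r$, $\mathcal H=\mathcal H^0$ with $\|(u,v)\|_{\mathcal H}^2=\|u\|_2^2+\|v\|^2$. Fixed constants $p,k\in\mathbb R$. $S(t)z=(u(t),\partial_tu(t))$ is the (strongly continuous) semigroup on $\mathcal H$ given by the unique weak solution of $\partial_{tt}u+Au+\partial_t u-(p-\|u\|_1^2)A^{1/2}u+k^2u^+=f$ with $(u(0),\partial_tu(0))=z$. $\mathcal S$ is the set of $(u,0)\in\mathcal H$ with $u$ a weak solution of $Au-(p-\|u\|_1^2)A^{1/2}u+k^2u^+=f$. A global attractor is a compact set $\mathcal A\subset\mathcal H$ which attracts every bounded set $B\subset\mathcal H$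 (the Hausdorff semidistance $\delta(S(t)B,\mathcal A)\to0$ as $t\to\infty$) and is fully invariant ($S(t)\mathcal A=\mathcal A$ for all $t\ge0$). A complete trajectory is a map $z:\mathbb R\to\mathcal H$ with $S(t)z(\tau)=z(t+\tau)$ for all $t\ge0$, $\tau\in\mathbb R$. *)

theory Defs
  imports "HOL-Analysis.Analysis"
begin

text \<open>
Setting.  H = L^2(Omega, mu) is represented by the set L2 M of square integrable
real functions on the measure space M (representatives; two representatives
are identified when their distance is 0).  The operator A (strictly positive,
selfadjoint, with compact inverse) is given through its spectral data: a complete
orthonormal family of eigenfunctions e j (j in J) with eigenvalues lam j > 0,
each sublevel set of lam being finite (lam j tends to infinity).  Then
A^(r/4) u = sum_j lam_j^(r/4) <u,e_j> e_j.
\<close>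

definition L2 :: "'w measure \<Rightarrow> ('w \<Rightarrow> real) set" where
  "L2 M = {u. u \<in> borel_measurable M \<and> integrable M (\<lambda>x. (u x)^2)}"

definition ip :: "'w measure \<Rightarrow> ('w \<Rightarrow> real) \<Rightarrow> ('w \<Rightarrow> real) \<Rightarrow> real" where
  "ip M u v = integral\<^sup>L M (\<lambda>x. u x * v x)"

definition nrm :: "'w measure \<Rightarrow> ('w \<Rightarrow> real) \<Rightarrow> real" where
  "nrm M u = sqrt (ip M u u)"

definition coef :: "'w measure \<Rightarrow> (nat \<Rightarrow> 'w \<Rightarrow> real) \<Rightarrow> nat \<Rightarrow> ('w \<Rightarrow> real) \<Rightarrow> real" where
  "coef M e j u = ip M u (e j)"

definition pos :: "('w \<Rightarrow> real) \<Rightarrow> ('w \<Rightarrow> real)" where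
  "pos u = (\<lambda>x. max (u x) 0)"

definition spectral_data ::
  "'w measure \<Rightarrow> nat set \<Rightarrow> (nat \<Rightarrow> 'w \<Rightarrow> real) \<Rightarrow> (nat \<Rightarrow> real) \<Rightarrow> bool" where
  "spectral_data M J e lam \<longleftrightarrow>
     (\<forall>j\<in>J. e j \<in> L2 M) \<and>
     (\<forall>i\<in>J. \<forall>j\<in>J. ip M (e i) (e j) = (if i = j then 1 else 0)) \<and>
     (\<forall>u\<in>L2 M. (\<forall>j\<in>J. coef M e j u = 0) \<longrightarrow> nrm M u = 0) \<and>
     (\<forall>j\<in>J. lam j > 0) \<and>
     (\<forall>c. finite {j\<in>J. lam j \<le> c})"

text \<open>squared norm  ||u||_r^2 = ||A^(r/4) u||^2\<close>
definition Hnorm2 ::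
  "'w measure \<Rightarrow> nat set \<Rightarrow> (nat \<Rightarrow> 'w \<Rightarrow> real) \<Rightarrow> (nat \<Rightarrow> real) \<Rightarrow> real \<Rightarrow> ('w \<Rightarrow> real) \<Rightarrow> real" where
  "Hnorm2 M J e lam r u = (\<Sum>\<^sub>\<infinity>j\<in>J. lam j powr (r/2) * (coef M e j u)^2)"

text \<open>H^r = D(A^(r/4)), r \<ge> 0\<close>
definition Hr ::
  "'w measure \<Rightarrow> nat set \<Rightarrow> (nat \<Rightarrow> 'w \<Rightarrow> real) \<Rightarrow> (nat \<Rightarrow> real) \<Rightarrow> real \<Rightarrow> ('w \<Rightarrow> real) set" where
  "Hr M J e lam r = {u \<in> L2 M. (\<lambda>j. lam j powr (r/2) * (coef M e j u)^2) summable_on J}"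

definition PH ::
  "'w measure \<Rightarrow> nat set \<Rightarrow> (nat \<Rightarrow> 'w \<Rightarrow> real) \<Rightarrow> (nat \<Rightarrow> real) \<Rightarrow> (('w \<Rightarrow> real) \<times> ('w \<Rightarrow> real)) set" where
  "PH M J e lam = Hr M J e lam 2 \<times> L2 M"

definition dPH ::
  "'w measure \<Rightarrow> nat set \<Rightarrow> (nat \<Rightarrow> 'w \<Rightarrow> real) \<Rightarrow> (nat \<Rightarrow> real)
   \<Rightarrow> ('w \<Rightarrow> real) \<times> ('w \<Rightarrow> real) \<Rightarrow> ('w \<Rightarrow> real) \<times> ('w \<Rightarrow> real) \<Rightarrow> real" where
  "dPH M J e lam z w =
     sqrt (Hnorm2 M J e lam 2 (\<lambda>x. fst z x - fst w x) + (nrm M (\<lambda>x. snd z x - snd w x))^2)"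

definition normPH ::
  "'w measure \<Rightarrow> nat set \<Rightarrow> (nat \<Rightarrow> 'w \<Rightarrow> real) \<Rightarrow> (nat \<Rightarrow> real)
   \<Rightarrow> ('w \<Rightarrow> real) \<times> ('w \<Rightarrow> real) \<Rightarrow> real" where
  "normPH M J e lam z = sqrt (Hnorm2 M J e lam 2 (fst z) + (nrm M (snd z))^2)"

text \<open>Weak solution on [0,\<infinity>) of
  u_tt + A u + u_t - (p - ||u||_1^2) A^(1/2) u + k^2 u^+ = f,  (u(0),u_t(0)) = z.
  sol t = (u(t), u_t(t)); sol is continuous into \<H>, and the equation holds in the
  weak (Galerkin) sense: tested against every eigenfunction e_j, integrated in time.\<close>
definition weak_sol ::
  "'w measure \<Rightarrow> nat set \<Rightarrow> (nat \<Rightarrow> 'w \<Rightarrow> real) \<Rightarrow> (nat \<Rightarrow> real) \<Rightarrow> real \<Rightarrow> real \<Rightarrow> ('w \<Rightarrow> real)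
   \<Rightarrow> ('w \<Rightarrow> real) \<times> ('w \<Rightarrow> real) \<Rightarrow> (real \<Rightarrow> ('w \<Rightarrow> real) \<times> ('w \<Rightarrow> real)) \<Rightarrow> bool" where
  "weak_sol M J e lam p k f z sol \<longleftrightarrow>
     (\<forall>t\<ge>0. sol t \<in> PH M J e lam) \<and>
     (\<forall>t\<ge>0. \<forall>\<epsilon>>0. \<exists>\<delta>>0. \<forall>s\<ge>0. \<bar>s - t\<bar> < \<delta> \<longrightarrow> dPH M J e lam (sol s) (sol t) < \<epsilon>) \<and>
     dPH M J e lam (sol 0) z = 0 \<and>
     (\<forall>j\<in>J. \<forall>t\<ge>0.
        coef M e j (fst (sol t)) =
          coef M e j (fst (sol 0)) + integral {0..t} (\<lambda>s. coef M e j (snd (sol s))) \<and>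
        coef M e j (snd (sol t)) =
          coef M e j (snd (sol 0)) + integral {0..t} (\<lambda>s.
             coef M e j f - lam j * coef M e j (fst (sol s)) - coef M e j (snd (sol s))
             + (p - Hnorm2 M J e lam 1 (fst (sol s))) * sqrt (lam j) * coef M e j (fst (sol s))
             - k^2 * coef M e j (pos (fst (sol s)))))"

definition Sg ::
  "'w measure \<Rightarrow> nat set \<Rightarrow> (nat \<Rightarrow> 'w \<Rightarrow> real) \<Rightarrow> (nat \<Rightarrow> real) \<Rightarrow> real \<Rightarrow> real \<Rightarrow> ('w \<Rightarrow> real)
   \<Rightarrow> real \<Rightarrow> ('w \<Rightarrow> real) \<times> ('w \<Rightarrow> real) \<Rightarrow> ('w \<Rightarrow> real) \<times> ('w \<Rightarrow> real)" where
  "Sg M J e lam p k f t z = (SOME sol. weak_sol M J e lam p k f z sol) t"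

text \<open>stationary points: (u,0), u weak solution of A u - (p - ||u||_1^2) A^(1/2) u + k^2 u^+ = f\<close>
definition stationary ::
  "'w measure \<Rightarrow> nat set \<Rightarrow> (nat \<Rightarrow> 'w \<Rightarrow> real) \<Rightarrow> (nat \<Rightarrow> real) \<Rightarrow> real \<Rightarrow> real \<Rightarrow> ('w \<Rightarrow> real)
   \<Rightarrow> (('w \<Rightarrow> real) \<times> ('w \<Rightarrow> real)) set" where
  "stationary M J e lam p k f =
     {(u, \<lambda>x. 0) | u. u \<in> Hr M J e lam 2 \<and>
        (\<forall>j\<in>J. lam j * coef M e j u - (p - Hnorm2 M J e lam 1 u) * sqrt (lam j) * coef M e j u
                 + k^2 * coef M e j (pos u) = coef M e j f)}"

definition set_eqH ::
  "'w measure \<Rightarrow> nat set \<Rightarrow> (nat \<Rightarrow> 'w \<Rightarrow> real) \<Rightarrow> (nat \<Rightarrow> real)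
   \<Rightarrow> (('w \<Rightarrow> real) \<times> ('w \<Rightarrow> real)) set \<Rightarrow> (('w \<Rightarrow> real) \<times> ('w \<Rightarrow> real)) set \<Rightarrow> bool" where
  "set_eqH M J e lam X Y \<longleftrightarrow>
     (\<forall>x\<in>X. \<exists>y\<in>Y. dPH M J e lam x y = 0) \<and> (\<forall>y\<in>Y. \<exists>x\<in>X. dPH M J e lam x y = 0)"

definition boundedH ::
  "'w measure \<Rightarrow> nat set \<Rightarrow> (nat \<Rightarrow> 'w \<Rightarrow> real) \<Rightarrow> (nat \<Rightarrow> real)
   \<Rightarrow> (('w \<Rightarrow> real) \<times> ('w \<Rightarrow> real)) set \<Rightarrow> bool" where
  "boundedH M J e lam B \<longleftrightarrow> B \<subseteq> PH M J e lam \<and> (\<exists>R. \<forall>b\<in>B. normPH M J e lam b \<le> R)"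

definition compactH ::
  "'w measure \<Rightarrow> nat set \<Rightarrow> (nat \<Rightarrow> 'w \<Rightarrow> real) \<Rightarrow> (nat \<Rightarrow> real)
   \<Rightarrow> (('w \<Rightarrow> real) \<times> ('w \<Rightarrow> real)) set \<Rightarrow> bool" where
  "compactH M J e lam K \<longleftrightarrow> K \<subseteq> PH M J e lam \<and>
     (\<forall>x :: nat \<Rightarrow> ('w \<Rightarrow> real) \<times> ('w \<Rightarrow> real). (\<forall>n. x n \<in> K) \<longrightarrow>
        (\<exists>r y. strict_mono r \<and> y \<in> K \<and> (\<lambda>n. dPH M J e lam (x (r n)) y) \<longlonglongrightarrow> 0))"

definition openH ::
  "'w measure \<Rightarrow> nat set \<Rightarrow> (nat \<Rightarrow> 'w \<Rightarrow> real) \<Rightarrow> (nat \<Rightarrow> real)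
   \<Rightarrow> (('w \<Rightarrow> real) \<times> ('w \<Rightarrow> real)) set \<Rightarrow> bool" where
  "openH M J e lam U \<longleftrightarrow> U \<subseteq> PH M J e lam \<and>
     (\<forall>x\<in>U. \<exists>\<epsilon>>0. \<forall>y\<in>PH M J e lam. dPH M J e lam x y < \<epsilon> \<longrightarrow> y \<in> U)"

definition connectedH ::
  "'w measure \<Rightarrow> nat set \<Rightarrow> (nat \<Rightarrow> 'w \<Rightarrow> real) \<Rightarrow> (nat \<Rightarrow> real)
   \<Rightarrow> (('w \<Rightarrow> real) \<times> ('w \<Rightarrow> real)) set \<Rightarrow> bool" where
  "connectedH M J e lam K \<longleftrightarrow>
     \<not> (\<exists>U V. openH M J e lam U \<and> openH M J e lam V \<and> K \<subseteq> U \<union> V \<and> U \<inter> V \<inter> K = {}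
              \<and> U \<inter> K \<noteq> {} \<and> V \<inter> K \<noteq> {})"

definition global_attractor ::
  "'w measure \<Rightarrow> nat set \<Rightarrow> (nat \<Rightarrow> 'w \<Rightarrow> real) \<Rightarrow> (nat \<Rightarrow> real) \<Rightarrow> real \<Rightarrow> real \<Rightarrow> ('w \<Rightarrow> real)
   \<Rightarrow> (('w \<Rightarrow> real) \<times> ('w \<Rightarrow> real)) set \<Rightarrow> bool" where
  "global_attractor M J e lam p k f At \<longleftrightarrow>
     compactH M J e lam At \<and>
     (\<forall>B. boundedH M J e lam B \<longrightarrow>
        (\<forall>\<epsilon>>0. \<exists>T. \<forall>t\<ge>T. \<forall>b\<in>B. \<exists>a\<in>At. dPH M J e lam (Sg M J e lam p k f t b) a < \<epsilon>)) \<and>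
     (\<forall>t\<ge>0. set_eqH M J e lam (Sg M J e lam p k f t ` At) At)"

definition complete_traj ::
  "'w measure \<Rightarrow> nat set \<Rightarrow> (nat \<Rightarrow> 'w \<Rightarrow> real) \<Rightarrow> (nat \<Rightarrow> real) \<Rightarrow> real \<Rightarrow> real \<Rightarrow> ('w \<Rightarrow> real)
   \<Rightarrow> (real \<Rightarrow> ('w \<Rightarrow> real) \<times> ('w \<Rightarrow> real)) \<Rightarrow> bool" where
  "complete_traj M J e lam p k f z \<longleftrightarrow>
     (\<forall>\<tau>. z \<tau> \<in> PH M J e lam) \<and>
     (\<forall>t\<ge>0. \<forall>\<tau>. dPH M J e lam (Sg M J e lam p k f t (z \<tau>)) (z (t + \<tau>)) = 0)"

definition unstable_set ::
  "'w measure \<Rightarrow> nat set \<Rightarrow> (nat \<Rightarrow> 'w \<Rightarrow> real) \<Rightarrow> (nat \<Rightarrow> real) \<Rightarrow> real \<Rightarrow> real \<Rightarrow> ('w \<Rightarrow> real)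
   \<Rightarrow> (('w \<Rightarrow> real) \<times> ('w \<Rightarrow> real)) set" where
  "unstable_set M J e lam p k f =
     {z 0 | z. complete_traj M J e lam p k f z \<and>
        (\<exists>R. \<forall>t. normPH M J e lam (z t) \<le> R) \<and>
        (\<forall>\<epsilon>>0. \<exists>T. \<forall>t\<ge>T. \<exists>s\<in>stationary M J e lam p k f. dPH M J e lam (z (-t)) s < \<epsilon>)}"

end

theory Submission
  imports Defs
begin

text \<open>
In the eigenfunction coordinates \<open>x = A\<^sup>1\<^sup>/\<^sup>2 u\<close>, \<open>y = \<partial>\<^sub>t u\<close> the phase space is a closed subspace of
\<open>\<ell>\<^sup>2 \<times> \<ell>\<^sup>2\<close>, and the equation is a family of damped oscillators
\<open>x\<^sub>j' = \<omega>\<^sub>j y\<^sub>j\<close>, \<open>y\<^sub>j' = - \<omega>\<^sub>j x\<^sub>j - y\<^sub>j + \<beta> x\<^sub>j + r\<^sub>j\<close> coupled only through the scalar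
\<open>\<beta> = p - \<parallel>u\<parallel>\<^sub>1\<^sup>2\<close> and through \<open>r = f - k\<^sup>2 u\<^sup>+\<close>.  The energy is a strict Lyapunov function, and adding a
small multiple of \<open>\<langle>u, \<partial>\<^sub>t u\<rangle>\<close> to it yields an absorbing ball.  Where \<open>\<omega>\<^sub>j\<close> is large compared with
\<open>\<beta>\<close> and \<open>\<beta>'\<close>, a modified energy of the single mode decays exponentially up to the size of \<open>r\<^sub>j\<close>.
Since \<open>A\<^sup>-\<^sup>1\<^sup>/\<^sup>2\<close> is compact and \<open>u \<mapsto> u\<^sup>+\<close> is a contraction, the high modes of \<open>r\<close> are uniformly small along
bounded trajectories; hence the flow is asymptotically compact and the limit set of the absorbing
ball is the attractor.  The same decay estimate, applied to the time difference quotients of a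
complete bounded trajectory from time \<open>- \<infinity>\<close> on, bounds \<open>\<partial>\<^sub>t u\<close> in \<open>H\<^sup>2\<close> and \<open>\<partial>\<^sub>t\<^sup>2 u\<close> in \<open>H\<close>, and the equation
then bounds \<open>u\<close> in \<open>H\<^sup>4\<close>.  The Lyapunov function is constant along the forward orbit of every
backward limit point, which is therefore stationary.
\<close>

section \<open>The sequence space\<close>

text \<open>The given phase space consists of representatives, so its distance is only a
  pseudometric. All arguments are therefore carried out in the Hilbert space of coefficients and
  pulled back at the end; the attractor obtained is the set of all representatives of a compact set
  of coefficients. The positive part enters the dynamics only through three facts: it is a
  contraction, its product with its argument is nonnegative, and it is the gradient of half the
  squared norm of the positive part. Two obstacles shape the estimates. A weak solution is
  differentiable mode by mode but not in norm, so energy identities are proved for partial sums and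
  passed to the limit under a time integral. And the flow does not smooth initial data, so
  compactness must come from the decay of high modes; this decay has to tolerate the time-dependent
  coefficient \<beta>, which is bounded but not small, and does so because the frequencies are
  eventually large compared with it.\<close>

lemma summable_mult_of_squares:
  fixes a b :: "nat \<Rightarrow> real"
  assumes "summable (\<lambda>n. (a n)\<^sup>2)" "summable (\<lambda>n. (b n)\<^sup>2)"
  shows "summable (\<lambda>n. a n * b n)"
proof (rule summable_comparison_test'[where g = "\<lambda>n. (a n)\<^sup>2 + (b n)\<^sup>2" and N = 0])
  show "summable (\<lambda>n. (a n)\<^sup>2 + (b n)\<^sup>2)"
    using assms by (rule summable_add)
  fix n :: nat
  have "2 * (\<bar>a n\<bar> * \<bar>b n\<bar>) \<le> (a n)\<^sup>2 + (b n)\<^sup>2"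
    using sum_squares_bound[of "\<bar>a n\<bar>" "\<bar>b n\<bar>"] by (simp add: mult.assoc)
  moreover have "0 \<le> \<bar>a n\<bar> * \<bar>b n\<bar>" by simp
  ultimately show "norm (a n * b n) \<le> (a n)\<^sup>2 + (b n)\<^sup>2"
    unfolding real_norm_def abs_mult by linarith
qed

text \<open>All natural numbers serve as indices, also when the eigenfunctions are indexed by a
  proper or finite subset \<open>J\<close>; the spare coordinates are later forced to be 0 by
  \<open>phase\<close> and \<open>supported\<close>.\<close>

typedef l2 = "{a :: nat \<Rightarrow> real. summable (\<lambda>n. (a n)\<^sup>2)}"
  morphisms coord Abs_l2
  by (rule exI[of _ "\<lambda>_. 0"]) simp

setup_lifting type_definition_l2

lemma summable_coord: "summable (\<lambda>n. (coord x n)\<^sup>2)"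
  using coord[of x] by simp

lemma coord_Abs_l2: "summable (\<lambda>n. (a n)\<^sup>2) \<Longrightarrow> coord (Abs_l2 a) = a"
  by (simp add: Abs_l2_inverse)

lemma l2_eqI: "(\<And>n. coord x n = coord y n) \<Longrightarrow> x = y"
  by (simp add: coord_inject[symmetric] fun_eq_iff)

instantiation l2 :: real_vector
begin

lift_definition zero_l2 :: l2 is "\<lambda>_. 0" by simp

lift_definition plus_l2 :: "l2 \<Rightarrow> l2 \<Rightarrow> l2" is "\<lambda>a b n. a n + b n"
proof -
  fix a b :: "nat \<Rightarrow> real"
  assume *: "summable (\<lambda>n. (a n)\<^sup>2)" "summable (\<lambda>n. (b n)\<^sup>2)"
  have "summable (\<lambda>n. (a n)\<^sup>2 + (b n)\<^sup>2 + 2 * (a n * b n))"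
    by (intro summable_add summable_mult summable_mult_of_squares *)
  then show "summable (\<lambda>n. (a n + b n)\<^sup>2)"
    by (simp add: power2_sum mult.assoc)
qed

lift_definition uminus_l2 :: "l2 \<Rightarrow> l2" is "\<lambda>a n. - a n" by simp

lift_definition scaleR_l2 :: "real \<Rightarrow> l2 \<Rightarrow> l2" is "\<lambda>c a n. c * a n"
  by (simp add: power_mult_distrib summable_mult)

definition minus_l2 :: "l2 \<Rightarrow> l2 \<Rightarrow> l2" where
  "minus_l2 x y = x + - y"

lemma coord_simps [simp]:
  "coord 0 n = 0"
  "coord (x + y) n = coord x n + coord y n"
  "coord (- x) n = - coord x n"
  "coord (x - y) n = coord x n - coord y n"
  "coord (c *\<^sub>R x) n = c * coord x n"
  by (simp_all add: zero_l2.rep_eq plus_l2.rep_eq uminus_l2.rep_eq scaleR_l2.rep_eq minus_l2_def)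

instance
  by standard (rule l2_eqI, simp add: algebra_simps)+

end

instantiation l2 :: real_inner
begin

definition inner_l2 :: "l2 \<Rightarrow> l2 \<Rightarrow> real" where
  "inner_l2 x y = (\<Sum>n. coord x n * coord y n)"

definition norm_l2 :: "l2 \<Rightarrow> real" where
  "norm_l2 x = sqrt (inner x x)"

definition sgn_l2 :: "l2 \<Rightarrow> l2" where
  "sgn_l2 x = x /\<^sub>R norm x"

definition dist_l2 :: "l2 \<Rightarrow> l2 \<Rightarrow> real" where
  "dist_l2 x y = norm (x - y)"

definition uniformity_l2 :: "(l2 \<times> l2) filter" where
  "uniformity_l2 = (INF e\<in>{0<..}. principal {(x, y). dist x y < e})"

definition open_l2 :: "l2 set \<Rightarrow> bool" where
  "open_l2 U \<longleftrightarrow> (\<forall>x\<in>U. eventually (\<lambda>(x', y). x' = x \<longrightarrow> y \<in> U) uniformity)"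

instance
proof
  fix x y z :: l2 and c :: real
  have s: "summable (\<lambda>n. coord u n * coord v n)" for u v
    by (intro summable_mult_of_squares summable_coord)
  show "inner x y = inner y x"
    by (simp add: inner_l2_def mult.commute)
  show "inner (x + y) z = inner x z + inner y z"
    by (simp add: inner_l2_def distrib_right suminf_add s)
  show "inner (c *\<^sub>R x) y = c * inner x y"
    by (simp add: inner_l2_def mult.assoc suminf_mult s)
  show "0 \<le> inner x x"
    by (simp add: inner_l2_def suminf_nonneg s)
  have "(\<Sum>n. coord x n * coord x n) = 0 \<longleftrightarrow> (\<forall>n. coord x n * coord x n = 0)"
    by (rule suminf_eq_zero_iff) (simp_all add: s)
  moreover have "x = 0 \<longleftrightarrow> (\<forall>n. coord x n = 0)"
    using l2_eqI[of x 0] by auto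
  moreover have "coord x n * coord x n = 0 \<longleftrightarrow> coord x n = 0" for n
    by simp
  ultimately show "inner x x = 0 \<longleftrightarrow> x = 0"
    unfolding inner_l2_def by (simp only:)
  show "norm x = sqrt (inner x x)" by (rule norm_l2_def)
  show "sgn x = x /\<^sub>R norm x" by (rule sgn_l2_def)
  show "dist x y = norm (x - y)" by (rule dist_l2_def)
  show "uniformity = (INF e\<in>{0<..}. principal {(x :: l2, y). dist x y < e})"
    by (rule uniformity_l2_def)
  show "open U \<longleftrightarrow> (\<forall>x\<in>U. eventually (\<lambda>(x', y). x' = x \<longrightarrow> y \<in> U) uniformity)" for U :: "l2 set"
    by (rule open_l2_def)
qed

end

lemma inner_l2_sums: "(\<lambda>n. coord x n * coord y n) sums inner x y"
  unfolding inner_l2_def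
  by (intro summable_sums summable_mult_of_squares summable_coord)

lemma norm_l2_sums: "(\<lambda>n. (coord x n)\<^sup>2) sums (norm x)\<^sup>2"
  using inner_l2_sums[of x x] unfolding power2_norm_eq_inner power2_eq_square[of "coord _ _"] .

lemma inner_l2_limit: "(\<lambda>n. \<Sum>j<n. coord x j * coord y j) \<longlonglongrightarrow> inner x y"
  using inner_l2_sums sums_def by blast

lemma sum_coord_le:
  assumes "finite F"
  shows "(\<Sum>j\<in>F. (coord x j)\<^sup>2) \<le> (norm x)\<^sup>2"
  using sum_le_suminf[OF summable_coord assms] sums_unique[OF norm_l2_sums] by simp

lemma abs_coord_le: "\<bar>coord x j\<bar> \<le> norm x"
  using sum_coord_le[of "{j}" x] abs_le_square_iff[of "coord x j" "norm x"] by simp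

lemma norm_l2_le:
  assumes "\<And>n. (\<Sum>j<n. (coord x j)\<^sup>2) \<le> B\<^sup>2" "0 \<le> B"
  shows "norm x \<le> B"
proof -
  have "(\<lambda>n. \<Sum>j<n. (coord x j)\<^sup>2) \<longlonglongrightarrow> (norm x)\<^sup>2"
    using norm_l2_sums sums_def by blast
  then have "(norm x)\<^sup>2 \<le> B\<^sup>2"
    by (rule LIMSEQ_le_const2) (use assms(1) in blast)
  then show ?thesis
    using assms(2) by (rule power2_le_imp_le)
qed

lemma summable_of_bounded_partial_sums:
  fixes a :: "nat \<Rightarrow> real"
  assumes "\<And>n. 0 \<le> a n" "\<And>n. (\<Sum>j<n. a j) \<le> B"
  shows "summable a"
  by (rule summableI_nonneg_bounded[of a B]) (use assms in auto)

lemma bounded_linear_coord: "bounded_linear (\<lambda>x. coord x j)"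
  by (rule bounded_linear_intro[where K = 1]) (simp_all add: abs_coord_le)

lemmas continuous_on_coord = bounded_linear.continuous_on[OF bounded_linear_coord]

text \<open>A Cauchy sequence converges in every coordinate. Bounds on finite partial sums survive
  this limit, which puts the limit into the space and also turns the Cauchy estimate into
  convergence in norm.\<close>

instance l2 :: complete_space
proof
  fix X :: "nat \<Rightarrow> l2"
  assume X: "Cauchy X"
  have "Cauchy (\<lambda>m. coord (X m) j)" for j
    by (rule bounded_linear.Cauchy[OF bounded_linear_coord X])
  then have "\<exists>c. (\<lambda>m. coord (X m) j) \<longlonglongrightarrow> c" for j
    by (simp add: Cauchy_convergent_iff convergent_def)
  then obtain c where c: "\<And>j. (\<lambda>m. coord (X m) j) \<longlonglongrightarrow> c j"
    by metis
  obtain B where B: "\<And>m. norm (X m) \<le> B"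
    using Cauchy_Bseq[OF X] by (auto simp: Bseq_def)
  have "(\<Sum>j<n. (c j)\<^sup>2) \<le> B\<^sup>2" for n
  proof (rule LIMSEQ_le_const2)
    show "(\<lambda>m. \<Sum>j<n. (coord (X m) j)\<^sup>2) \<longlonglongrightarrow> (\<Sum>j<n. (c j)\<^sup>2)"
      by (intro tendsto_intros c)
    show "\<exists>N. \<forall>m\<ge>N. (\<Sum>j<n. (coord (X m) j)\<^sup>2) \<le> B\<^sup>2"
      using order_trans[OF sum_coord_le power_mono[OF B norm_ge_zero]] by blast
  qed
  then have "summable (\<lambda>j. (c j)\<^sup>2)"
    by (intro summable_of_bounded_partial_sums) auto
  then have L: "coord (Abs_l2 c) j = c j" for j
    by (simp add: coord_Abs_l2)
  have "X \<longlonglongrightarrow> Abs_l2 c"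
  proof (rule metric_LIMSEQ_I)
    fix r :: real assume r: "0 < r"
    then obtain N where N: "\<And>m n. m \<ge> N \<Longrightarrow> n \<ge> N \<Longrightarrow> dist (X m) (X n) < r / 2"
      using metric_CauchyD[OF X, of "r / 2"] by auto
    have "dist (X m) (Abs_l2 c) < r" if m: "m \<ge> N" for m
    proof -
      have "(\<Sum>j<n. (coord (X m - Abs_l2 c) j)\<^sup>2) \<le> (r / 2)\<^sup>2" for n
      proof (rule LIMSEQ_le_const2)
        show "(\<lambda>i. \<Sum>j<n. (coord (X m - X i) j)\<^sup>2) \<longlonglongrightarrow> (\<Sum>j<n. (coord (X m - Abs_l2 c) j)\<^sup>2)"
          unfolding coord_simps L by (intro tendsto_intros c)
        have "(\<Sum>j<n. (coord (X m - X i) j)\<^sup>2) \<le> (r / 2)\<^sup>2" if "i \<ge> N" for i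
        proof -
          have "(norm (X m - X i))\<^sup>2 \<le> (r / 2)\<^sup>2"
            using N[OF m that] by (intro power_mono) (auto simp: dist_norm)
          then show ?thesis
            using sum_coord_le[of "{..<n}" "X m - X i"] by simp
        qed
        then show "\<exists>N. \<forall>i\<ge>N. (\<Sum>j<n. (coord (X m - X i) j)\<^sup>2) \<le> (r / 2)\<^sup>2"
          by blast
      qed
      then have "norm (X m - Abs_l2 c) \<le> r / 2"
        using r by (intro norm_l2_le) auto
      then show ?thesis
        using r by (simp add: dist_norm)
    qed
    then show "\<exists>N. \<forall>m\<ge>N. dist (X m) (Abs_l2 c) < r"
      by blast
  qed
  then show "convergent X"
    by (auto simp: convergent_def)
qed

instance l2 :: banach ..

section \<open>Diagonal operators, truncations and compact sets\<close>

definition diag :: "(nat \<Rightarrow> real) \<Rightarrow> l2 \<Rightarrow> l2" where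
  "diag m x = Abs_l2 (\<lambda>j. m j * coord x j)"

lemma sum_diag_le:
  fixes m :: "nat \<Rightarrow> real"
  assumes "\<And>j. j \<in> F \<Longrightarrow> \<bar>m j\<bar> \<le> B"
  shows "(\<Sum>j\<in>F. (m j * c j)\<^sup>2) \<le> B\<^sup>2 * (\<Sum>j\<in>F. (c j)\<^sup>2)"
proof -
  have "(m j * c j)\<^sup>2 \<le> B\<^sup>2 * (c j)\<^sup>2" if "j \<in> F" for j
    using power_mono[OF assms[OF that], of 2] unfolding power_mult_distrib
    by (intro mult_right_mono) auto
  then show ?thesis
    unfolding sum_distrib_left by (rule sum_mono)
qed

text \<open>\<open>diag\<close> applies \<open>Abs_l2\<close> to a sequence that need not be square
  summable; a bound on the multipliers makes it so, which is why the facts about \<open>diag\<close>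
  carry such a bound.\<close>

lemma coord_diag:
  assumes "\<And>j. \<bar>m j\<bar> \<le> B"
  shows "coord (diag m x) j = m j * coord x j"
proof -
  have "(\<Sum>j<n. (m j * coord x j)\<^sup>2) \<le> B\<^sup>2 * (norm x)\<^sup>2" for n
    by (rule order_trans[OF sum_diag_le mult_left_mono[OF sum_coord_le]]) (use assms in auto)
  then have "summable (\<lambda>j. (m j * coord x j)\<^sup>2)"
    by (intro summable_of_bounded_partial_sums) auto
  then show ?thesis
    by (simp add: diag_def coord_Abs_l2)
qed

lemma norm_diag_le:
  assumes "\<And>j. \<bar>m j\<bar> \<le> B"
  shows "norm (diag m x) \<le> B * norm x"
proof (rule norm_l2_le)
  have B: "0 \<le> B"
    using assms[of 0] by linarith
  then show "0 \<le> B * norm x" by simp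
  show "(\<Sum>j<n. (coord (diag m x) j)\<^sup>2) \<le> (B * norm x)\<^sup>2" for n
  proof -
    have "(\<Sum>j<n. (m j * coord x j)\<^sup>2) \<le> B\<^sup>2 * (\<Sum>j<n. (coord x j)\<^sup>2)"
      using assms by (intro sum_diag_le)
    also have "\<dots> \<le> B\<^sup>2 * (norm x)\<^sup>2"
      by (intro mult_left_mono sum_coord_le) auto
    finally show ?thesis
      by (simp add: coord_diag[OF assms] power_mult_distrib)
  qed
qed

lemma bounded_linear_diag:
  assumes "\<And>j. \<bar>m j\<bar> \<le> B"
  shows "bounded_linear (diag m)"
proof (rule bounded_linear_intro[where K = B])
  show "norm (diag m x) \<le> norm x * B" for x
    using norm_diag_le[OF assms] by (simp add: mult.commute)
qed (auto intro!: l2_eqI simp: coord_diag[OF assms] algebra_simps)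

definition trunc :: "nat \<Rightarrow> l2 \<Rightarrow> l2" where
  "trunc n = diag (\<lambda>j. if j < n then 1 else 0)"

lemma coord_trunc [simp]: "coord (trunc n x) j = (if j < n then coord x j else 0)"
  unfolding trunc_def by (subst coord_diag[where B = 1]) auto

lemma norm_trunc_le: "norm (trunc n x) \<le> norm x"
  using norm_diag_le[of "\<lambda>j. if j < n then 1 else 0" 1 x] by (simp add: trunc_def)

lemma norm_tail_le: "norm (x - trunc n x) \<le> norm x"
proof (rule norm_l2_le)
  show "(\<Sum>j<m. (coord (x - trunc n x) j)\<^sup>2) \<le> (norm x)\<^sup>2" for m
    by (rule order_trans[OF sum_mono sum_coord_le[of "{..<m}"]]) auto
qed simp

lemma tail_tendsto_0: "(\<lambda>n. norm (x - trunc n x)) \<longlonglongrightarrow> 0"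
proof -
  have eq: "(norm (x - trunc n x))\<^sup>2 = (norm x)\<^sup>2 - (\<Sum>j<n. (coord x j)\<^sup>2)" for n
  proof -
    have "(\<lambda>j. (coord (trunc n x) j)\<^sup>2) sums (\<Sum>j<n. (coord (trunc n x) j)\<^sup>2)"
      by (rule sums_finite) auto
    then have "(\<lambda>j. (coord x j)\<^sup>2 - (coord (trunc n x) j)\<^sup>2) sums ((norm x)\<^sup>2 - (\<Sum>j<n. (coord x j)\<^sup>2))"
      by (intro sums_diff norm_l2_sums) simp
    moreover have "(coord x j)\<^sup>2 - (coord (trunc n x) j)\<^sup>2 = (coord (x - trunc n x) j)\<^sup>2" for j
      by simp
    ultimately show ?thesis
      using norm_l2_sums[of "x - trunc n x"] by (simp only: sums_unique2)
  qed
  have "(\<lambda>n. (norm x)\<^sup>2 - (\<Sum>j<n. (coord x j)\<^sup>2)) \<longlonglongrightarrow> (norm x)\<^sup>2 - (norm x)\<^sup>2"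
    using norm_l2_sums[of x] unfolding sums_def by (intro tendsto_intros)
  then have "(\<lambda>n. sqrt ((norm (x - trunc n x))\<^sup>2)) \<longlonglongrightarrow> sqrt 0"
    unfolding eq by (intro tendsto_real_sqrt) simp
  then show ?thesis by simp
qed

text \<open>A finite net reduces the claim to finitely many tails, because passing to the tail does
  not increase distances (\<open>norm_tail_le\<close>).\<close>

lemma compact_uniform_tails:
  assumes "compact C" "0 < \<epsilon>"
  shows "\<exists>n0. \<forall>n\<ge>n0. \<forall>c\<in>C. norm (c - trunc n c) < \<epsilon>"
proof -
  obtain T where T: "finite T" "C \<subseteq> (\<Union>x\<in>T. ball x (\<epsilon> / 2))"
    using assms compact_eq_totally_bounded[of C] by (meson half_gt_zero)
  have "\<forall>t\<in>T. \<exists>n0. \<forall>n\<ge>n0. norm (t - trunc n t) < \<epsilon> / 2"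
    using LIMSEQ_D[OF tail_tendsto_0, of "\<epsilon> / 2"] assms(2) by simp
  then obtain g where g: "\<And>t n. t \<in> T \<Longrightarrow> n \<ge> g t \<Longrightarrow> norm (t - trunc n t) < \<epsilon> / 2"
    by metis
  have "norm (c - trunc n c) < \<epsilon>" if c: "c \<in> C" and n: "n \<ge> Max (g ` T)" for n c
  proof -
    obtain t where t: "t \<in> T" "dist t c < \<epsilon> / 2"
      using T(2) c by (auto simp: subset_eq)
    have "n \<ge> g t"
      using n t(1) T(1) by (meson Max_ge finite_imageI image_eqI order_trans)
    have "c - trunc n c = (t - trunc n t) + ((c - t) - trunc n (c - t))"
      by (intro l2_eqI) simp
    then have "norm (c - trunc n c) \<le> norm (t - trunc n t) + norm ((c - t) - trunc n (c - t))"
      by (metis norm_triangle_ineq)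
    also have "\<dots> < \<epsilon> / 2 + \<epsilon> / 2"
      using g[OF t(1) \<open>n \<ge> g t\<close>] norm_tail_le[of "c - t" n] t(2)
      by (simp add: dist_norm norm_minus_commute)
    finally show ?thesis by simp
  qed
  then show ?thesis by blast
qed

definition basis_vector :: "nat \<Rightarrow> l2" where
  "basis_vector i = Abs_l2 (\<lambda>j. if j = i then 1 else 0)"

lemma coord_basis_vector [simp]: "coord (basis_vector i) j = (if j = i then 1 else 0)"
proof -
  have "summable (\<lambda>j. (if j = i then 1 else 0 :: real)\<^sup>2)"
    by (rule summable_finite[of "{i}"]) auto
  then show ?thesis
    by (simp add: basis_vector_def coord_Abs_l2)
qed

text \<open>A compact superset suffices for finding finite nets, and it can be taken as a sum of
  segments: each new coordinate contributes one.\<close>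

lemma compact_trunc_superset: "\<exists>C. compact C \<and> trunc n ` cball 0 R \<subseteq> C"
proof (induction n)
  case 0
  have "trunc 0 x = 0" for x
    by (rule l2_eqI) simp
  then have "compact {0 :: l2} \<and> trunc 0 ` cball 0 R \<subseteq> {0}"
    by (simp add: image_subset_iff)
  then show ?case by blast
next
  case (Suc n)
  then obtain C where C: "compact C" "trunc n ` cball 0 R \<subseteq> C" by blast
  have "compact ((\<lambda>c. c *\<^sub>R basis_vector n) ` {-R..R})"
    by (rule compact_continuous_image) (auto intro!: continuous_intros)
  then have "compact {a + b |a b. a \<in> C \<and> b \<in> (\<lambda>c. c *\<^sub>R basis_vector n) ` {-R..R}}"
    using C(1) by (rule compact_sums[rotated])
  moreover have "trunc (Suc n) x \<in> {a + b |a b. a \<in> C \<and> b \<in> (\<lambda>c. c *\<^sub>R basis_vector n) ` {-R..R}}"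
    if "x \<in> cball 0 R" for x
  proof -
    have "trunc (Suc n) x = trunc n x + coord x n *\<^sub>R basis_vector n"
      by (rule l2_eqI) (simp add: less_Suc_eq)
    moreover have "trunc n x \<in> C"
      using C(2) that by blast
    moreover have "coord x n \<in> {-R..R}"
      using that abs_coord_le[of x n] by (auto simp: abs_le_iff)
    ultimately show ?thesis by blast
  qed
  ultimately show ?case by blast
qed

text \<open>Total boundedness: the multipliers from \<open>n\<close> on are below \<open>d\<close>,
  so the tail of the image is uniformly small, and the remaining head lies in a compact set.\<close>

lemma relatively_compact_diag_cball:
  assumes m: "\<And>j. \<bar>m j\<bar> \<le> B" and lim: "m \<longlonglongrightarrow> 0"
  shows "compact (closure (diag m ` cball 0 R))"
proof -
  have "\<exists>T. finite T \<and> closure (diag m ` cball 0 R) \<subseteq> (\<Union>x\<in>T. ball x \<epsilon>)" if \<epsilon>: "0 < \<epsilon>" for \<epsilon>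
  proof -
    \<comment> \<open>The 1 in the denominator keeps \<open>d\<close> positive for every
      \<open>R\<close>; a multiplier bound of \<open>d\<close> leaves tails of norm at most
      \<epsilon>/4 over the ball.\<close>
    define d where "d = \<epsilon> / (4 * (\<bar>R\<bar> + 1))"
    have d: "0 < d" "d * \<bar>R\<bar> \<le> \<epsilon> / 4"
      using \<epsilon> unfolding d_def by (simp_all add: field_simps)
    obtain n where n: "\<And>j. j \<ge> n \<Longrightarrow> \<bar>m j\<bar> < d"
      using LIMSEQ_D[OF lim d(1)] by auto
    obtain C where C: "compact C" "trunc n ` cball 0 (B * \<bar>R\<bar>) \<subseteq> C"
      using compact_trunc_superset by blast
    obtain T where T: "finite T" "C \<subseteq> (\<Union>x\<in>T. ball x (\<epsilon> / 4))"
      using C(1) \<epsilon> compact_eq_totally_bounded[of C] by (metis zero_less_divide_iff zero_less_numeral)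
    have near: "\<exists>t\<in>T. dist t (diag m x) < \<epsilon> / 2" if x: "x \<in> cball 0 R" for x
    proof -
      have xR: "norm x \<le> \<bar>R\<bar>" using x by simp
      have "diag m x - trunc n (diag m x) = diag (\<lambda>j. if j < n then 0 else m j) x"
      proof (rule l2_eqI)
        show "coord (diag m x - trunc n (diag m x)) j = coord (diag (\<lambda>j. if j < n then 0 else m j) x) j" for j
          using m abs_ge_zero[of "m 0"] order_trans[OF abs_ge_zero m]
          by (subst coord_diag[where B = B]) (auto simp: coord_diag[OF m])
      qed
      moreover have "norm (diag (\<lambda>j. if j < n then 0 else m j) x) \<le> d * norm x"
        using n d(1) by (intro norm_diag_le) (auto simp: not_less intro: less_imp_le)
      moreover have "d * norm x \<le> d * \<bar>R\<bar>"
        using xR d(1) by simp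
      ultimately have a: "norm (diag m x - trunc n (diag m x)) \<le> \<epsilon> / 4"
        using d(2) by simp
      have "norm (diag m x) \<le> B * norm x"
        by (rule norm_diag_le[OF m])
      also have "\<dots> \<le> B * \<bar>R\<bar>"
        using xR order_trans[OF abs_ge_zero m] by (intro mult_left_mono)
      finally have "trunc n (diag m x) \<in> C"
        using C(2) by (auto simp: image_subset_iff)
      then obtain t where "t \<in> T" "dist t (trunc n (diag m x)) < \<epsilon> / 4"
        using T(2) by auto
      then show ?thesis
        using a dist_triangle[of t "diag m x" "trunc n (diag m x)"]
        by (intro bexI[of _ t]) (auto simp: dist_norm norm_minus_commute)
    qed
    have "\<exists>t\<in>T. dist t y < \<epsilon>" if "y \<in> closure (diag m ` cball 0 R)" for y
    proof -
      have "\<exists>w\<in>diag m ` cball 0 R. dist w y < \<epsilon> / 2"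
        using that half_gt_zero[OF \<epsilon>] unfolding closure_approachable by blast
      then obtain x where x: "x \<in> cball 0 R" "dist (diag m x) y < \<epsilon> / 2"
        by blast
      obtain t where "t \<in> T" "dist t (diag m x) < \<epsilon> / 2"
        using near[OF x(1)] by blast
      then show ?thesis
        using x(2) dist_triangle[of t y "diag m x"] by (intro bexI[of _ t]) linarith+
    qed
    then show ?thesis
      using T(1) by (intro exI[of _ T]) (simp add: subset_eq)
  qed
  then show ?thesis
    by (auto simp: compact_eq_totally_bounded complete_eq_closed)
qed

section \<open>Attractors of dissipative semigroups\<close>

text \<open>\<open>P\<close> is a subset of the space because the coefficients in use form a proper
  subspace when \<open>J\<close> is a proper subset. Its convexity makes the intersections with
  balls connected, which is what the connectedness of the attractor rests on.\<close>

locale dissipative_semigroup =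
  fixes P :: "'a :: real_normed_vector set" and S :: "real \<Rightarrow> 'a \<Rightarrow> 'a" and R0 :: real
  assumes closed_P: "closed P"
    and convex_P: "convex P"
    and S_in_P: "\<And>t x. 0 \<le> t \<Longrightarrow> x \<in> P \<Longrightarrow> S t x \<in> P"
    and S_0: "\<And>x. x \<in> P \<Longrightarrow> S 0 x = x"
    and S_add: "\<And>s t x. 0 \<le> s \<Longrightarrow> 0 \<le> t \<Longrightarrow> x \<in> P \<Longrightarrow> S (s + t) x = S s (S t x)"
    and S_continuous: "\<And>t. 0 \<le> t \<Longrightarrow> continuous_on P (S t)"
    and absorbing: "\<And>R. \<exists>T\<ge>0. \<forall>t\<ge>T. \<forall>x\<in>P. norm x \<le> R \<longrightarrow> norm (S t x) \<le> R0"
    and asymptotically_compact: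
      "\<And>R t x. (\<And>n. real n \<le> t n) \<Longrightarrow> (\<And>n. x n \<in> P) \<Longrightarrow> (\<And>n. norm (x n) \<le> R) \<Longrightarrow>
        \<exists>r l. strict_mono (r :: nat \<Rightarrow> nat) \<and> (\<lambda>n. S (t (r n)) (x (r n))) \<longlonglongrightarrow> l"
begin

text \<open>The omega-limit set of the absorbing ball. The condition \<open>real n \<le> t n\<close>
  is a normal form: any sequence of times tending to infinity has a subsequence that satisfies
  it.\<close>

definition attractor :: "'a set" where
  "attractor = {y. \<exists>t x. (\<forall>n. real n \<le> t n \<and> x n \<in> P \<and> norm (x n) \<le> R0)
                      \<and> (\<lambda>n. S (t n) (x n)) \<longlonglongrightarrow> y}"

text \<open>After the absorbing time \<open>T\<close> the points have entered the ball of radius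
  \<open>R0\<close>. Dropping the initial \<open>m \<ge> T\<close> terms pays for the lost time, so
  that the remaining times still dominate \<open>n\<close>.\<close>

lemma limit_in_attractor:
  assumes t: "\<And>n. real n \<le> t n" and x: "\<And>n. x n \<in> P" "\<And>n. norm (x n) \<le> R"
    and lim: "(\<lambda>n. S (t n) (x n)) \<longlonglongrightarrow> y"
  shows "y \<in> attractor"
proof -
  obtain T where T: "0 \<le> T" "\<And>t x. T \<le> t \<Longrightarrow> x \<in> P \<Longrightarrow> norm x \<le> R \<Longrightarrow> norm (S t x) \<le> R0"
    using absorbing[of R] by blast
  define m where "m = nat \<lceil>T\<rceil>"
  have m: "T \<le> real m"
    unfolding m_def by (rule real_nat_ceiling_ge)
  have t': "real n \<le> t (n + m) - T" for n
    using t[of "n + m"] m by simp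
  have "S (t (n + m) - T) (S T (x (n + m))) = S (t (n + m)) (x (n + m))" for n
    using S_add[of "t (n + m) - T" T "x (n + m)"] t'[of n] T(1) x(1) by simp
  moreover have "(\<lambda>n. S (t (n + m)) (x (n + m))) \<longlonglongrightarrow> y"
    by (rule LIMSEQ_ignore_initial_segment[OF lim])
  ultimately have "(\<lambda>n. S (t (n + m) - T) (S T (x (n + m)))) \<longlonglongrightarrow> y"
    by simp
  moreover have "S T (x n) \<in> P" "norm (S T (x n)) \<le> R0" for n
    using T x S_in_P by auto
  ultimately show ?thesis
    unfolding attractor_def using t'
    by (intro CollectI exI[of _ "\<lambda>n. t (n + m) - T"] exI[of _ "\<lambda>n. S T (x (n + m))"]) blast
qed

lemma subsequence_to_attractor:
  assumes t: "\<And>n. real n \<le> t n" and x: "\<And>n. x n \<in> P" "\<And>n. norm (x n) \<le> R"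
  shows "\<exists>r l. strict_mono (r :: nat \<Rightarrow> nat) \<and> l \<in> attractor
    \<and> (\<lambda>n. S (t (r n)) (x (r n))) \<longlonglongrightarrow> l"
proof -
  obtain r l where r: "strict_mono (r :: nat \<Rightarrow> nat)" "(\<lambda>n. S (t (r n)) (x (r n))) \<longlonglongrightarrow> l"
    using asymptotically_compact[of t x R, OF t x] by blast
  have "real n \<le> t (r n)" for n
    using t[of "r n"] seq_suble[OF r(1), of n] by linarith
  then have "l \<in> attractor"
    by (rule limit_in_attractor) (use x r(2) in auto)
  with r show ?thesis by blast
qed

lemma attractor_subset: "attractor \<subseteq> P"
proof
  fix y assume "y \<in> attractor"
  then obtain t x where *: "\<And>n. real n \<le> t n" "\<And>n. x n \<in> P" "(\<lambda>n. S (t n) (x n)) \<longlonglongrightarrow> y"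
    unfolding attractor_def by blast
  have "S (t n) (x n) \<in> P" for n
    using *(1)[of n] *(2) by (intro S_in_P) linarith+
  then show "y \<in> P"
    using closed_sequentially[OF closed_P _ *(3)] by blast
qed

lemma attractor_approx:
  assumes "y \<in> attractor" "0 < \<epsilon>"
  obtains t x where "real n \<le> t" "x \<in> P" "norm x \<le> R0" "dist (S t x) y < \<epsilon>"
proof -
  obtain t x where *: "\<And>n. real n \<le> t n" "\<And>n. x n \<in> P" "\<And>n. norm (x n) \<le> R0"
      "(\<lambda>n. S (t n) (x n)) \<longlonglongrightarrow> y"
    using assms(1) unfolding attractor_def by blast
  obtain N where "\<And>m. m \<ge> N \<Longrightarrow> dist (S (t m) (x m)) y < \<epsilon>"
    using metric_LIMSEQ_D[OF *(4) assms(2)] by blast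
  then have "dist (S (t (N + n)) (x (N + n))) y < \<epsilon>" by simp
  moreover have "real n \<le> t (N + n)"
    using *(1)[of "N + n"] by simp
  ultimately show thesis
    using that *(2,3) by blast
qed

text \<open>A diagonal choice: \<open>y n\<close> is approximated within \<open>1 / Suc n\<close> by
  an orbit point at a time at least \<open>n\<close>. A subsequence of these orbit points converges
  to a point of the attractor and carries \<open>y\<close> along.\<close>

lemma compact_attractor: "compact attractor"
  unfolding compact_eq_seq_compact_metric seq_compact_def
proof (intro allI impI)
  fix y :: "nat \<Rightarrow> 'a" assume y: "\<forall>n. y n \<in> attractor"
  have "\<exists>t x. real n \<le> t \<and> x \<in> P \<and> norm x \<le> R0 \<and> dist (S t x) (y n) < 1 / Suc n" for n
    using attractor_approx[of "y n" "1 / Suc n" n] y by (metis divide_pos_pos of_nat_0_less_iff zero_less_Suc zero_less_one)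
  then obtain t x where tx: "\<And>n. real n \<le> t n" "\<And>n. x n \<in> P" "\<And>n. norm (x n) \<le> R0"
      "\<And>n. dist (S (t n) (x n)) (y n) < 1 / Suc n"
    by metis
  obtain r l where r: "strict_mono (r :: nat \<Rightarrow> nat)" "l \<in> attractor"
      "(\<lambda>n. S (t (r n)) (x (r n))) \<longlonglongrightarrow> l"
    using subsequence_to_attractor[of t x R0, OF tx(1-3)] by blast
  have "(\<lambda>n. dist (S (t n) (x n)) (y n)) \<longlonglongrightarrow> 0"
    by (rule tendsto_sandwich[OF _ _ tendsto_const LIMSEQ_Suc[OF lim_1_over_n]])
      (use tx(4) in \<open>auto intro!: always_eventually less_imp_le\<close>)
  then have "(\<lambda>n. dist (S (t (r n)) (x (r n))) (y (r n))) \<longlonglongrightarrow> 0"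
    using LIMSEQ_subseq_LIMSEQ[OF _ r(1)] unfolding o_def by blast
  then have "(\<lambda>n. dist (S (t (r n)) (x (r n))) (y (r n)) + dist (S (t (r n)) (x (r n))) l) \<longlonglongrightarrow> 0 + 0"
    by (rule tendsto_add) (use r(3) in \<open>simp add: tendsto_dist_iff[of _ l]\<close>)
  then have sum_lim: "(\<lambda>n. dist (S (t (r n)) (x (r n))) (y (r n)) + dist (S (t (r n)) (x (r n))) l) \<longlonglongrightarrow> 0"
    by simp
  have "(\<lambda>n. dist (y (r n)) l) \<longlonglongrightarrow> 0"
    by (rule tendsto_sandwich[OF _ _ tendsto_const sum_lim])
      (auto simp: dist_triangle3 intro: always_eventually)
  then have "(\<lambda>n. y (r n)) \<longlonglongrightarrow> l"
    unfolding tendsto_dist_iff[of _ l] .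
  then show "\<exists>l\<in>attractor. \<exists>r. strict_mono r \<and> (y \<circ> r) \<longlonglongrightarrow> l"
    using r by (auto simp: o_def)
qed

text \<open>Otherwise points starting in one ball would stay \<epsilon> away from the attractor at
  arbitrarily late times, against \<open>subsequence_to_attractor\<close>.\<close>

lemma attracts:
  assumes "0 < \<epsilon>"
  shows "\<exists>T\<ge>0. \<forall>t\<ge>T. \<forall>x\<in>P. norm x \<le> R \<longrightarrow> (\<exists>a\<in>attractor. dist (S t x) a < \<epsilon>)"
proof (rule ccontr)
  assume neg: "\<not> ?thesis"
  have "\<exists>t x. real n \<le> t \<and> x \<in> P \<and> norm x \<le> R \<and> (\<forall>a\<in>attractor. \<epsilon> \<le> dist (S t x) a)" for n
  proof -
    have "\<exists>t\<ge>real n. \<exists>x\<in>P. norm x \<le> R \<and> \<not> (\<exists>a\<in>attractor. dist (S t x) a < \<epsilon>)"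
      using neg of_nat_0_le_iff[of n] by blast
    then show ?thesis
      unfolding bex_simps not_less by blast
  qed
  then obtain t x where tx: "\<And>n. real n \<le> t n" "\<And>n. x n \<in> P" "\<And>n. norm (x n) \<le> R"
      "\<And>n a. a \<in> attractor \<Longrightarrow> \<epsilon> \<le> dist (S (t n) (x n)) a"
    by metis
  obtain r l where r: "strict_mono (r :: nat \<Rightarrow> nat)" "l \<in> attractor"
      "(\<lambda>n. S (t (r n)) (x (r n))) \<longlonglongrightarrow> l"
    using subsequence_to_attractor[of t x R, OF tx(1-3)] by blast
  obtain N where "dist (S (t (r N)) (x (r N))) l < \<epsilon>"
    using metric_LIMSEQ_D[OF r(3) assms] by blast
  then show False
    using tx(4)[OF r(2), of "r N"] by linarith
qed

lemma S_in_attractor: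
  assumes "0 \<le> s" "y \<in> attractor"
  shows "S s y \<in> attractor"
proof -
  obtain t x where *: "\<And>n. real n \<le> t n" "\<And>n. x n \<in> P" "\<And>n. norm (x n) \<le> R0"
      "(\<lambda>n. S (t n) (x n)) \<longlonglongrightarrow> y"
    using assms(2) unfolding attractor_def by blast
  have t0: "0 \<le> t n" for n
    using *(1)[of n] by linarith
  have "(\<lambda>n. S s (S (t n) (x n))) \<longlonglongrightarrow> S s y"
    by (rule continuous_on_tendsto_compose[OF S_continuous[OF assms(1)] *(4)])
      (use assms(2) attractor_subset S_in_P t0 *(2) in auto)
  then have "(\<lambda>n. S (s + t n) (x n)) \<longlonglongrightarrow> S s y"
    by (simp add: S_add assms(1) t0 *(2))
  then show ?thesis
    by (rule limit_in_attractor[rotated 3]) (use * assms(1) add_increasing[OF assms(1) *(1)] in auto)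
qed

text \<open>Stopping the approximating orbits \<open>s\<close> earlier and extracting a limit gives
  the preimage; the index shift \<open>m\<close> keeps the shortened times at least
  \<open>n\<close>.\<close>

lemma attractor_preimage:
  assumes s: "0 \<le> s" and y: "y \<in> attractor"
  obtains w where "w \<in> attractor" "S s w = y"
proof -
  obtain t x where *: "\<And>n. real n \<le> t n" "\<And>n. x n \<in> P" "\<And>n. norm (x n) \<le> R0"
      "(\<lambda>n. S (t n) (x n)) \<longlonglongrightarrow> y"
    using y unfolding attractor_def by blast
  define m where "m = nat \<lceil>s\<rceil>"
  have m: "s \<le> real m"
    unfolding m_def by (rule real_nat_ceiling_ge)
  have t': "real n \<le> t (n + m) - s" for n
    using *(1)[of "n + m"] m by simp
  obtain r w where r: "strict_mono (r :: nat \<Rightarrow> nat)" "w \<in> attractor"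
      "(\<lambda>n. S (t (r n + m) - s) (x (r n + m))) \<longlonglongrightarrow> w"
    using subsequence_to_attractor[of "\<lambda>n. t (n + m) - s" "\<lambda>n. x (n + m)" R0, OF t' *(2,3)] by blast
  have nn: "0 \<le> t (n + m) - s" for n
    using t'[of n] by linarith
  have "(\<lambda>n. S s (S (t (r n + m) - s) (x (r n + m)))) \<longlonglongrightarrow> S s w"
    by (rule continuous_on_tendsto_compose[OF S_continuous[OF s] r(3)])
      (use r(2) attractor_subset S_in_P nn *(2) in auto)
  then have "(\<lambda>n. S (t (r n + m)) (x (r n + m))) \<longlonglongrightarrow> S s w"
    using S_add[OF s nn *(2)] by simp
  moreover have "(\<lambda>n. S (t (r n + m)) (x (r n + m))) \<longlonglongrightarrow> y"
    using LIMSEQ_subseq_LIMSEQ[OF LIMSEQ_ignore_initial_segment[OF *(4), of m] r(1)]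
    by (simp add: o_def)
  ultimately have "S s w = y"
    by (rule LIMSEQ_unique)
  with r(2) that show thesis by blast
qed

text \<open>If the attractor split into two compact pieces, the image of a large convex set would be
  a connected set near both pieces but not meeting the gap between them.\<close>

lemma connected_attractor: "connected attractor"
proof (rule connectedI)
  fix U V assume UV: "open U" "open V" "U \<inter> attractor \<noteq> {}" "V \<inter> attractor \<noteq> {}"
    "U \<inter> V \<inter> attractor = {}" "attractor \<subseteq> U \<union> V"
  \<comment> \<open>Removing \<open>V\<close> leaves exactly the part in \<open>U\<close>, and
    conversely, so both pieces are closed in a compact set and have a positive distance.\<close>
  define A1 A2 where "A1 = attractor - V" and "A2 = attractor - U"
  have A12: "compact A1" "closed A2" "A1 \<inter> A2 = {}" "attractor = A1 \<union> A2" "A1 \<noteq> {}" "A2 \<noteq> {}"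
    using UV compact_attractor unfolding A1_def A2_def
    by (auto intro: compact_diff compact_imp_closed[OF compact_diff])
  obtain x0 where x0: "x0 \<in> A1" "\<And>x. x \<in> A1 \<Longrightarrow> infdist x0 A2 \<le> infdist x A2"
    using continuous_attains_inf[OF A12(1,5) continuous_on_infdist[OF continuous_on_id]] by blast
  obtain d where d: "0 < d" "\<And>x y. x \<in> A1 \<Longrightarrow> y \<in> A2 \<Longrightarrow> d \<le> dist x y"
  proof
    show "0 < infdist x0 A2"
      using in_closed_iff_infdist_zero[OF A12(2,6), of x0] x0(1) A12(3) infdist_nonneg[of x0 A2]
      by fastforce
    show "infdist x0 A2 \<le> dist x y" if "x \<in> A1" "y \<in> A2" for x y
      using x0(2)[OF that(1)] infdist_le[OF that(2), of x] by linarith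
  qed
  obtain R where R: "\<And>y. y \<in> attractor \<Longrightarrow> norm y \<le> R"
    using compact_imp_bounded[OF compact_attractor] unfolding bounded_iff by blast
  obtain T where T: "0 \<le> T" "\<And>x. x \<in> P \<Longrightarrow> norm x \<le> R \<Longrightarrow> \<exists>a\<in>attractor. dist (S T x) a < d / 2"
    using attracts[of "d / 2" R] d(1) by (meson half_gt_zero order_refl)
  \<comment> \<open>\<open>R\<close> bounds the attractor, so \<open>B\<close> contains it, and full
    invariance puts the attractor inside the image of \<open>B\<close> under
    \<open>S T\<close>.\<close>
  define B where "B = P \<inter> cball 0 R"
  have "connected (S T ` B)"
    unfolding B_def
    by (intro connected_continuous_image continuous_on_subset[OF S_continuous[OF T(1)]]
        convex_connected convex_Int convex_P convex_cball) auto
  moreover have sub: "attractor \<subseteq> S T ` B"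
  proof
    fix y assume "y \<in> attractor"
    then obtain w where "w \<in> attractor" "S T w = y"
      using attractor_preimage[OF T(1)] by blast
    then show "y \<in> S T ` B"
      using R attractor_subset unfolding B_def by auto
  qed
  moreover define U' V' where "U' = (\<Union>a\<in>A1. ball a (d / 2))" and "V' = (\<Union>a\<in>A2. ball a (d / 2))"
  have "open U'" "open V'"
    unfolding U'_def V'_def by auto
  moreover have "S T ` B \<subseteq> U' \<union> V'"
  proof
    fix y assume "y \<in> S T ` B"
    then obtain x where "x \<in> P" "norm x \<le> R" "y = S T x"
      unfolding B_def by auto
    then obtain a where "a \<in> attractor" "dist y a < d / 2"
      using T(2) by blast
    then show "y \<in> U' \<union> V'"
      using A12(4) unfolding U'_def V'_def by (auto simp: dist_commute)
  qed
  moreover have "U' \<inter> V' = {}"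
  proof (rule ccontr)
    assume "U' \<inter> V' \<noteq> {}"
    then obtain y a b where "a \<in> A1" "b \<in> A2" "dist a y < d / 2" "dist b y < d / 2"
      unfolding U'_def V'_def by auto
    then show False
      using d(2)[of a b] dist_triangle2[of a b y] by linarith
  qed
  moreover have "A1 \<subseteq> U'" "A2 \<subseteq> V'"
    using d(1) unfolding U'_def V'_def by auto
  then have "U' \<inter> S T ` B \<noteq> {}" "V' \<inter> S T ` B \<noteq> {}"
    using sub A12(4,5,6) by blast+
  ultimately show False
    using connectedD[of "S T ` B" U' V'] by blast
qed

section \<open>Complete orbits and their backward limits\<close>

definition complete_orbit :: "(real \<Rightarrow> 'a) \<Rightarrow> bool" where
  "complete_orbit z \<longleftrightarrow> (\<forall>\<tau>. z \<tau> \<in> P) \<and> (\<forall>t\<ge>0. \<forall>\<tau>. S t (z \<tau>) = z (t + \<tau>))"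

text \<open>\<open>z \<tau>\<close> is reached from \<open>z (\<tau> - n)\<close> in time
  \<open>n\<close>, so a constant sequence exhibits it as a limit of orbit points with bounded
  starting points.\<close>

lemma bounded_complete_orbit_in_attractor:
  assumes "complete_orbit z" "\<And>\<tau>. norm (z \<tau>) \<le> R"
  shows "z \<tau> \<in> attractor"
proof (rule limit_in_attractor)
  have "S (real n) (z (\<tau> - real n)) = z \<tau>" for n
    using assms(1) unfolding complete_orbit_def by simp
  then show "(\<lambda>n. S (real n) (z (\<tau> - real n))) \<longlonglongrightarrow> z \<tau>"
    by simp
qed (use assms in \<open>auto simp: complete_orbit_def\<close>)

lemma complete_orbit_through:
  assumes "y \<in> attractor"
  obtains z where "complete_orbit z" "z 0 = y" "\<And>\<tau>. z \<tau> \<in> attractor"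
proof -
  have "\<forall>w\<in>attractor. \<exists>w'\<in>attractor. S 1 w' = w"
    using attractor_preimage[of 1] by (metis zero_le_one)
  then obtain g where g: "\<And>w. w \<in> attractor \<Longrightarrow> g w \<in> attractor" "\<And>w. w \<in> attractor \<Longrightarrow> S 1 (g w) = w"
    by metis
  define Y where "Y n = (g ^^ n) y" for n
  have Y: "Y n \<in> attractor" "S 1 (Y (Suc n)) = Y n" for n
  proof -
    show "Y n \<in> attractor"
      by (induction n) (auto simp: Y_def assms g)
    then show "S 1 (Y (Suc n)) = Y n"
      by (simp add: Y_def g)
  qed
  have YP: "Y n \<in> P" for n
    using Y(1) attractor_subset by blast
  \<comment> \<open>\<open>Y n\<close> is to be the state at time \<open>- n\<close>. The index used
    is the least \<open>n\<close> with \<open>0 \<le> t + n\<close>, hence 0 for all nonnegative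
    \<open>t\<close>; \<open>step\<close> shows that every larger index gives the same
    state.\<close>
  define z where "z t = S (t + real (nat \<lceil>- t\<rceil>)) (Y (nat \<lceil>- t\<rceil>))" for t
  have step: "S (t + real (n + m)) (Y (n + m)) = S (t + real n) (Y n)" if "0 \<le> t + real n" for t n m
  proof (induction m)
    case (Suc m)
    have "S (t + real (n + Suc m)) (Y (n + Suc m)) = S (t + real (n + m)) (S 1 (Y (n + Suc m)))"
      using S_add[of "t + real (n + m)" 1 "Y (n + Suc m)"] that YP by (simp add: algebra_simps)
    then show ?case
      using Suc Y(2) by simp
  qed simp
  have z_eq: "z t = S (t + real n) (Y n)" if "0 \<le> t + real n" for t n
  proof -
    have "nat \<lceil>- t\<rceil> \<le> n"
      using that by (simp add: nat_le_iff ceiling_le_iff)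
    moreover have "0 \<le> t + real (nat \<lceil>- t\<rceil>)"
      using real_nat_ceiling_ge[of "- t"] by linarith
    ultimately show ?thesis
      using step[of t "nat \<lceil>- t\<rceil>" "n - nat \<lceil>- t\<rceil>"] unfolding z_def by simp
  qed
  have ex: "\<exists>n. 0 \<le> t + real n" for t
    using real_nat_ceiling_ge[of "- t"] by (intro exI[of _ "nat \<lceil>- t\<rceil>"]) linarith
  have zA: "z t \<in> attractor" for t
    using ex[of t] z_eq S_in_attractor Y(1) by metis
  have "S s (z \<tau>) = z (s + \<tau>)" if s: "0 \<le> s" for s \<tau>
  proof -
    obtain n where n: "0 \<le> \<tau> + real n"
      using ex by blast
    have "S s (z \<tau>) = S (s + (\<tau> + real n)) (Y n)"
      using S_add[OF s n YP] z_eq[OF n] by simp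
    then show ?thesis
      using z_eq[of "s + \<tau>" n] n s by (simp add: add.assoc)
  qed
  then have "complete_orbit z"
    unfolding complete_orbit_def using zA attractor_subset by blast
  moreover have "z 0 = y"
    using z_eq[of 0 0] S_0 YP[of 0] by (simp add: Y_def)
  ultimately show thesis
    using that zA by blast
qed

text \<open>Backward limit points of an orbit in the attractor have a constant Lyapunov function
  along their forward orbit.\<close>

lemma backward_limit_equilibria:
  fixes L :: "'a \<Rightarrow> real"
  assumes z: "complete_orbit z" "\<And>\<tau>. z \<tau> \<in> attractor"
    and L_cont: "continuous_on P L"
    and L_decr: "\<And>t x. 0 \<le> t \<Longrightarrow> x \<in> P \<Longrightarrow> L (S t x) \<le> L x"
    and L_strict: "\<And>x. x \<in> P \<Longrightarrow> (\<And>t. 0 \<le> t \<Longrightarrow> L (S t x) = L x) \<Longrightarrow> x \<in> E"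
    and "0 < \<epsilon>"
  shows "\<exists>T. \<forall>t\<ge>T. \<exists>s\<in>E. dist (z (- t)) s < \<epsilon>"
proof (rule ccontr)
  assume neg: "\<not> ?thesis"
  have "\<exists>t\<ge>real n. \<forall>s\<in>E. \<epsilon> \<le> dist (z (- t)) s" for n
    using neg unfolding not_less[symmetric, of \<epsilon>] by blast
  then obtain t where t: "\<And>n. real n \<le> t n" "\<And>n s. s \<in> E \<Longrightarrow> \<epsilon> \<le> dist (z (- t n)) s"
    by metis
  obtain y r where y: "y \<in> attractor" "strict_mono (r :: nat \<Rightarrow> nat)" "(\<lambda>n. z (- t (r n))) \<longlonglongrightarrow> y"
    using compact_attractor z(2) unfolding compact_eq_seq_compact_metric seq_compact_def
    by (auto simp: o_def dest!: spec[of _ "\<lambda>n. z (- t n)"])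
  have yP: "y \<in> P"
    using y(1) attractor_subset by blast
  have zP: "z \<tau> \<in> P" for \<tau>
    using z(2) attractor_subset by blast
  have Sz: "S s (z \<tau>) = z (s + \<tau>)" if "0 \<le> s" for s \<tau>
    using z(1) that unfolding complete_orbit_def by blast
  have mono: "L (z a) \<le> L (z b)" if "b \<le> a" for a b
    using L_decr[of "a - b" "z b"] Sz[of "a - b" b] zP that by simp
  have "compact (L ` attractor)"
    by (intro compact_continuous_image continuous_on_subset[OF L_cont attractor_subset] compact_attractor)
  then have "bdd_above (L ` attractor)"
    by (intro bounded_imp_bdd_above compact_imp_bounded)
  then have bdd: "bdd_above (range (\<lambda>a. L (z a)))"
    by (rule bdd_above_mono) (use z(2) in auto)
  \<comment> \<open>\<open>L\<close> does not increase along \<open>z\<close>, so this supremum,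
    finite by compactness of the attractor, is the limit of \<open>L\<close> at time minus
    infinity.\<close>
  define Lmax where "Lmax = (SUP a. L (z a))"
  have L_limit: "L (S s y) = Lmax" if s: "0 \<le> s" for s
  proof -
    have lim_z: "(\<lambda>n. z (s - t (r n))) \<longlonglongrightarrow> S s y"
      using continuous_on_tendsto_compose[OF S_continuous[OF s] y(3) yP] zP Sz[OF s] by simp
    then have "(\<lambda>n. L (z (s - t (r n)))) \<longlonglongrightarrow> L (S s y)"
      by (rule continuous_on_tendsto_compose[OF L_cont]) (use zP S_in_P[OF s yP] in auto)
    moreover have "(\<lambda>n. L (z (s - t (r n)))) \<longlonglongrightarrow> Lmax"
    proof (rule order_tendstoI)
      fix a assume "a < Lmax"
      then obtain b where b: "a < L (z b)"
        unfolding Lmax_def using less_cSUP_iff[OF _ bdd, of a] by auto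
      have "a < L (z (s - t (r n)))" if "n \<ge> nat \<lceil>s - b\<rceil>" for n
      proof -
        have "s - b \<le> real n"
          using that by linarith
        also have "real n \<le> t (r n)"
          using t(1)[of "r n"] seq_suble[OF y(2), of n] by linarith
        finally show ?thesis
          using mono[of "s - t (r n)" b] b by linarith
      qed
      then show "\<forall>\<^sub>F n in sequentially. a < L (z (s - t (r n)))"
        unfolding eventually_sequentially by blast
    next
      fix a assume "Lmax < a"
      moreover have "L (z b) \<le> Lmax" for b
        unfolding Lmax_def by (rule cSUP_upper[OF _ bdd]) simp
      ultimately have "L (z (s - t (r n))) < a" for n
        by (meson order_le_less_trans)
      then show "\<forall>\<^sub>F n in sequentially. L (z (s - t (r n))) < a"
        by simp
    qed
    ultimately show ?thesis
      by (rule LIMSEQ_unique)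
  qed
  then have "y \<in> E"
    using L_strict[OF yP] L_limit[of 0] S_0[OF yP] by simp
  moreover obtain n where "dist (z (- t (r n))) y < \<epsilon>"
    using metric_LIMSEQ_D[OF y(3) \<open>0 < \<epsilon>\<close>] by blast
  ultimately show False
    using t(2)[of y "r n"] by linarith
qed

end

section \<open>Differential inequalities on half-lines\<close>

lemma has_real_derivative_at_gt:
  assumes "(F has_real_derivative D) (at t within {a..})" "a < t"
  shows "(F has_real_derivative D) (at t)"
  using assms at_within_interior[of t "{a..}"] by (simp add: interior_Ici)

lemma integral_has_vector_derivative_Ici:
  fixes F R :: "real \<Rightarrow> 'b :: banach"
  assumes "continuous_on {a..} R" "\<And>s. a \<le> s \<Longrightarrow> F s = c + integral {a..s} R" "a \<le> t"
  shows "(F has_vector_derivative R t) (at t within {a..})"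
proof -
  have "((\<lambda>s. c + integral {a..s} R) has_vector_derivative 0 + R t) (at t within {a..t+1})"
    by (intro has_vector_derivative_add has_vector_derivative_const integral_has_vector_derivative
        continuous_on_subset[OF assms(1)]) (use assms(3) in auto)
  moreover have "at t within {a..t+1} = at t within {a..}"
    by (rule at_within_nhd[of t "{..<t+1}"]) auto
  ultimately have "((\<lambda>s. c + integral {a..s} R) has_vector_derivative R t) (at t within {a..})"
    by simp
  then show ?thesis
    by (rule has_vector_derivative_transform[rotated 2]) (use assms(2,3) in auto)
qed

lemma integral_has_real_derivative_Ici:
  fixes F R :: "real \<Rightarrow> real"
  assumes "continuous_on {a..} R" "\<And>s. a \<le> s \<Longrightarrow> F s = c + integral {a..s} R" "a \<le> t"
  shows "(F has_real_derivative R t) (at t within {a..})"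
  using integral_has_vector_derivative_Ici[OF assms]
  by (simp add: has_real_derivative_iff_has_vector_derivative)

lemma derivative_has_integral_Ici:
  fixes F F' :: "real \<Rightarrow> real"
  assumes "\<And>t. a \<le> t \<Longrightarrow> (F has_real_derivative F' t) (at t within {a..})" "a \<le> s"
  shows "(F' has_integral F s - F a) {a..s}"
proof (rule fundamental_theorem_of_calculus[OF assms(2)])
  fix t assume "t \<in> {a..s}"
  then have "(F has_vector_derivative F' t) (at t within {a..})"
    using assms(1) by (simp add: has_real_derivative_iff_has_vector_derivative)
  then show "(F has_vector_derivative F' t) (at t within {a..s})"
    by (rule has_vector_derivative_within_subset) auto
qed

text \<open>Each increment of \<open>q n\<close> is the integral of \<open>q' n\<close>; dominated
  convergence passes to the limit in the integrals, and continuity of \<open>R\<close> recovers a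
  derivative. Series are thereby differentiated term by term without uniform convergence.\<close>

lemma has_real_derivative_limit_dominated:
  fixes q q' :: "nat \<Rightarrow> real \<Rightarrow> real"
  assumes q: "\<And>n t. a \<le> t \<Longrightarrow> (q n has_real_derivative q' n t) (at t within {a..})"
    and lim: "\<And>t. a \<le> t \<Longrightarrow> (\<lambda>n. q n t) \<longlonglongrightarrow> Q t" "\<And>t. a \<le> t \<Longrightarrow> (\<lambda>n. q' n t) \<longlonglongrightarrow> R t"
    and dom: "\<And>n t. a \<le> t \<Longrightarrow> \<bar>q' n t\<bar> \<le> B t"
    and cont: "continuous_on {a..} R" "continuous_on {a..} B"
    and t: "a \<le> t"
  shows "(Q has_real_derivative R t) (at t within {a..})"
proof (rule integral_has_real_derivative_Ici[OF cont(1) _ t])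
  fix s assume s: "a \<le> s"
  have int: "(q' n has_integral q n s - q n a) {a..s}" for n
    by (rule derivative_has_integral_Ici[OF q s])
  have "(\<lambda>n. integral {a..s} (q' n)) \<longlonglongrightarrow> integral {a..s} R"
  proof (rule dominated_convergence(2))
    show "q' n integrable_on {a..s}" for n
      using int by (rule has_integral_integrable)
    show "B integrable_on {a..s}"
      by (rule integrable_continuous_real, rule continuous_on_subset[OF cont(2)]) simp
  qed (use dom lim(2) in auto)
  then have "(\<lambda>n. q n s - q n a) \<longlonglongrightarrow> integral {a..s} R"
    unfolding integral_unique[OF int] .
  moreover have "(\<lambda>n. q n s - q n a) \<longlonglongrightarrow> Q s - Q a"
    using s by (intro tendsto_diff lim(1)) auto
  ultimately have "Q s - Q a = integral {a..s} R"
    by (rule LIMSEQ_unique[rotated])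
  then show "Q s = Q a + integral {a..s} R"
    by simp
qed

lemma nonincreasing_Ici:
  fixes F F' :: "real \<Rightarrow> real"
  assumes "\<And>t. a \<le> t \<Longrightarrow> (F has_real_derivative F' t) (at t within {a..})"
    and "\<And>t. a \<le> t \<Longrightarrow> F' t \<le> 0" and "a \<le> s"
  shows "F s \<le> F a"
proof -
  have "(F' has_integral F s - F a) {a..s}"
    by (rule derivative_has_integral_Ici[OF assms(1,3)])
  moreover have "((\<lambda>_. 0) has_integral 0) {a..s}"
    by (rule has_integral_0)
  ultimately have "F s - F a \<le> 0"
    by (rule has_integral_le) (use assms(2) in auto)
  then show ?thesis by simp
qed

text \<open>The sign of \<open>c\<close> is left open: positive \<open>c\<close> gives decay towards
  \<open>d / c\<close>, negative \<open>c\<close> the usual exponential growth bound. The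
  integrating factor is applied to \<open>F - d / c\<close>.\<close>

lemma gronwall_Ici:
  fixes F F' :: "real \<Rightarrow> real"
  assumes F: "\<And>t. a \<le> t \<Longrightarrow> (F has_real_derivative F' t) (at t within {a..})"
    and le: "\<And>t. a \<le> t \<Longrightarrow> F' t \<le> - c * F t + d" and c: "c \<noteq> 0" and t: "a \<le> t"
  shows "F t \<le> d / c + exp (- c * (t - a)) * (F a - d / c)"
proof -
  define h where "h s = exp (c * (s - a)) * (F s - d / c)" for s
  have "h t \<le> h a"
  proof (rule nonincreasing_Ici[OF _ _ t])
    fix s assume s: "a \<le> s"
    show "(h has_real_derivative exp (c * (s - a)) * (c * F s - d + F' s)) (at s within {a..})"
      unfolding h_def
      by (auto intro!: derivative_eq_intros F[OF s] simp: c algebra_simps)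
    show "exp (c * (s - a)) * (c * F s - d + F' s) \<le> 0"
      using le[OF s] by (intro mult_nonneg_nonpos) auto
  qed
  then have "exp (- c * (t - a)) * h t \<le> exp (- c * (t - a)) * (F a - d / c)"
    unfolding h_def by (intro mult_left_mono) auto
  moreover have "exp (- c * (t - a)) * h t = F t - d / c"
    unfolding h_def by (simp flip: exp_add mult.assoc)
  ultimately show ?thesis by linarith
qed

text \<open>Decay of finitely many high-frequency modes of
  \<open>u'' + u' + A u - \<beta>(t) A\<^sup>1\<^sup>/\<^sup>2 u = r\<close>.  Including the term \<open>-\<beta> X\<^sup>2 / \<omega>\<close> in the energy
  cancels the product \<open>\<beta> X Y\<close>, which the damping alone does not control.\<close>

lemma high_mode_decay:
  fixes X Y r :: "nat \<Rightarrow> real \<Rightarrow> real" and \<omega> :: "nat \<Rightarrow> real" and \<beta> \<beta>' :: "real \<Rightarrow> real"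
  assumes F: "finite F" and \<omega>: "\<And>j. j \<in> F \<Longrightarrow> 16 * (1 + C) \<le> \<omega> j"
    and X: "\<And>j t. j \<in> F \<Longrightarrow> a \<le> t \<Longrightarrow> (X j has_real_derivative \<omega> j * Y j t) (at t within {a..})"
    and Y: "\<And>j t. j \<in> F \<Longrightarrow> a \<le> t \<Longrightarrow>
      (Y j has_real_derivative - \<omega> j * X j t - Y j t + \<beta> t * X j t + r j t) (at t within {a..})"
    and \<beta>: "\<And>t. a \<le> t \<Longrightarrow> (\<beta> has_real_derivative \<beta>' t) (at t within {a..})"
    and C: "\<And>t. a \<le> t \<Longrightarrow> \<bar>\<beta> t\<bar> \<le> C" "\<And>t. a \<le> t \<Longrightarrow> \<bar>\<beta>' t\<bar> \<le> C"
    and D: "\<And>t. a \<le> t \<Longrightarrow> (\<Sum>j\<in>F. (r j t)\<^sup>2) \<le> D"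
    and t: "a \<le> t"
  shows "(\<Sum>j\<in>F. (X j t)\<^sup>2 + (Y j t)\<^sup>2)
    \<le> 64 * D + 4 * exp (- (t - a) / 4) * (\<Sum>j\<in>F. (X j a)\<^sup>2 + (Y j a)\<^sup>2)"
proof -
  \<comment> \<open>The cross term over \<open>2 * \<omega> j\<close> exchanges half of the damping
    of \<open>Y\<close> for a damping of \<open>X\<close>: its derivative contributes
    \<open>Y\<^sup>2 / 2 - X\<^sup>2 / 2\<close>, which leaves minus one half of both squares in
    \<open>E'\<close>.\<close>
  define E where "E j t = ((1 - \<beta> t / \<omega> j) * (X j t)\<^sup>2 + (Y j t)\<^sup>2) / 2 + X j t * Y j t / (2 * \<omega> j)" for j t
  define E' where "E' j t = - (Y j t)\<^sup>2 / 2 - (X j t)\<^sup>2 / 2 - \<beta>' t / \<omega> j * (X j t)\<^sup>2 / 2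
      - X j t * Y j t / (2 * \<omega> j) + \<beta> t / \<omega> j * (X j t)\<^sup>2 / 2 + Y j t * r j t + X j t * r j t / (2 * \<omega> j)" for j t
  have C0: "0 \<le> C"
    using C(1)[OF t] by linarith
  have D0: "0 \<le> D"
    using D[OF t] sum_nonneg[of F "\<lambda>j. (r j t)\<^sup>2"] by auto
  have pos: "0 < \<omega> j" "1 / \<omega> j \<le> 1 / 16" if "j \<in> F" for j
    using \<omega>[OF that] C0 by (auto simp: field_simps)
  \<comment> \<open>The threshold \<open>16 * (1 + C)\<close> provides the room: a coefficient
    bounded by \<open>C\<close> and divided by \<omega> takes at most 1/16 of the square of
    \<open>X\<close>, the cross term at most 1/64 of both squares. \<open>E\<close> then lies
    between a quarter and the whole of the sum of squares.\<close>
  have small: "\<bar>c / \<omega> j\<bar> \<le> 1 / 16" if "j \<in> F" "\<bar>c\<bar> \<le> C" for c j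
    using \<omega>[OF that(1)] that(2) C0 pos[OF that(1)] by (simp add: abs_divide field_simps)
  have prod: "\<bar>x * y / (2 * \<omega> j)\<bar> \<le> (x\<^sup>2 + y\<^sup>2) / 64" if "j \<in> F" for x y j
  proof -
    have "\<bar>x * y\<bar> \<le> (x\<^sup>2 + y\<^sup>2) / 2"
      using sum_squares_bound[of "\<bar>x\<bar>" "\<bar>y\<bar>"] by (simp add: abs_mult)
    then have "\<bar>x * y\<bar> * (1 / \<omega> j) \<le> ((x\<^sup>2 + y\<^sup>2) / 2) * (1 / 16)"
      using pos[OF that] by (intro mult_mono) auto
    then show ?thesis
      using pos(1)[OF that] by (simp add: abs_mult field_simps)
  qed
  have small_sq: "\<bar>c / \<omega> j * x\<^sup>2\<bar> \<le> x\<^sup>2 / 16" if "j \<in> F" "\<bar>c\<bar> \<le> C" for c j and x :: real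
  proof -
    have "\<bar>c / \<omega> j\<bar> * x\<^sup>2 \<le> 1 / 16 * x\<^sup>2"
      by (intro mult_right_mono small that) auto
    then show ?thesis by (simp add: abs_mult)
  qed
  have E_deriv: "(E j has_real_derivative E' j s) (at s within {a..})" if "j \<in> F" "a \<le> s" for j s
    unfolding E_def E'_def
    using pos[OF that(1)]
    by (auto intro!: derivative_eq_intros X[OF that] Y[OF that] \<beta>[OF that(2)])
      (simp add: field_simps power2_eq_square)
  have E_upper: "E j s \<le> (X j s)\<^sup>2 + (Y j s)\<^sup>2" and E_lower: "((X j s)\<^sup>2 + (Y j s)\<^sup>2) / 4 \<le> E j s"
    if "j \<in> F" "a \<le> s" for j s
  proof -
    have "E j s = (X j s)\<^sup>2 / 2 - \<beta> s / \<omega> j * (X j s)\<^sup>2 / 2 + (Y j s)\<^sup>2 / 2 + X j s * Y j s / (2 * \<omega> j)"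
      unfolding E_def using pos[OF that(1)] by (simp add: field_simps)
    then show "E j s \<le> (X j s)\<^sup>2 + (Y j s)\<^sup>2" "((X j s)\<^sup>2 + (Y j s)\<^sup>2) / 4 \<le> E j s"
      using small_sq[OF that(1) C(1)[OF that(2)], of "X j s"] prod[OF that(1), of "X j s" "Y j s"]
        zero_le_power2[of "X j s"] zero_le_power2[of "Y j s"] by argo+
  qed
  have E'_le: "E' j s \<le> - (1 / 4) * E j s + 4 * (r j s)\<^sup>2" if "j \<in> F" "a \<le> s" for j s
  proof -
    have "Y j s * r j s \<le> (Y j s)\<^sup>2 / 8 + 2 * (r j s)\<^sup>2"
      using zero_le_power2[of "Y j s / 2 - 2 * r j s"] by (simp add: power2_diff power_divide)
    then have "E' j s \<le> - (1 / 4) * ((X j s)\<^sup>2 + (Y j s)\<^sup>2) + 4 * (r j s)\<^sup>2"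
      unfolding E'_def
      using small_sq[OF that(1) C(1)[OF that(2)], of "X j s"] small_sq[OF that(1) C(2)[OF that(2)], of "X j s"]
        prod[OF that(1), of "X j s" "Y j s"] prod[OF that(1), of "X j s" "r j s"]
        zero_le_power2[of "X j s"] zero_le_power2[of "Y j s"] zero_le_power2[of "r j s"] by argo
    then show ?thesis
      using E_upper[OF that] by argo
  qed
  \<comment> \<open>Rate 1/4 and forcing \<open>4 * D\<close> give the level \<open>16 * D\<close>;
    the factor 4 lost in \<open>E_lower\<close> then produces the constants 64 and 4 of the
    statement.\<close>
  have "(\<Sum>j\<in>F. E j t) \<le> 4 * D / (1 / 4) + exp (- (1 / 4) * (t - a)) * ((\<Sum>j\<in>F. E j a) - 4 * D / (1 / 4))"
  proof (rule gronwall_Ici[OF _ _ _ t])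
    fix s assume s: "a \<le> s"
    show "((\<lambda>t. \<Sum>j\<in>F. E j t) has_real_derivative (\<Sum>j\<in>F. E' j s)) (at s within {a..})"
      by (intro DERIV_sum E_deriv s)
    have "(\<Sum>j\<in>F. E' j s) \<le> (\<Sum>j\<in>F. - (1 / 4) * E j s + 4 * (r j s)\<^sup>2)"
      by (intro sum_mono E'_le s)
    also have "\<dots> = - (1 / 4) * (\<Sum>j\<in>F. E j s) + 4 * (\<Sum>j\<in>F. (r j s)\<^sup>2)"
      by (simp only: sum.distrib sum_distrib_left)
    finally show "(\<Sum>j\<in>F. E' j s) \<le> - (1 / 4) * (\<Sum>j\<in>F. E j s) + 4 * D"
      using D[OF s] by linarith
  qed simp
  moreover have quarter: "4 * D / (1 / 4) = 16 * D"
    by simp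
  moreover have "exp (- (1 / 4) * (t - a)) * ((\<Sum>j\<in>F. E j a) - 16 * D)
      \<le> exp (- (t - a) / 4) * (\<Sum>j\<in>F. (X j a)\<^sup>2 + (Y j a)\<^sup>2)"
  proof -
    have "(\<Sum>j\<in>F. E j a) \<le> (\<Sum>j\<in>F. (X j a)\<^sup>2 + (Y j a)\<^sup>2)"
      by (intro sum_mono E_upper) auto
    then have "(\<Sum>j\<in>F. E j a) - 16 * D \<le> (\<Sum>j\<in>F. (X j a)\<^sup>2 + (Y j a)\<^sup>2)"
      using D0 by linarith
    moreover have "exp (- (1 / 4) * (t - a)) = exp (- (t - a) / 4)"
      by (rule arg_cong[where f = exp]) (simp only: times_divide_eq_left minus_divide_left mult_1 mult_minus_left)
    ultimately show ?thesis
      by (simp only: mult_left_mono exp_ge_zero)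
  qed
  moreover have "(\<Sum>j\<in>F. (X j t)\<^sup>2 + (Y j t)\<^sup>2) / 4 \<le> (\<Sum>j\<in>F. E j t)"
    unfolding sum_divide_distrib by (intro sum_mono E_lower t)
  ultimately show ?thesis
    unfolding quarter by linarith
qed

section \<open>The equation in eigenfunction coordinates\<close>

lemma inner_trunc: "(\<Sum>j<n. coord x j * coord y j) = inner (trunc n x) y"
proof -
  have "(\<lambda>j. coord (trunc n x) j * coord y j) sums (\<Sum>j<n. coord (trunc n x) j * coord y j)"
    by (rule sums_finite) auto
  then have "inner (trunc n x) y = (\<Sum>j<n. coord (trunc n x) j * coord y j)"
    by (rule sums_unique2[OF inner_l2_sums])
  then show ?thesis by simp
qed

lemma abs_partial_inner_le: "\<bar>\<Sum>j<n. coord x j * coord y j\<bar> \<le> norm x * norm y"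
proof -
  have "\<bar>\<Sum>j<n. coord x j * coord y j\<bar> \<le> norm (trunc n x) * norm y"
    unfolding inner_trunc by (rule Cauchy_Schwarz_ineq2)
  also have "\<dots> \<le> norm x * norm y"
    by (intro mult_right_mono norm_trunc_le) auto
  finally show ?thesis .
qed

lemma norm_prod_sq: "(norm z)\<^sup>2 = (norm (fst z))\<^sup>2 + (norm (snd z))\<^sup>2"
  by (cases z) (simp add: norm_Pair)

text \<open>Coordinates: \<open>z = (x, y)\<close> with \<open>x = A\<^sup>1\<^sup>/\<^sup>2 u\<close>, \<open>y = \<partial>\<^sub>t u\<close>, expanded in eigenfunctions;
  \<open>w j\<close> is the square root of the eigenvalue (and \<open>0\<close> at unused indices),
  and \<open>N a\<close> is the expansion of the positive part of the function with expansion \<open>a\<close>.\<close>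

locale bridge =
  fixes w :: "nat \<Rightarrow> real" and p k :: real and f :: l2 and N :: "l2 \<Rightarrow> l2"
  assumes w_nonneg: "\<And>j. 0 \<le> w j"
    and w_finite: "\<And>c. finite {j. 0 < w j \<and> w j \<le> c}"
    and N_lipschitz: "\<And>a b. norm (N a - N b) \<le> norm (a - b)"
    and N_nonneg: "\<And>a. 0 \<le> inner (N a) a"
    and N_potential:
      "\<And>a b. \<bar>inner (N b) b / 2 - inner (N a) a / 2 - inner (N a) (b - a)\<bar> \<le> (norm (b - a))\<^sup>2 / 2"
begin

definition K :: "l2 \<Rightarrow> l2" where
  "K = diag (\<lambda>j. 1 / w j)"

definition \<kappa> :: real where
  "\<kappa> = (SOME c. \<forall>j. \<bar>1 / w j\<bar> \<le> c)"

definition phase :: "(l2 \<times> l2) set" where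
  "phase = {z. \<forall>j. w j = 0 \<longrightarrow> coord (fst z) j = 0 \<and> coord (snd z) j = 0}"

text \<open>As \<open>x = A\<^sup>1\<^sup>/\<^sup>2 u\<close>, the inner product of
  \<open>K x\<close> with \<open>x\<close> is
  \<open>\<parallel>u\<parallel>\<^sub>1\<^sup>2\<close>.\<close>

definition \<beta> :: "l2 \<times> l2 \<Rightarrow> real" where
  "\<beta> z = p - inner (K (fst z)) (fst z)"

text \<open>\<open>A\<^sup>1\<^sup>/\<^sup>2 u\<close> is the coordinate \<open>x\<close> itself, so
  everything in the equation apart from the rotation and the damping is a locally Lipschitz map of
  the phase space.\<close>

definition G :: "l2 \<times> l2 \<Rightarrow> l2" where
  "G z = f + \<beta> z *\<^sub>R fst z - k\<^sup>2 *\<^sub>R N (K (fst z))"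

text \<open>The forcing \<open>g\<close> is arbitrary so that the identities below also cover
  differences of solutions. Derivatives are taken in single coordinates, since the
  \<open>w j\<close> may be unbounded and \<open>z\<close> need not be differentiable in
  norm.\<close>

definition linear_solution :: "(real \<Rightarrow> l2) \<Rightarrow> real \<Rightarrow> (real \<Rightarrow> l2 \<times> l2) \<Rightarrow> bool" where
  "linear_solution g a z \<longleftrightarrow>
     continuous_on {a..} z \<and> continuous_on {a..} g \<and> (\<forall>t\<ge>a. z t \<in> phase) \<and>
     (\<forall>j. \<forall>t\<ge>a.
       ((\<lambda>t. coord (fst (z t)) j) has_real_derivative w j * coord (snd (z t)) j) (at t within {a..}) \<and>
       ((\<lambda>t. coord (snd (z t)) j) has_real_derivative
          - w j * coord (fst (z t)) j - coord (snd (z t)) j + coord (g t) j) (at t within {a..}))"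

definition solution :: "real \<Rightarrow> (real \<Rightarrow> l2 \<times> l2) \<Rightarrow> bool" where
  "solution a z \<longleftrightarrow> linear_solution (\<lambda>t. G (z t)) a z"

text \<open>Only finitely many positive \<open>w j\<close> are at most 1; the sum of their
  reciprocals bounds each of them, and all other reciprocals are at most 1.\<close>

lemma \<kappa>: "\<bar>1 / w j\<bar> \<le> \<kappa>"
proof -
  have "\<exists>c. \<forall>j. \<bar>1 / w j\<bar> \<le> c"
  proof (intro exI allI)
    fix j
    let ?J = "{j. 0 < w j \<and> w j \<le> 1}"
    show "\<bar>1 / w j\<bar> \<le> 1 + (\<Sum>j\<in>?J. 1 / w j)"
    proof (cases "j \<in> ?J")
      case True
      have "1 / w j \<le> (\<Sum>j\<in>?J. 1 / w j)"
        by (rule member_le_sum[OF True _ w_finite]) (simp add: w_nonneg)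
      then show ?thesis
        using w_nonneg[of j] by simp
    next
      case False
      then have "\<bar>1 / w j\<bar> \<le> 1"
        using w_nonneg[of j] by (cases "w j = 0") (auto simp: field_simps)
      moreover have "0 \<le> (\<Sum>j\<in>?J. 1 / w j)"
        by (intro sum_nonneg) (simp add: w_nonneg)
      ultimately show ?thesis by linarith
    qed
  qed
  then show ?thesis
    unfolding \<kappa>_def by (rule someI2_ex) blast
qed

lemma \<kappa>_nonneg: "0 \<le> \<kappa>"
  using \<kappa>[of 0] abs_ge_zero order_trans by blast

lemma coord_K: "coord (K x) j = coord x j / w j"
  using coord_diag[of "\<lambda>j. 1 / w j", OF \<kappa>] by (simp add: K_def)

lemma bounded_linear_K: "bounded_linear K"
  unfolding K_def by (rule bounded_linear_diag[OF \<kappa>])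

lemma norm_K_le: "norm (K x) \<le> \<kappa> * norm x"
  unfolding K_def by (rule norm_diag_le[OF \<kappa>])

lemma K_diff: "K (x - y) = K x - K y"
  by (rule linear_diff[OF bounded_linear.linear[OF bounded_linear_K]])

lemma K_symmetric: "inner (K x) y = inner x (K y)"
proof -
  have "(\<lambda>j. coord (K x) j * coord y j) = (\<lambda>j. coord x j * coord (K y) j)"
    by (simp add: coord_K)
  then show ?thesis
    by (simp only: inner_l2_def)
qed

lemma abs_inner_K_le: "\<bar>inner (K x) y\<bar> \<le> \<kappa> * (norm x * norm y)"
proof -
  have "\<bar>inner (K x) y\<bar> \<le> norm (K x) * norm y"
    by (rule Cauchy_Schwarz_ineq2)
  also have "\<dots> \<le> (\<kappa> * norm x) * norm y"
    by (intro mult_right_mono norm_K_le) auto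
  finally show ?thesis by (simp add: mult.assoc)
qed

lemma norm_N_le: "norm (N a) \<le> norm (N 0) + norm a"
  using N_lipschitz[of a 0] norm_triangle_ineq2[of "N a" "N 0"] by simp

lemma continuous_on_N: "continuous_on UNIV N"
  by (rule lipschitz_on_continuous_on[where L = 1], rule lipschitz_onI)
    (simp_all add: dist_norm N_lipschitz)

lemma continuous_on_K [continuous_intros]: "continuous_on S h \<Longrightarrow> continuous_on S (\<lambda>x. K (h x))"
  by (rule bounded_linear.continuous_on[OF bounded_linear_K])

lemma continuous_on_N' [continuous_intros]: "continuous_on S h \<Longrightarrow> continuous_on S (\<lambda>x. N (h x))"
  by (rule continuous_on_compose2[OF continuous_on_N]) auto

lemma continuous_on_\<beta> [continuous_intros]: "continuous_on S h \<Longrightarrow> continuous_on S (\<lambda>x. \<beta> (h x))"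
  unfolding \<beta>_def by (intro continuous_intros)

lemma continuous_on_G [continuous_intros]: "continuous_on S h \<Longrightarrow> continuous_on S (\<lambda>x. G (h x))"
  unfolding G_def by (intro continuous_intros)

lemma closed_phase: "closed phase"
proof -
  have "phase = (\<Inter>j\<in>{j. w j = 0}. {z. coord (fst z) j = 0} \<inter> {z. coord (snd z) j = 0})"
    unfolding phase_def by auto
  moreover have "closed {z :: l2 \<times> l2. coord (fst z) j = 0}" "closed {z :: l2 \<times> l2. coord (snd z) j = 0}" for j
    by (intro closed_Collect_eq continuous_on_coord continuous_intros)+
  ultimately show ?thesis
    by (simp add: closed_INT closed_Int)
qed

lemma convex_phase: "convex phase"
  unfolding phase_def by (rule convexI) auto

section \<open>Energy identities\<close>

lemma linear_solution_diff:
  assumes "linear_solution g1 a z1" "linear_solution g2 a z2"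
  shows "linear_solution (\<lambda>t. g1 t - g2 t) a (\<lambda>t. z1 t - z2 t)"
  using assms unfolding linear_solution_def phase_def
  by (auto intro!: continuous_intros derivative_eq_intros simp: algebra_simps)

text \<open>The rotation between \<open>x\<close> and \<open>y\<close> cancels within each mode, so
  the derivatives of the partial sums contain no \<open>w j\<close> and are dominated through the
  Cauchy-Schwarz inequality.\<close>

lemma linear_solution_energy:
  assumes z: "linear_solution g a z" and t: "a \<le> t"
  shows "((\<lambda>t. (norm (z t))\<^sup>2) has_real_derivative
    2 * (inner (g t) (snd (z t)) - inner (snd (z t)) (snd (z t)))) (at t within {a..})"
proof (rule has_real_derivative_limit_dominated[OF _ _ _ _ _ _ t])
  let ?q = "\<lambda>n t. \<Sum>j<n. (coord (fst (z t)) j)\<^sup>2 + (coord (snd (z t)) j)\<^sup>2"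
  let ?q' = "\<lambda>n t. 2 * ((\<Sum>j<n. coord (g t) j * coord (snd (z t)) j)
      - (\<Sum>j<n. coord (snd (z t)) j * coord (snd (z t)) j))"
  show "(?q n has_real_derivative ?q' n s) (at s within {a..})" if "a \<le> s" for n s
  proof -
    have "(?q n has_real_derivative (\<Sum>j<n. 2 * (coord (g s) j * coord (snd (z s)) j
        - coord (snd (z s)) j * coord (snd (z s)) j))) (at s within {a..})"
      using z that unfolding linear_solution_def
      by (auto intro!: derivative_eq_intros DERIV_sum simp: algebra_simps power2_eq_square)
    then show ?thesis
      by (simp add: sum_distrib_left sum_subtractf)
  qed
  show "(\<lambda>n. ?q n s) \<longlonglongrightarrow> (norm (z s))\<^sup>2" for s
    unfolding norm_prod_sq sum.distrib
    using norm_l2_sums unfolding sums_def by (intro tendsto_add)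
  show "(\<lambda>n. ?q' n s) \<longlonglongrightarrow> 2 * (inner (g s) (snd (z s)) - inner (snd (z s)) (snd (z s)))" for s
    by (intro tendsto_intros inner_l2_limit)
  show "\<bar>?q' n s\<bar> \<le> 2 * (norm (g s) * norm (snd (z s)) + norm (snd (z s)) * norm (snd (z s)))" for n s
  proof -
    have "\<bar>2 * (A - B)\<bar> \<le> 2 * (c + d)" if "\<bar>A\<bar> \<le> c" "\<bar>B\<bar> \<le> d" for A B c d :: real
      using abs_triangle_ineq4[of A B] that by (simp add: abs_mult)
    then show ?thesis
      by this (rule abs_partial_inner_le)+
  qed
  show "continuous_on {a..} (\<lambda>s. 2 * (inner (g s) (snd (z s)) - inner (snd (z s)) (snd (z s))))"
    "continuous_on {a..} (\<lambda>s. 2 * (norm (g s) * norm (snd (z s)) + norm (snd (z s)) * norm (snd (z s))))"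
    using z unfolding linear_solution_def by (auto intro!: continuous_intros)
qed

text \<open>The weight \<open>1 / w j\<close> cancels the factor \<open>w j\<close> in the
  derivative of \<open>x\<^sub>j\<close>. At indices with \<open>w j = 0\<close> it is membership in
  \<open>phase\<close> that makes both sides vanish.\<close>

lemma linear_solution_stretch:
  assumes z: "linear_solution g a z" and t: "a \<le> t"
  shows "((\<lambda>t. inner (K (fst (z t))) (fst (z t))) has_real_derivative
    2 * inner (fst (z t)) (snd (z t))) (at t within {a..})"
proof (rule has_real_derivative_limit_dominated[OF _ _ _ _ _ _ t])
  let ?q = "\<lambda>n t. \<Sum>j<n. coord (K (fst (z t))) j * coord (fst (z t)) j"
  let ?q' = "\<lambda>n t. 2 * (\<Sum>j<n. coord (fst (z t)) j * coord (snd (z t)) j)"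
  show "(?q n has_real_derivative ?q' n s) (at s within {a..})" if s: "a \<le> s" for n s
  proof -
    have "((\<lambda>s. coord (K (fst (z s))) j * coord (fst (z s)) j) has_real_derivative
        2 * (coord (fst (z s)) j * coord (snd (z s)) j)) (at s within {a..})" for j
    proof (cases "w j = 0")
      case True
      then have "coord (snd (z s)) j = 0"
        using z s unfolding linear_solution_def phase_def by blast
      with True show ?thesis
        by (simp add: coord_K)
    next
      case False
      then show ?thesis
        using z s unfolding linear_solution_def coord_K
        by (auto intro!: derivative_eq_intros simp: field_simps)
    qed
    then show ?thesis
      unfolding sum_distrib_left by (intro DERIV_sum)
  qed
  show "(\<lambda>n. ?q n s) \<longlonglongrightarrow> inner (K (fst (z s))) (fst (z s))"
    "(\<lambda>n. ?q' n s) \<longlonglongrightarrow> 2 * inner (fst (z s)) (snd (z s))" for s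
    by (intro tendsto_intros inner_l2_limit)+
  show "\<bar>?q' n s\<bar> \<le> 2 * (norm (fst (z s)) * norm (snd (z s)))" for n s
    using abs_partial_inner_le[where n = n and x = "fst (z s)" and y = "snd (z s)"] by linarith
  show "continuous_on {a..} (\<lambda>s. 2 * inner (fst (z s)) (snd (z s)))"
    "continuous_on {a..} (\<lambda>s. 2 * (norm (fst (z s)) * norm (snd (z s))))"
    using z unfolding linear_solution_def by (auto intro!: continuous_intros)
qed

text \<open>Here the derivative exists in norm: \<open>K\<close> absorbs the unbounded factor, and
  \<open>u\<close> is the integral of the continuous curve \<open>\<partial>\<^sub>t u\<close>. The
  chain rule for the potential of \<open>N\<close> relies on this.\<close>

lemma linear_solution_position:
  assumes z: "linear_solution g a z" and t: "a \<le> t"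
  shows "((\<lambda>t. K (fst (z t))) has_vector_derivative snd (z t)) (at t within {a..})"
proof (rule integral_has_vector_derivative_Ici[where R = "\<lambda>t. snd (z t)", OF _ _ t])
  have cont: "continuous_on {a..} (\<lambda>t. snd (z t))"
    using z unfolding linear_solution_def by (auto intro!: continuous_intros)
  then show "continuous_on {a..} (\<lambda>t. snd (z t))" .
  fix s assume s: "a \<le> s"
  have int: "(\<lambda>t. snd (z t)) integrable_on {a..s}"
    by (rule integrable_continuous_real, rule continuous_on_subset[OF cont]) simp
  show "K (fst (z s)) = K (fst (z a)) + integral {a..s} (\<lambda>t. snd (z t))"
  proof (rule l2_eqI)
    fix j
    have "((\<lambda>t. coord (snd (z t)) j) has_integral coord (integral {a..s} (\<lambda>t. snd (z t))) j) {a..s}"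
      using has_integral_linear[OF integrable_integral[OF int] bounded_linear_coord]
      unfolding o_def .
    moreover have "((\<lambda>t. coord (snd (z t)) j) has_integral
        coord (K (fst (z s))) j - coord (K (fst (z a))) j) {a..s}"
    proof (rule derivative_has_integral_Ici[OF _ s])
      fix \<tau> assume \<tau>: "a \<le> \<tau>"
      show "((\<lambda>t. coord (K (fst (z t))) j) has_real_derivative coord (snd (z \<tau>)) j) (at \<tau> within {a..})"
      proof (cases "w j = 0")
        case True
        then have "coord (snd (z \<tau>)) j = 0"
          using z \<tau> unfolding linear_solution_def phase_def by blast
        with True show ?thesis
          by (simp add: coord_K)
      next
        case False
        then show ?thesis
          using z \<tau> unfolding linear_solution_def coord_K
          by (auto intro!: derivative_eq_intros)
      qed
    qed
    ultimately have "coord (integral {a..s} (\<lambda>t. snd (z t))) j = coord (K (fst (z s))) j - coord (K (fst (z a))) j"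
      by (rule has_integral_unique)
    then show "coord (K (fst (z s))) j = coord (K (fst (z a)) + integral {a..s} (\<lambda>t. snd (z t))) j"
      by simp
  qed
qed

text \<open>The equation tested with \<open>u\<close>. It produces the term
  \<open>- \<parallel>x\<parallel>\<^sup>2\<close>, which the damping, acting on \<open>y\<close>
  alone, does not supply.\<close>

lemma linear_solution_cross:
  assumes z: "linear_solution g a z" and t: "a \<le> t"
  shows "((\<lambda>t. inner (K (fst (z t))) (snd (z t))) has_real_derivative
    inner (snd (z t)) (snd (z t)) - inner (fst (z t)) (fst (z t)) - inner (K (fst (z t))) (snd (z t))
      + inner (K (fst (z t))) (g t)) (at t within {a..})"
proof (rule has_real_derivative_limit_dominated[OF _ _ _ _ _ _ t])
  let ?q = "\<lambda>n t. \<Sum>j<n. coord (K (fst (z t))) j * coord (snd (z t)) j"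
  let ?S = "\<lambda>u v n t. \<Sum>j<n. coord (u t) j * coord (v t) j"
  let ?x = "\<lambda>t. fst (z t)" and ?y = "\<lambda>t. snd (z t)" and ?u = "\<lambda>t. K (fst (z t))"
  let ?q' = "\<lambda>n t. ?S ?y ?y n t - ?S ?x ?x n t - ?S ?u ?y n t + ?S ?u g n t"
  show "(?q n has_real_derivative ?q' n s) (at s within {a..})" if s: "a \<le> s" for n s
  proof -
    have "((\<lambda>s. coord (K (fst (z s))) j * coord (snd (z s)) j) has_real_derivative
        coord (?y s) j * coord (?y s) j - coord (?x s) j * coord (?x s) j
        - coord (?u s) j * coord (?y s) j + coord (?u s) j * coord (g s) j) (at s within {a..})" for j
    proof (cases "w j = 0")
      case True
      then have "coord (snd (z s)) j = 0" "coord (fst (z s)) j = 0"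
        using z s unfolding linear_solution_def phase_def by blast+
      with True show ?thesis
        by (simp add: coord_K)
    next
      case False
      then show ?thesis
        using z s unfolding linear_solution_def coord_K
        by (auto intro!: derivative_eq_intros simp: field_simps)
    qed
    then have "(?q n has_real_derivative (\<Sum>j<n. coord (?y s) j * coord (?y s) j - coord (?x s) j * coord (?x s) j
        - coord (?u s) j * coord (?y s) j + coord (?u s) j * coord (g s) j)) (at s within {a..})"
      by (intro DERIV_sum)
    then show ?thesis
      by (simp add: sum_subtractf sum.distrib)
  qed
  show "(\<lambda>n. ?q n s) \<longlonglongrightarrow> inner (K (fst (z s))) (snd (z s))"
    "(\<lambda>n. ?q' n s) \<longlonglongrightarrow> inner (?y s) (?y s) - inner (?x s) (?x s) - inner (?u s) (?y s) + inner (?u s) (g s)" for s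
    by (intro tendsto_intros inner_l2_limit)+
  show "\<bar>?q' n s\<bar> \<le> norm (?y s) * norm (?y s) + norm (?x s) * norm (?x s) + norm (?u s) * norm (?y s)
      + norm (?u s) * norm (g s)" for n s
    using abs_partial_inner_le[where n = n and x = "?y s" and y = "?y s"]
      abs_partial_inner_le[where n = n and x = "?x s" and y = "?x s"]
      abs_partial_inner_le[where n = n and x = "?u s" and y = "?y s"]
      abs_partial_inner_le[where n = n and x = "?u s" and y = "g s"] by linarith
  show "continuous_on {a..} (\<lambda>s. inner (?y s) (?y s) - inner (?x s) (?x s) - inner (?u s) (?y s) + inner (?u s) (g s))"
    "continuous_on {a..} (\<lambda>s. norm (?y s) * norm (?y s) + norm (?x s) * norm (?x s) + norm (?u s) * norm (?y s)
      + norm (?u s) * norm (g s))"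
    using z unfolding linear_solution_def by (auto intro!: continuous_intros)
qed

text \<open>\<open>N_potential\<close> bounds the Taylor remainder of this functional by a square,
  so \<open>N\<close> is its gradient although the positive part is not differentiable.\<close>

lemma potential_has_derivative:
  "((\<lambda>a. inner (N a) a / 2) has_derivative (\<lambda>h. inner (N a) h)) (at a)"
proof (rule has_derivativeI_sandwich[where e = 1])
  show "bounded_linear (\<lambda>h. inner (N a) h)"
    by (rule bounded_linear_inner_right)
  show "norm (inner (N b) b / 2 - inner (N a) a / 2 - inner (N a) (b - a)) / norm (b - a)
      \<le> norm (b - a) / 2" if "b \<noteq> a" for b
    using N_potential[of b a] that by (simp add: field_simps power2_eq_square)
  show "((\<lambda>b. norm (b - a) / 2) \<longlongrightarrow> 0) (at a)"
    by (rule tendsto_eq_intros refl | simp)+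
qed simp

lemma potential_has_real_derivative:
  assumes "(u has_vector_derivative u') (at t within S)"
  shows "((\<lambda>t. inner (N (u t)) (u t) / 2) has_real_derivative inner (N (u t)) u') (at t within S)"
proof -
  have "((\<lambda>t. inner (N (u t)) (u t) / 2) has_derivative (\<lambda>h. inner (N (u t)) (h *\<^sub>R u'))) (at t within S)"
    by (rule has_derivative_compose[OF assms[unfolded has_vector_derivative_def] potential_has_derivative])
  moreover have "(\<lambda>h. inner (N (u t)) (h *\<^sub>R u')) = (*) (inner (N (u t)) u')"
    by (simp add: fun_eq_iff mult.commute)
  ultimately show ?thesis
    unfolding has_field_derivative_def by (simp only:)
qed

text \<open>The mechanical energy: kinetic and bending energy, the stretching energy
  \<open>(p - \<parallel>u\<parallel>\<^sub>1\<^sup>2)\<^sup>2 / 4\<close>, the energy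
  \<open>k\<^sup>2 \<parallel>u\<^sup>+\<parallel>\<^sup>2 / 2\<close> of the one-sided springs,
  minus the work of the load \<open>f\<close>.\<close>

definition lyapunov :: "l2 \<times> l2 \<Rightarrow> real" where
  "lyapunov z = (norm z)\<^sup>2 / 2 + (\<beta> z)\<^sup>2 / 4 + k\<^sup>2 * (inner (N (K (fst z))) (K (fst z)) / 2)
     - inner f (K (fst z))"

text \<open>Each of the three terms of \<open>G\<close>, paired with \<open>y\<close>, is cancelled
  by the derivative of one of the last three summands of \<open>lyapunov\<close>; the damping
  remains.\<close>

lemma lyapunov_derivative:
  assumes z: "solution a z" and t: "a \<le> t"
  shows "((\<lambda>t. lyapunov (z t)) has_real_derivative - (norm (snd (z t)))\<^sup>2) (at t within {a..})"
proof -
  let ?x = "fst (z t)" and ?y = "snd (z t)"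
  have lin: "linear_solution (\<lambda>t. G (z t)) a z"
    using z unfolding solution_def .
  note pos = linear_solution_position[OF lin t]
  have "((\<lambda>t. inner f (K (fst (z t)))) has_vector_derivative inner f ?y) (at t within {a..})"
    by (rule bounded_linear.has_vector_derivative[OF bounded_linear_inner_right pos])
  then have "((\<lambda>t. inner f (K (fst (z t)))) has_real_derivative inner f ?y) (at t within {a..})"
    by (simp add: has_real_derivative_iff_has_vector_derivative)
  moreover have "((\<lambda>t. (\<beta> (z t))\<^sup>2) has_real_derivative
      2 * \<beta> (z t) * (- (2 * inner ?x ?y))) (at t within {a..})"
    unfolding \<beta>_def by (auto intro!: derivative_eq_intros linear_solution_stretch[OF lin t])
  ultimately have "((\<lambda>t. lyapunov (z t)) has_real_derivative
      2 * (inner (G (z t)) ?y - inner ?y ?y) / 2 + 2 * \<beta> (z t) * (- (2 * inner ?x ?y)) / 4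
      + k\<^sup>2 * inner (N (K ?x)) ?y - inner f ?y) (at t within {a..})"
    unfolding lyapunov_def
    by (intro DERIV_diff DERIV_add DERIV_cmult DERIV_cdivide linear_solution_energy[OF lin t]
        potential_has_real_derivative[OF pos])
  moreover have "2 * (inner (G (z t)) ?y - inner ?y ?y) / 2 + 2 * \<beta> (z t) * (- (2 * inner ?x ?y)) / 4
      + k\<^sup>2 * inner (N (K ?x)) ?y - inner f ?y = - (norm ?y)\<^sup>2"
    unfolding G_def by (simp add: inner_simps power2_norm_eq_inner field_simps)
  ultimately show ?thesis by simp
qed

lemma lyapunov_continuous: "continuous_on UNIV lyapunov"
  unfolding lyapunov_def by (intro continuous_intros) auto

end

section \<open>Dissipativity and continuous dependence\<close>

lemma exp_decay_tendsto_0: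
  fixes c :: real
  assumes "0 < c"
  shows "((\<lambda>s. exp (- (c * s))) \<longlongrightarrow> 0) at_top"
  by (rule filterlim_compose[OF exp_at_bot])
    (use assms in \<open>auto simp: filterlim_uminus_at_bot
      intro!: filterlim_tendsto_pos_mult_at_top[OF tendsto_const] filterlim_ident\<close>)

context bridge
begin

lemma abs_\<beta>_le: "norm z \<le> R \<Longrightarrow> \<bar>\<beta> z\<bar> \<le> \<bar>p\<bar> + \<kappa> * R\<^sup>2"
proof -
  assume z: "norm z \<le> R"
  then have x: "norm (fst z) \<le> R"
    using norm_fst_le[of "fst z" "snd z"] by simp
  have "\<bar>inner (K (fst z)) (fst z)\<bar> \<le> \<kappa> * (norm (fst z) * norm (fst z))"
    by (rule abs_inner_K_le)
  also have "\<dots> \<le> \<kappa> * (R * R)"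
    using x order_trans[OF norm_ge_zero x] by (intro mult_left_mono mult_mono \<kappa>_nonneg) auto
  finally show ?thesis
    unfolding \<beta>_def power2_eq_square by linarith
qed

lemma norm_fst_snd_le: "norm z \<le> R \<Longrightarrow> norm (fst z) \<le> R \<and> norm (snd z) \<le> R"
  using norm_fst_le[of "fst z" "snd z"] norm_snd_le[of "snd z" "fst z"] by simp

definition Gbound :: "real \<Rightarrow> real" where
  "Gbound R = norm f + (\<bar>p\<bar> + \<kappa> * R\<^sup>2) * R + k\<^sup>2 * (norm (N 0) + \<kappa> * R)"

lemma norm_G_le: 
  assumes z: "norm z \<le> R" 
  shows "norm (G z) \<le> Gbound R"
proof -
  have x: "norm (fst z) \<le> R"
    using norm_fst_snd_le[OF z] by blast
  have R: "0 \<le> R"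
    using z norm_ge_zero order_trans by blast
  have "norm (G z) \<le> norm (f + \<beta> z *\<^sub>R fst z) + norm (k\<^sup>2 *\<^sub>R N (K (fst z)))"
    unfolding G_def by (rule norm_triangle_ineq4)
  also have "\<dots> \<le> norm f + \<bar>\<beta> z\<bar> * norm (fst z) + k\<^sup>2 * norm (N (K (fst z)))"
    using norm_triangle_ineq[of f "\<beta> z *\<^sub>R fst z"] by simp
  also have "\<dots> \<le> norm f + (\<bar>p\<bar> + \<kappa> * R\<^sup>2) * R + k\<^sup>2 * (norm (N 0) + \<kappa> * R)"
  proof -
    have "norm (N (K (fst z))) \<le> norm (N 0) + \<kappa> * norm (fst z)"
      using norm_N_le[of "K (fst z)"] norm_K_le[of "fst z"] by linarith
    also have "\<dots> \<le> norm (N 0) + \<kappa> * R"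
      using mult_left_mono[OF x \<kappa>_nonneg] by simp
    finally have "k\<^sup>2 * norm (N (K (fst z))) \<le> k\<^sup>2 * (norm (N 0) + \<kappa> * R)"
      by (intro mult_left_mono) auto
    moreover have "\<bar>\<beta> z\<bar> * norm (fst z) \<le> (\<bar>p\<bar> + \<kappa> * R\<^sup>2) * R"
      using abs_\<beta>_le[OF z] x R \<kappa>_nonneg by (intro mult_mono) auto
    ultimately show ?thesis by linarith
  qed
  finally show ?thesis
    unfolding Gbound_def .
qed

lemma \<beta>_diff_le:
  assumes z: "norm z \<le> R" "norm z' \<le> R"
  shows "\<bar>\<beta> z - \<beta> z'\<bar> \<le> 2 * \<kappa> * R * norm (z - z')"
proof -
  let ?d = "fst z - fst z'"
  have R: "0 \<le> R"
    using z(1) norm_ge_zero order_trans by blast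
  have d: "norm ?d \<le> norm (z - z')"
    using norm_fst_snd_le[of "z - z'"] by simp
  have "\<beta> z' - \<beta> z = inner (K ?d) (fst z) + inner (K ?d) (fst z')"
    using K_symmetric[of "fst z" "fst z'"]
    unfolding \<beta>_def by (simp add: K_diff inner_simps inner_commute)
  also have "\<bar>\<dots>\<bar> \<le> \<kappa> * (norm ?d * norm (fst z)) + \<kappa> * (norm ?d * norm (fst z'))"
    using abs_inner_K_le[of ?d "fst z"] abs_inner_K_le[of ?d "fst z'"] by linarith
  also have "\<dots> \<le> \<kappa> * (norm (z - z') * R) + \<kappa> * (norm (z - z') * R)"
    using d norm_fst_snd_le[OF z(1)] norm_fst_snd_le[OF z(2)]
    by (intro add_mono mult_left_mono mult_mono \<kappa>_nonneg) auto
  finally show ?thesis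
    by (simp add: abs_minus_commute algebra_simps)
qed

text \<open>The summand 1 keeps the constant positive, so that it can serve as a rate in
  \<open>gronwall_Ici\<close>.\<close>

definition Glip :: "real \<Rightarrow> real" where
  "Glip R = \<bar>p\<bar> + \<kappa> * R\<^sup>2 + 2 * \<kappa> * R * R + k\<^sup>2 * \<kappa> + 1"

lemma G_locally_lipschitz:
  assumes z: "norm z \<le> R" "norm z' \<le> R"
  shows "norm (G z - G z') \<le> Glip R * norm (z - z')"
proof -
  let ?d = "fst z - fst z'" and ?n = "norm (z - z')"
  have R: "0 \<le> R"
    using z(1) norm_ge_zero order_trans by blast
  have d: "norm ?d \<le> ?n"
    using norm_fst_snd_le[of "z - z'"] by simp
  have "G z - G z' = \<beta> z *\<^sub>R ?d + (\<beta> z - \<beta> z') *\<^sub>R fst z' - k\<^sup>2 *\<^sub>R (N (K (fst z)) - N (K (fst z')))"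
    unfolding G_def by (simp add: algebra_simps)
  also have "norm \<dots> \<le> norm (\<beta> z *\<^sub>R ?d + (\<beta> z - \<beta> z') *\<^sub>R fst z') + norm (k\<^sup>2 *\<^sub>R (N (K (fst z)) - N (K (fst z'))))"
    by (rule norm_triangle_ineq4)
  also have "\<dots> \<le> \<bar>\<beta> z\<bar> * norm ?d + \<bar>\<beta> z - \<beta> z'\<bar> * norm (fst z') + k\<^sup>2 * norm (N (K (fst z)) - N (K (fst z')))"
    using norm_triangle_ineq[of "\<beta> z *\<^sub>R ?d" "(\<beta> z - \<beta> z') *\<^sub>R fst z'"] by simp
  also have "\<dots> \<le> (\<bar>p\<bar> + \<kappa> * R\<^sup>2) * ?n + (2 * \<kappa> * R * ?n) * R + k\<^sup>2 * (\<kappa> * ?n)"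
  proof (intro add_mono)
    show "\<bar>\<beta> z\<bar> * norm ?d \<le> (\<bar>p\<bar> + \<kappa> * R\<^sup>2) * ?n"
      using abs_\<beta>_le[OF z(1)] d \<kappa>_nonneg by (intro mult_mono) auto
    show "\<bar>\<beta> z - \<beta> z'\<bar> * norm (fst z') \<le> (2 * \<kappa> * R * ?n) * R"
      using \<beta>_diff_le[OF z] norm_fst_snd_le[OF z(2)] \<kappa>_nonneg R by (intro mult_mono) auto
    have "norm (N (K (fst z)) - N (K (fst z'))) \<le> norm (K ?d)"
      using N_lipschitz[of "K (fst z)" "K (fst z')"] by (simp add: K_diff)
    also have "\<dots> \<le> \<kappa> * ?n"
      using norm_K_le[of ?d] mult_left_mono[OF d \<kappa>_nonneg] by linarith
    finally show "k\<^sup>2 * norm (N (K (fst z)) - N (K (fst z'))) \<le> k\<^sup>2 * (\<kappa> * ?n)"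
      by (intro mult_left_mono) auto
  qed
  also have "\<dots> = (\<bar>p\<bar> + \<kappa> * R\<^sup>2 + 2 * \<kappa> * R * R + k\<^sup>2 * \<kappa>) * ?n"
    by (simp add: algebra_simps)
  also have "\<dots> \<le> Glip R * ?n"
    unfolding Glip_def by (intro mult_right_mono) auto
  finally show ?thesis .
qed

text \<open>The energy identity for the difference: the rotation has dropped out and the damping has
  a good sign, which leaves the Lipschitz bound of \<open>G\<close> on a ball. With equal initial
  values this is uniqueness.\<close>

lemma continuous_dependence:
  assumes z: "solution a z" "\<And>t. a \<le> t \<Longrightarrow> norm (z t) \<le> R"
    and z': "solution a z'" "\<And>t. a \<le> t \<Longrightarrow> norm (z' t) \<le> R"
    and t: "a \<le> t"
  shows "(norm (z t - z' t))\<^sup>2 \<le> exp (2 * Glip R * (t - a)) * (norm (z a - z' a))\<^sup>2"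
proof -
  have R: "0 \<le> R"
    using z(2)[of a] norm_ge_zero[of "z a"] by linarith
  have L: "0 < Glip R"
    unfolding Glip_def using \<kappa>_nonneg R by (intro add_nonneg_pos) auto
  then have nz: "- (2 * Glip R) \<noteq> 0"
    by simp
  have lin: "linear_solution (\<lambda>t. G (z t) - G (z' t)) a (\<lambda>t. z t - z' t)"
    using z(1) z'(1) unfolding solution_def by (rule linear_solution_diff)
  have "(norm (z t - z' t))\<^sup>2 \<le> 0 / - (2 * Glip R)
      + exp (- (- (2 * Glip R)) * (t - a)) * ((norm (z a - z' a))\<^sup>2 - 0 / - (2 * Glip R))"
  proof (rule gronwall_Ici[OF linear_solution_energy[OF lin] _ _ t])
    fix s assume s: "a \<le> s"
    let ?y = "snd (z s - z' s)"
    have "inner (G (z s) - G (z' s)) ?y \<le> norm (G (z s) - G (z' s)) * norm ?y"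
      by (rule norm_cauchy_schwarz)
    also have "\<dots> \<le> (Glip R * norm (z s - z' s)) * norm (z s - z' s)"
      using G_locally_lipschitz[OF z(2)[OF s] z'(2)[OF s]] norm_fst_snd_le[of "z s - z' s"] L
      by (intro mult_mono) auto
    finally have "inner (G (z s) - G (z' s)) ?y \<le> Glip R * (norm (z s - z' s))\<^sup>2"
      by (simp add: power2_eq_square mult.assoc)
    then have "inner (G (z s) - G (z' s)) ?y - inner ?y ?y \<le> Glip R * (norm (z s - z' s))\<^sup>2"
      using inner_ge_zero[of ?y] by linarith
    then show "2 * (inner (G (z s) - G (z' s)) ?y - inner ?y ?y)
        \<le> - (- (2 * Glip R)) * (norm (z s - z' s))\<^sup>2 + 0"
      by (simp only: minus_minus add_0_right mult.assoc mult_left_mono zero_le_numeral)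
  qed (use nz in auto)
  then show ?thesis by simp
qed

section \<open>The absorbing ball\<close>

definition eps :: real where
  "eps = 1 / (4 * (\<kappa>\<^sup>2 + \<kappa> + 1))"

text \<open>The bound on \<open>eps * \<kappa>\<close> keeps the modified energy coercive; the bound
  on \<open>eps * (\<kappa>\<^sup>2 + 3)\<close> leaves a nonnegative share of the damping in
  \<open>modified_energy_decay\<close>.\<close>

lemma eps: "0 < eps" "eps * \<kappa> \<le> 1 / 4" "eps * (\<kappa>\<^sup>2 + 3) \<le> 2"
proof -
  have pos: "0 < \<kappa>\<^sup>2 + \<kappa> + 1"
    using \<kappa>_nonneg by (intro add_nonneg_pos) auto
  then show "0 < eps" "eps * \<kappa> \<le> 1 / 4" "eps * (\<kappa>\<^sup>2 + 3) \<le> 2"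
    using \<kappa>_nonneg unfolding eps_def by (auto simp: field_simps)
qed

definition modified_energy :: "l2 \<times> l2 \<Rightarrow> real" where
  "modified_energy z = lyapunov z + eps * inner (K (fst z)) (snd z)"

text \<open>The load and the cross term each cost at most 1/8 of the squared norm, out of the 1/2
  present in the energy; the two potential terms are nonnegative and are dropped.\<close>

lemma norm_le_modified_energy: "(norm z)\<^sup>2 / 4 \<le> modified_energy z + 2 * (\<kappa> * norm f)\<^sup>2"
proof -
  let ?x = "norm (fst z)" and ?y = "norm (snd z)"
  have "\<bar>inner f (K (fst z))\<bar> \<le> norm f * (\<kappa> * ?x)"
    using order_trans[OF Cauchy_Schwarz_ineq2 mult_left_mono[OF norm_K_le norm_ge_zero]] .
  also have "\<dots> \<le> ?x\<^sup>2 / 8 + 2 * (\<kappa> * norm f)\<^sup>2"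
    using zero_le_power2[of "?x / 4 - 2 * (\<kappa> * norm f) / 2"]
      zero_le_power2[of "?x / 2 - 2 * (\<kappa> * norm f)"]
    by (simp add: power2_diff power_divide power_mult_distrib algebra_simps)
  finally have 1: "\<bar>inner f (K (fst z))\<bar> \<le> ?x\<^sup>2 / 8 + 2 * (\<kappa> * norm f)\<^sup>2" .
  have "\<bar>eps * inner (K (fst z)) (snd z)\<bar> \<le> eps * (\<kappa> * (?x * ?y))"
    using abs_inner_K_le[of "fst z" "snd z"] eps(1) by (simp add: abs_mult)
  also have "\<dots> = (eps * \<kappa>) * (?x * ?y)"
    by simp
  also have "\<dots> \<le> (1 / 4) * ((?x\<^sup>2 + ?y\<^sup>2) / 2)"
    using eps \<kappa>_nonneg sum_squares_bound[of ?x ?y] by (intro mult_mono) auto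
  finally have 2: "\<bar>eps * inner (K (fst z)) (snd z)\<bar> \<le> (?x\<^sup>2 + ?y\<^sup>2) / 8"
    by simp
  have 3: "0 \<le> k\<^sup>2 * (inner (N (K (fst z))) (K (fst z)) / 2)"
    using N_nonneg by simp
  have 4: "0 \<le> (\<beta> z)\<^sup>2 / 4"
    by simp
  show ?thesis
    unfolding modified_energy_def lyapunov_def norm_prod_sq
    using 1 2 3 4 zero_le_power2[of ?x] zero_le_power2[of ?y] by argo
qed

lemma modified_energy_bounded:
  "\<exists>Q. \<forall>z. norm z \<le> R \<longrightarrow> modified_energy z \<le> Q"
proof (intro exI allI impI)
  fix z :: "l2 \<times> l2" assume z: "norm z \<le> R"
  have R: "0 \<le> R"
    using z norm_ge_zero order_trans by blast
  have x: "norm (fst z) \<le> R" "norm (snd z) \<le> R"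
    using norm_fst_snd_le[OF z] by auto
  have Kx: "norm (K (fst z)) \<le> \<kappa> * R"
    using norm_K_le[of "fst z"] mult_left_mono[OF x(1) \<kappa>_nonneg] by linarith
  have \<kappa>R: "0 \<le> \<kappa> * R"
    using \<kappa>_nonneg R by simp
  have 1: "(norm z)\<^sup>2 \<le> R\<^sup>2"
    using z by (intro power_mono) auto
  have 2: "(\<beta> z)\<^sup>2 \<le> (\<bar>p\<bar> + \<kappa> * R\<^sup>2)\<^sup>2"
    using power_mono[OF abs_\<beta>_le[OF z], of 2] by simp
  have "inner (N (K (fst z))) (K (fst z)) \<le> norm (N (K (fst z))) * norm (K (fst z))"
    by (rule norm_cauchy_schwarz)
  also have "\<dots> \<le> (norm (N 0) + \<kappa> * R) * (\<kappa> * R)"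
    using norm_N_le[of "K (fst z)"] Kx \<kappa>R by (intro mult_mono) auto
  finally have 3: "k\<^sup>2 * (inner (N (K (fst z))) (K (fst z)) / 2) \<le> k\<^sup>2 * ((norm (N 0) + \<kappa> * R) * (\<kappa> * R) / 2)"
    by (intro mult_left_mono) auto
  have "\<bar>inner f (K (fst z))\<bar> \<le> norm f * norm (K (fst z))"
    by (rule Cauchy_Schwarz_ineq2)
  also have "\<dots> \<le> norm f * (\<kappa> * R)"
    using Kx by (intro mult_left_mono) auto
  finally have 4: "- inner f (K (fst z)) \<le> norm f * (\<kappa> * R)"
    by linarith
  have "inner (K (fst z)) (snd z) \<le> norm (K (fst z)) * norm (snd z)"
    by (rule norm_cauchy_schwarz)
  also have "\<dots> \<le> (\<kappa> * R) * R"
    using Kx x \<kappa>R by (intro mult_mono) auto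
  finally have 5: "eps * inner (K (fst z)) (snd z) \<le> eps * ((\<kappa> * R) * R)"
    using eps(1) by (intro mult_left_mono) auto
  show "modified_energy z \<le> R\<^sup>2 / 2 + (\<bar>p\<bar> + \<kappa> * R\<^sup>2)\<^sup>2 / 4
      + k\<^sup>2 * ((norm (N 0) + \<kappa> * R) * (\<kappa> * R) / 2) + norm f * (\<kappa> * R) + eps * ((\<kappa> * R) * R)"
    unfolding modified_energy_def lyapunov_def using 1 2 3 4 5 by linarith
qed

text \<open>When \<open>eps\<close> times the energy is added to its derivative, the terms with
  \<open>f\<close> cancel, the potential terms have a favourable sign, and the damping absorbs the
  rest. The constant \<open>p\<^sup>2 / 2\<close> is the price of the indefinite sign of
  \<beta>.\<close>

lemma modified_energy_decay:
  assumes z: "solution a z" and t: "a \<le> t"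
  shows "modified_energy (z t) \<le> p\<^sup>2 / 2 + exp (- eps * (t - a)) * (modified_energy (z a) - p\<^sup>2 / 2)"
proof -
  have lin: "linear_solution (\<lambda>t. G (z t)) a z"
    using z unfolding solution_def .
  let ?D = "\<lambda>s. - (norm (snd (z s)))\<^sup>2 + eps *
    (inner (snd (z s)) (snd (z s)) - inner (fst (z s)) (fst (z s)) - inner (K (fst (z s))) (snd (z s))
      + inner (K (fst (z s))) (G (z s)))"
  have "modified_energy (z t) \<le> (eps * (p\<^sup>2 / 2)) / eps
      + exp (- eps * (t - a)) * (modified_energy (z a) - (eps * (p\<^sup>2 / 2)) / eps)"
  proof (rule gronwall_Ici[where F' = ?D, OF _ _ _ t])
    fix s assume s: "a \<le> s"
    show "((\<lambda>s. modified_energy (z s)) has_real_derivative ?D s) (at s within {a..})"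
      unfolding modified_energy_def
      by (intro DERIV_add DERIV_cmult lyapunov_derivative[OF z s] linear_solution_cross[OF lin s])
    let ?x = "fst (z s)" and ?y = "snd (z s)" and ?u = "K (fst (z s))" and ?b = "\<beta> (z s)"
    define X Y n c g where "X = (norm ?x)\<^sup>2" and "Y = (norm ?y)\<^sup>2" and "n = k\<^sup>2 * inner (N ?u) ?u"
      and "c = inner ?u ?y" and "g = inner f ?u"
    have n: "0 \<le> n"
      unfolding n_def using N_nonneg by simp
    \<comment> \<open>The stretching term contributes \<beta> times \<open>inner ?u ?x\<close>, and
      the latter is \<open>p - \<beta>\<close>; completing the square isolates
      \<open>p\<^sup>2 / 2\<close>.\<close>
    have "inner ?u (G (z s)) = g + ?b * (p - ?b) - n"
      unfolding G_def g_def n_def \<beta>_def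
      by (simp add: inner_simps inner_commute)
    also have "?b * (p - ?b) \<le> p\<^sup>2 / 2 - ?b\<^sup>2 / 2"
      using zero_le_power2[of "p - ?b"] by (simp add: power2_diff power2_eq_square algebra_simps)
    finally have uG: "inner ?u (G (z s)) \<le> g + p\<^sup>2 / 2 - ?b\<^sup>2 / 2 - n"
      by simp
    have D: "?D s = - Y + eps * (Y - X - c + inner ?u (G (z s)))"
      unfolding X_def Y_def c_def by (simp add: power2_norm_eq_inner)
    have E: "modified_energy (z s) = (X + Y) / 2 + ?b\<^sup>2 / 4 + n / 2 - g + eps * c"
      unfolding modified_energy_def lyapunov_def norm_prod_sq X_def Y_def n_def g_def c_def by simp
    have "\<bar>c\<bar> \<le> \<kappa> * (norm ?x * norm ?y)"
      unfolding c_def by (rule abs_inner_K_le)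
    also have "\<dots> \<le> X / 2 + \<kappa>\<^sup>2 * Y / 2"
      using sum_squares_bound[of "norm ?x" "\<kappa> * norm ?y"]
      unfolding X_def Y_def by (simp add: power_mult_distrib algebra_simps)
    finally have c: "\<bar>c\<bar> \<le> X / 2 + \<kappa>\<^sup>2 * Y / 2" .
    have eps1: "eps \<le> 1"
    proof -
      have "eps * 3 \<le> eps * (\<kappa>\<^sup>2 + 3)"
        using eps(1) by (intro mult_left_mono) auto
      then show ?thesis
        using eps(3) by linarith
    qed
    have "- (1 - eps) * c = (1 - eps) * - c"
      by (simp add: algebra_simps)
    also have "\<dots> \<le> (1 - eps) * \<bar>c\<bar>"
      using eps1 by (intro mult_left_mono) auto
    also have "\<dots> \<le> 1 * \<bar>c\<bar>"
      using eps(1) by (intro mult_right_mono) auto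
    finally have c': "- (1 - eps) * c \<le> X / 2 + \<kappa>\<^sup>2 * Y / 2"
      using c by simp
    have "?D s + eps * modified_energy (z s)
        = - Y + eps * (Y - X - c + inner ?u (G (z s)) + (X + Y) / 2 + ?b\<^sup>2 / 4 + n / 2 - g + eps * c)"
      unfolding D E by (simp add: algebra_simps)
    also have "\<dots> \<le> - Y + eps * (3 * Y / 2 + \<kappa>\<^sup>2 * Y / 2 + p\<^sup>2 / 2)"
    proof -
      have "- (1 - eps) * c = - c + eps * c"
        by (simp add: algebra_simps)
      then have "Y - X - c + inner ?u (G (z s)) + (X + Y) / 2 + ?b\<^sup>2 / 4 + n / 2 - g + eps * c
          \<le> 3 * Y / 2 + \<kappa>\<^sup>2 * Y / 2 + p\<^sup>2 / 2"
        using uG c' n zero_le_power2[of ?b] by argo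
      then show ?thesis
        using eps(1) by simp
    qed
    also have "\<dots> = - Y * (1 - eps * (\<kappa>\<^sup>2 + 3) / 2) + eps * (p\<^sup>2 / 2)"
      by (simp add: field_simps)
    also have "\<dots> \<le> eps * (p\<^sup>2 / 2)"
      using eps(3) unfolding Y_def by simp
    finally show "?D s \<le> - eps * modified_energy (z s) + eps * (p\<^sup>2 / 2)"
      by simp
  qed (use eps(1) in simp)
  then show ?thesis
    using eps(1) by simp
qed

lemma solution_norm_le:
  assumes z: "solution a z" and t: "a \<le> t" and Q: "modified_energy (z a) \<le> Q"
  shows "(norm (z t))\<^sup>2 \<le> 2 * p\<^sup>2 + 8 * (\<kappa> * norm f)\<^sup>2 + 4 * exp (- eps * (t - a)) * \<bar>Q\<bar>"
proof -
  have "modified_energy (z a) - p\<^sup>2 / 2 \<le> \<bar>Q\<bar>"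
    using Q zero_le_power2[of p] abs_ge_self[of Q] by linarith
  then have "exp (- eps * (t - a)) * (modified_energy (z a) - p\<^sup>2 / 2) \<le> exp (- eps * (t - a)) * \<bar>Q\<bar>"
    by (intro mult_left_mono) auto
  then show ?thesis
    using modified_energy_decay[OF z t] norm_le_modified_energy[of "z t"] by linarith
qed

lemma solution_uniformly_bounded:
  "\<exists>R'. \<forall>z a t. solution a z \<longrightarrow> norm (z a) \<le> R \<longrightarrow> a \<le> t \<longrightarrow> norm (z t) \<le> R'"
proof -
  obtain Q where Q: "\<And>z. norm z \<le> R \<Longrightarrow> modified_energy z \<le> Q"
    using modified_energy_bounded by blast
  have "norm (z t) \<le> sqrt (2 * p\<^sup>2 + 8 * (\<kappa> * norm f)\<^sup>2 + 4 * \<bar>Q\<bar>)"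
    if "solution a z" "norm (z a) \<le> R" "a \<le> t" for z a t
  proof (rule real_le_rsqrt)
    have "exp (- eps * (t - a)) \<le> 1"
      using eps(1) that(3) by simp
    then have "4 * exp (- eps * (t - a)) * \<bar>Q\<bar> \<le> 4 * \<bar>Q\<bar>"
      using mult_right_mono[of "exp (- eps * (t - a))" 1 "4 * \<bar>Q\<bar>"] by (simp add: mult_ac)
    then show "(norm (z t))\<^sup>2 \<le> 2 * p\<^sup>2 + 8 * (\<kappa> * norm f)\<^sup>2 + 4 * \<bar>Q\<bar>"
      using solution_norm_le[OF that(1,3) Q[OF that(2)]] by linarith
  qed
  then show ?thesis by blast
qed

text \<open>The limit of the bound in \<open>solution_norm_le\<close>, with 1 added under the root
  as a slack below which the decaying term falls in finite time.\<close>

definition absorbing_radius :: real where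
  "absorbing_radius = sqrt (2 * p\<^sup>2 + 8 * (\<kappa> * norm f)\<^sup>2 + 1)"

lemma solution_absorbed:
  "\<exists>T\<ge>0. \<forall>z a t. solution a z \<longrightarrow> norm (z a) \<le> R \<longrightarrow> a + T \<le> t \<longrightarrow> norm (z t) \<le> absorbing_radius"
proof -
  obtain Q where Q: "\<And>z. norm z \<le> R \<Longrightarrow> modified_energy z \<le> Q"
    using modified_energy_bounded by blast
  have "((\<lambda>s. exp (- (eps * s))) \<longlongrightarrow> 0) at_top"
    by (rule exp_decay_tendsto_0[OF eps(1)])
  then have "((\<lambda>s. 4 * exp (- (eps * s)) * \<bar>Q\<bar>) \<longlongrightarrow> 4 * 0 * \<bar>Q\<bar>) at_top"
    by (intro tendsto_intros)
  then have "\<forall>\<^sub>F s in at_top. 4 * exp (- (eps * s)) * \<bar>Q\<bar> < 1"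
    by (rule order_tendstoD) simp
  then obtain T where T: "\<And>s. T \<le> s \<Longrightarrow> 4 * exp (- (eps * s)) * \<bar>Q\<bar> < 1"
    unfolding eventually_at_top_linorder by blast
  have "norm (z t) \<le> absorbing_radius"
    if "solution a z" "norm (z a) \<le> R" "a + max 0 T \<le> t" for z a t
    unfolding absorbing_radius_def
  proof (rule real_le_rsqrt)
    have "a \<le> t" "T \<le> t - a"
      using that(3) max.cobounded1[of 0 T] max.cobounded2[of T 0] by linarith+
    with solution_norm_le[OF that(1) this(1) Q[OF that(2)]] T[of "t - a"]
    show "(norm (z t))\<^sup>2 \<le> 2 * p\<^sup>2 + 8 * (\<kappa> * norm f)\<^sup>2 + 1"
      by simp
  qed
  then show ?thesis
    by (intro exI[of _ "max 0 T"]) auto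
qed

end

section \<open>High modes: compactness and regularity\<close>

text \<open>The range has finite nets: the heads lie in a compact set, and the finitely many early
  terms with uncontrolled tails join the net as points of their own.\<close>

lemma convergent_subsequence_of_small_tails:
  fixes W :: "nat \<Rightarrow> l2 \<times> l2"
  assumes bound: "\<And>m. norm (W m) \<le> R"
    and tails: "\<And>\<epsilon>. 0 < \<epsilon> \<Longrightarrow> \<exists>n m0. \<forall>m\<ge>m0.
      norm (fst (W m) - trunc n (fst (W m))) \<le> \<epsilon> \<and> norm (snd (W m) - trunc n (snd (W m))) \<le> \<epsilon>"
  shows "\<exists>r l. strict_mono (r :: nat \<Rightarrow> nat) \<and> (\<lambda>m. W (r m)) \<longlonglongrightarrow> l"
proof -
  have "\<exists>T. finite T \<and> closure (range W) \<subseteq> (\<Union>x\<in>T. ball x \<epsilon>)" if \<epsilon>: "0 < \<epsilon>" for \<epsilon>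
  proof -
    obtain n m0 where n: "\<And>m. m0 \<le> m \<Longrightarrow> norm (fst (W m) - trunc n (fst (W m))) \<le> \<epsilon> / 8"
        "\<And>m. m0 \<le> m \<Longrightarrow> norm (snd (W m) - trunc n (snd (W m))) \<le> \<epsilon> / 8"
      using tails[of "\<epsilon> / 8"] \<epsilon> by auto
    obtain C where C: "compact C" "trunc n ` cball 0 R \<subseteq> C"
      using compact_trunc_superset by blast
    have "0 < \<epsilon> / 4" using \<epsilon> by simp
    then obtain T where T: "finite T" "C \<times> C \<subseteq> (\<Union>x\<in>T. ball x (\<epsilon> / 4))"
      using compact_Times[OF C(1) C(1)] unfolding compact_eq_totally_bounded by blast
    have near: "\<exists>x\<in>T \<union> W ` {..<m0}. dist x (W m) < \<epsilon> / 2 + \<epsilon> / 4" for m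
    proof (cases "m < m0")
      case True
      then show ?thesis
        using \<epsilon> by (intro bexI[of _ "W m"]) auto
    next
      case False
      let ?V = "(trunc n (fst (W m)), trunc n (snd (W m)))"
      have "W m = (fst (W m), snd (W m))"
        by simp
      then have "dist ?V (W m) \<le> norm (trunc n (fst (W m)) - fst (W m)) + norm (trunc n (snd (W m)) - snd (W m))"
        using norm_Pair_le[of "trunc n (fst (W m)) - fst (W m)" "trunc n (snd (W m)) - snd (W m)"]
        by (metis dist_norm diff_Pair)
      also have "\<dots> \<le> \<epsilon> / 4"
        using n[of m] False by (simp add: norm_minus_commute)
      finally have d: "dist ?V (W m) \<le> \<epsilon> / 4" .
      have "norm (fst (W m)) \<le> R" "norm (snd (W m)) \<le> R"
        using bound[of m] norm_fst_le[of "fst (W m)" "snd (W m)"] norm_snd_le[of "snd (W m)" "fst (W m)"]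
        by simp_all
      then have "?V \<in> C \<times> C"
        using C(2) by auto
      then have "\<exists>x\<in>T. ?V \<in> ball x (\<epsilon> / 4)"
        using T(2) by blast
      then obtain x where "x \<in> T" "dist x ?V < \<epsilon> / 4"
        by auto
      then show ?thesis
        using d dist_triangle[of x "W m" ?V] \<epsilon> by (intro bexI[of _ x]) auto
    qed
    have "\<exists>x\<in>T \<union> W ` {..<m0}. dist x y < \<epsilon>" if "y \<in> closure (range W)" for y
    proof -
      have "\<exists>v\<in>range W. dist v y < \<epsilon> / 4"
        using that \<open>0 < \<epsilon> / 4\<close> unfolding closure_approachable by blast
      then obtain m where "dist (W m) y < \<epsilon> / 4"
        by blast
      moreover obtain x where "x \<in> T \<union> W ` {..<m0}" "dist x (W m) < \<epsilon> / 2 + \<epsilon> / 4"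
        using near by blast
      ultimately show ?thesis
        using dist_triangle[of x y "W m"] by (intro bexI[of _ x]) linarith+
    qed
    then have "closure (range W) \<subseteq> (\<Union>x\<in>T \<union> W ` {..<m0}. ball x \<epsilon>)"
      unfolding subset_eq UN_iff mem_ball by blast
    then show ?thesis
      using T(1) by (intro exI[of _ "T \<union> W ` {..<m0}"]) simp
  qed
  then have "compact (closure (range W))"
    by (auto simp: compact_eq_totally_bounded complete_eq_closed)
  moreover have "W m \<in> closure (range W)" for m
    using closure_subset[of "range W"] by blast
  ultimately show ?thesis
    unfolding compact_eq_seq_compact_metric seq_compact_def o_def by blast
qed

lemma vector_derivative_lipschitz:
  assumes "\<And>t. (g has_vector_derivative g' t) (at t)" "\<And>t. norm (g' t) \<le> B"
  shows "norm (g t - g s) \<le> B * \<bar>t - s\<bar>"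
proof -
  have "norm (g t - g s) \<le> B * norm (t - s)"
  proof (rule differentiable_bound[of UNIV g "\<lambda>x h. h *\<^sub>R g' x"])
    show "(g has_derivative (\<lambda>h. h *\<^sub>R g' x)) (at x within UNIV)" for x
      using assms(1)[of x] by (simp add: has_vector_derivative_def)
    show "onorm (\<lambda>h. h *\<^sub>R g' x) \<le> B" for x
    proof (rule onorm_le)
      show "norm (h *\<^sub>R g' x) \<le> B * norm h" for h :: real
        using mult_left_mono[OF assms(2)[of x], of "\<bar>h\<bar>"] by (simp add: mult.commute)
    qed
  qed auto
  then show ?thesis by simp
qed

lemma DERIV_difference_quotient_sequence:
  assumes "(g has_real_derivative D) (at t)"
  shows "(\<lambda>n. (g (t + inverse (real (Suc n))) - g t) / inverse (real (Suc n))) \<longlonglongrightarrow> D"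
proof (rule filterlim_compose[where g = "\<lambda>h. (g (t + h) - g t) / h"])
  show "((\<lambda>h. (g (t + h) - g t) / h) \<longlongrightarrow> D) (at 0)"
    using assms by (simp add: DERIV_def)
  show "filterlim (\<lambda>n. inverse (real (Suc n))) (at 0) sequentially"
    by (rule filterlim_atI[OF LIMSEQ_inverse_real_of_nat]) simp
qed

context bridge
begin

lemma w_inverse_tendsto_0: "(\<lambda>j. 1 / w j) \<longlonglongrightarrow> 0"
proof (rule LIMSEQ_I)
  fix \<epsilon> :: real assume \<epsilon>: "0 < \<epsilon>"
  obtain n where n: "\<And>j. 0 < w j \<and> w j \<le> 1 / \<epsilon> \<Longrightarrow> j < n"
    using w_finite[of "1 / \<epsilon>"] unfolding finite_nat_set_iff_bounded by blast
  have "norm (1 / w j - 0) < \<epsilon>" if "n \<le> j" for j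
  proof (cases "w j = 0")
    case False
    then have "1 / \<epsilon> < w j"
      using n[of j] that w_nonneg[of j] by force
    then show ?thesis
      using \<epsilon> False w_nonneg[of j] by (simp add: field_simps)
  qed (use \<epsilon> in simp)
  then show "\<exists>n. \<forall>j\<ge>n. norm (1 / w j - 0) < \<epsilon>"
    by blast
qed

lemma w_eventually_large: "\<exists>n. \<forall>j\<ge>n. w j = 0 \<or> c \<le> w j"
proof -
  obtain n where n: "\<And>j. 0 < w j \<and> w j \<le> c \<Longrightarrow> j < n"
    using w_finite[of c] unfolding finite_nat_set_iff_bounded by blast
  have "w j = 0 \<or> c \<le> w j" if "n \<le> j" for j
    using n[of j] that w_nonneg[of j] by force
  then show ?thesis by blast
qed

lemma norm_tail_le_of_sums:
  assumes "\<And>m. (\<Sum>j\<in>{j \<in> {n..<m}. w j \<noteq> 0}. (coord x j)\<^sup>2) \<le> B\<^sup>2"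
    and "\<And>j. w j = 0 \<Longrightarrow> coord x j = 0" "0 \<le> B"
  shows "norm (x - trunc n x) \<le> B"
proof (rule norm_l2_le[OF _ assms(3)])
  fix m
  have "(\<Sum>j<m. (coord (x - trunc n x) j)\<^sup>2) = (\<Sum>j\<in>{j \<in> {n..<m}. w j \<noteq> 0}. (coord x j)\<^sup>2)"
    by (rule sum.mono_neutral_cong_right) (use assms(2) in auto)
  then show "(\<Sum>j<m. (coord (x - trunc n x) j)\<^sup>2) \<le> B\<^sup>2"
    using assms(1) by simp
qed

lemma solution_\<beta>_derivative:
  assumes "solution a z" "a \<le> t"
  shows "((\<lambda>t. \<beta> (z t)) has_real_derivative - (2 * inner (fst (z t)) (snd (z t)))) (at t within {a..})"
  using linear_solution_stretch[OF assms(1)[unfolded solution_def] assms(2)]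
  unfolding \<beta>_def by (auto intro!: derivative_eq_intros)

lemma abs_\<beta>_derivative_le:
  assumes "norm z \<le> R"
  shows "\<bar>- (2 * inner (fst z) (snd z))\<bar> \<le> 2 * R\<^sup>2"
proof -
  have "\<bar>inner (fst z) (snd z)\<bar> \<le> norm (fst z) * norm (snd z)"
    by (rule Cauchy_Schwarz_ineq2)
  also have "\<dots> \<le> R * R"
    using norm_fst_snd_le[OF assms] order_trans[OF norm_ge_zero assms] by (intro mult_mono) auto
  finally show ?thesis
    by (simp add: power2_eq_square)
qed

text \<open>A single constant for \<beta> and its time derivative, as \<open>high_mode_decay\<close>
  expects.\<close>

definition coefficient_bound :: "real \<Rightarrow> real" where
  "coefficient_bound R = \<bar>p\<bar> + \<kappa> * R\<^sup>2 + 2 * R\<^sup>2"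

lemma coefficient_bound:
  assumes "norm z \<le> R"
  shows "\<bar>\<beta> z\<bar> \<le> coefficient_bound R" "\<bar>- (2 * inner (fst z) (snd z))\<bar> \<le> coefficient_bound R"
    "0 \<le> coefficient_bound R"
proof -
  have "0 \<le> \<kappa> * R\<^sup>2" "0 \<le> R\<^sup>2"
    using \<kappa>_nonneg by auto
  then show "\<bar>\<beta> z\<bar> \<le> coefficient_bound R" "\<bar>- (2 * inner (fst z) (snd z))\<bar> \<le> coefficient_bound R"
    "0 \<le> coefficient_bound R"
    unfolding coefficient_bound_def
    using abs_\<beta>_le[OF assms] abs_\<beta>_derivative_le[OF assms] by linarith+
qed

lemma sum_sq_phase_le:
  assumes "finite F"
  shows "(\<Sum>j\<in>F. (coord (fst z) j)\<^sup>2 + (coord (snd z) j)\<^sup>2) \<le> (norm z)\<^sup>2"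
  unfolding sum.distrib norm_prod_sq by (intro add_mono sum_coord_le assms)

text \<open>Compactness of \<open>A\<^sup>-\<^sup>1\<^sup>/\<^sup>2\<close> makes the high modes of the forcing \<open>f - k\<^sup>2 u\<^sup>+\<close> uniformly small.\<close>

lemma solution_tails:
  assumes \<epsilon>: "0 < \<epsilon>"
  shows "\<exists>n T. \<forall>z t. solution 0 z \<longrightarrow> (\<forall>t\<ge>0. norm (z t) \<le> R) \<longrightarrow> 0 \<le> t \<longrightarrow> T \<le> t \<longrightarrow>
    norm (fst (z t) - trunc n (fst (z t))) \<le> \<epsilon> \<and> norm (snd (z t) - trunc n (snd (z t))) \<le> \<epsilon>"
proof -
  define C where "C = coefficient_bound R"
  \<comment> \<open>Chosen so that the term \<open>64 * \<eta>\<^sup>2\<close> from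
    \<open>high_mode_decay\<close> equals \<open>\<epsilon>\<^sup>2 / 4\<close>; the decaying term
    is allowed another \<open>\<epsilon>\<^sup>2 / 2\<close>.\<close>
  define \<eta> where "\<eta> = \<epsilon> / 16"
  have \<eta>: "0 < \<eta>"
    using \<epsilon> unfolding \<eta>_def by simp
  \<comment> \<open>Only this part of \<open>G\<close> counts as forcing, expressed through
    \<open>u\<close>. The term \<open>\<beta> x\<close> stays in the equation as a coefficient,
    since its high modes are not yet known to be small.\<close>
  define c where "c v = f - k\<^sup>2 *\<^sub>R N v" for v
  have "compact (c ` closure (K ` cball 0 R))"
  proof (rule compact_continuous_image)
    show "continuous_on (closure (K ` cball 0 R)) c"
      unfolding c_def
      by (rule continuous_on_diff continuous_on_const continuous_on_scaleR
          continuous_on_subset[OF continuous_on_N] subset_UNIV)+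
    show "compact (closure (K ` cball 0 R))"
      unfolding K_def by (rule relatively_compact_diag_cball[OF \<kappa> w_inverse_tendsto_0])
  qed
  from compact_uniform_tails[OF this \<eta>]
  obtain n0 where n0: "\<And>n v. n0 \<le> n \<Longrightarrow> v \<in> c ` closure (K ` cball 0 R) \<Longrightarrow> norm (v - trunc n v) < \<eta>"
    by blast
  obtain n1 where n1: "\<And>j. n1 \<le> j \<Longrightarrow> w j = 0 \<or> 16 * (1 + C) \<le> w j"
    using w_eventually_large[of "16 * (1 + C)"] by blast
  define n where "n = max n0 n1"
  have "((\<lambda>s :: real. exp (- (s / 4))) \<longlongrightarrow> 0) at_top"
    using exp_decay_tendsto_0[of "1 / 4"] by simp
  then have "((\<lambda>s. 4 * exp (- (s / 4)) * R\<^sup>2) \<longlongrightarrow> 4 * 0 * R\<^sup>2) at_top"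
    by (intro tendsto_intros)
  then have "\<forall>\<^sub>F s in at_top. 4 * exp (- (s / 4)) * R\<^sup>2 < \<epsilon>\<^sup>2 / 2"
    by (rule order_tendstoD) (use \<epsilon> in simp)
  then obtain T where T: "\<And>s. T \<le> s \<Longrightarrow> 4 * exp (- (s / 4)) * R\<^sup>2 < \<epsilon>\<^sup>2 / 2"
    unfolding eventually_at_top_linorder by blast
  have "norm (fst (z t) - trunc n (fst (z t))) \<le> \<epsilon> \<and> norm (snd (z t) - trunc n (snd (z t))) \<le> \<epsilon>"
    if z: "solution 0 z" "\<And>t. 0 \<le> t \<Longrightarrow> norm (z t) \<le> R" and t: "0 \<le> t" "T \<le> t" for z t
  proof -
    have sum_le: "(\<Sum>j\<in>{j \<in> {n..<m}. w j \<noteq> 0}. (coord (fst (z t)) j)\<^sup>2 + (coord (snd (z t)) j)\<^sup>2) \<le> \<epsilon>\<^sup>2" for m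
    proof -
      let ?F = "{j \<in> {n..<m}. w j \<noteq> 0}"
      have "(\<Sum>j\<in>?F. (coord (fst (z t)) j)\<^sup>2 + (coord (snd (z t)) j)\<^sup>2)
        \<le> 64 * \<eta>\<^sup>2 + 4 * exp (- (t - 0) / 4) * (\<Sum>j\<in>?F. (coord (fst (z 0)) j)\<^sup>2 + (coord (snd (z 0)) j)\<^sup>2)"
      proof (rule high_mode_decay[where \<omega> = w and C = C and \<beta> = "\<lambda>t. \<beta> (z t)"
            and r = "\<lambda>j t. coord (c (K (fst (z t)))) j"])
        show "16 * (1 + C) \<le> w j" if "j \<in> ?F" for j
          using n1[of j] that unfolding n_def by auto
        show "((\<lambda>t. coord (fst (z t)) j) has_real_derivative w j * coord (snd (z s)) j) (at s within {0..})"
          if "0 \<le> s" for j s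
          using z(1) that unfolding solution_def linear_solution_def by blast
        have "((\<lambda>t. coord (snd (z t)) j) has_real_derivative - w j * coord (fst (z s)) j - coord (snd (z s)) j
            + coord (G (z s)) j) (at s within {0..})" if "0 \<le> s" for j s
          using z(1) that unfolding solution_def linear_solution_def by blast
        then show "((\<lambda>t. coord (snd (z t)) j) has_real_derivative - w j * coord (fst (z s)) j - coord (snd (z s)) j
            + \<beta> (z s) * coord (fst (z s)) j + coord (c (K (fst (z s)))) j) (at s within {0..})"
          if "0 \<le> s" for j s
          using that by (simp add: G_def c_def algebra_simps)
        show "((\<lambda>t. \<beta> (z t)) has_real_derivative - (2 * inner (fst (z s)) (snd (z s)))) (at s within {0..})"
          if "0 \<le> s" for s
          by (rule solution_\<beta>_derivative[OF z(1) that])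
        show "\<bar>\<beta> (z s)\<bar> \<le> C" "\<bar>- (2 * inner (fst (z s)) (snd (z s)))\<bar> \<le> C" if "0 \<le> s" for s
          unfolding C_def by (rule coefficient_bound[OF z(2)[OF that]])+
        show "(\<Sum>j\<in>?F. (coord (c (K (fst (z s)))) j)\<^sup>2) \<le> \<eta>\<^sup>2" if s: "0 \<le> s" for s
        proof -
          let ?v = "c (K (fst (z s)))"
          have "fst (z s) \<in> cball 0 R"
            using norm_fst_snd_le[OF z(2)[OF s]] by simp
          then have "?v \<in> c ` closure (K ` cball 0 R)"
            using closure_subset by blast
          then have "norm (?v - trunc n ?v) < \<eta>"
            by (intro n0) (simp_all add: n_def)
          then have "(norm (?v - trunc n ?v))\<^sup>2 \<le> \<eta>\<^sup>2"
            by (intro power_mono) auto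
          moreover have "(\<Sum>j\<in>?F. (coord ?v j)\<^sup>2) = (\<Sum>j\<in>?F. (coord (?v - trunc n ?v) j)\<^sup>2)"
            by (rule sum.cong) auto
          moreover have "(\<Sum>j\<in>?F. (coord (?v - trunc n ?v) j)\<^sup>2) \<le> (norm (?v - trunc n ?v))\<^sup>2"
            by (rule sum_coord_le) simp
          ultimately show ?thesis by linarith
        qed
      qed (use t in auto)
      also have "\<dots> \<le> 64 * \<eta>\<^sup>2 + 4 * exp (- (t / 4)) * R\<^sup>2"
      proof -
        have "(\<Sum>j\<in>?F. (coord (fst (z 0)) j)\<^sup>2 + (coord (snd (z 0)) j)\<^sup>2) \<le> (norm (z 0))\<^sup>2"
          by (rule sum_sq_phase_le) simp
        also have "\<dots> \<le> R\<^sup>2"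
          using z(2)[of 0] by (intro power_mono) auto
        finally have "(\<Sum>j\<in>?F. (coord (fst (z 0)) j)\<^sup>2 + (coord (snd (z 0)) j)\<^sup>2) \<le> R\<^sup>2" .
        then have "4 * exp (- (t / 4)) * (\<Sum>j\<in>?F. (coord (fst (z 0)) j)\<^sup>2 + (coord (snd (z 0)) j)\<^sup>2)
            \<le> 4 * exp (- (t / 4)) * R\<^sup>2"
          by (intro mult_left_mono) auto
        then show ?thesis by simp
      qed
      also have "\<dots> \<le> \<epsilon>\<^sup>2"
      proof -
        have "64 * \<eta>\<^sup>2 = \<epsilon>\<^sup>2 / 4"
          unfolding \<eta>_def by (simp add: power_divide)
        then show ?thesis
          using T[OF t(2)] zero_le_power2[of \<epsilon>] by linarith
      qed
      finally show ?thesis .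
    qed
    have phase: "z t \<in> phase"
      using z(1) t unfolding solution_def linear_solution_def by blast
    have "(\<Sum>j\<in>{j \<in> {n..<m}. w j \<noteq> 0}. (coord (fst (z t)) j)\<^sup>2) \<le> \<epsilon>\<^sup>2"
      "(\<Sum>j\<in>{j \<in> {n..<m}. w j \<noteq> 0}. (coord (snd (z t)) j)\<^sup>2) \<le> \<epsilon>\<^sup>2" for m
      by (rule order_trans[OF sum_mono sum_le[of m]], simp)+
    then show ?thesis
      using phase \<epsilon> unfolding phase_def by (intro conjI norm_tail_le_of_sums) auto
  qed
  then show ?thesis by blast
qed

text \<open>Time difference quotients of a complete bounded solution satisfy the linearised equation
  with a bounded right-hand side, so they stay bounded uniformly in the step; letting the
  step tend to \<open>0\<close> bounds the time derivative, and the equation then bounds \<open>A u\<close>.\<close>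

lemma difference_quotient_high_modes:
  assumes z: "\<And>a. solution a z" "\<And>t. norm (z t) \<le> R"
    and F: "finite F" "\<And>j. j \<in> F \<Longrightarrow> 16 * (1 + coefficient_bound R) \<le> w j" and h: "0 < h"
  shows "(\<Sum>j\<in>F. ((coord (fst (z (t + h))) j - coord (fst (z t)) j) / h)\<^sup>2
      + ((coord (snd (z (t + h))) j - coord (snd (z t)) j) / h)\<^sup>2) \<le> 64 * (2 * R\<^sup>2 * R + k\<^sup>2 * R)\<^sup>2"
proof -
  define X Y where "X j t = (coord (fst (z (t + h))) j - coord (fst (z t)) j) / h"
    and "Y j t = (coord (snd (z (t + h))) j - coord (snd (z t)) j) / h" for j t
  \<comment> \<open>The discrete product rule: \<beta> at the later time stays as the coefficient of
    \<open>X\<close>, and its own quotient multiplies \<open>x\<close> at the earlier time.\<close>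
  define \<rho> where "\<rho> t = ((\<beta> (z (t + h)) - \<beta> (z t)) / h) *\<^sub>R fst (z t)
      - (k\<^sup>2 / h) *\<^sub>R (N (K (fst (z (t + h)))) - N (K (fst (z t))))" for t
  \<comment> \<open>\<open>2 * R\<^sup>2\<close> bounds the derivative of \<beta>, and
    \<open>R\<close> bounds the speed of \<open>u\<close> in \<open>H\<close>, hence also that of
    its positive part.\<close>
  define B where "B = 2 * R\<^sup>2 * R + k\<^sup>2 * R"
  have R: "0 \<le> R"
    using z(2)[of 0] norm_ge_zero[of "z 0"] by linarith
  have dx: "((\<lambda>t. coord (fst (z t)) j) has_real_derivative w j * coord (snd (z t)) j) (at t)"
    and dy: "((\<lambda>t. coord (snd (z t)) j) has_real_derivative
          - w j * coord (fst (z t)) j - coord (snd (z t)) j + coord (G (z t)) j) (at t)"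
    and db: "((\<lambda>t. \<beta> (z t)) has_real_derivative - (2 * inner (fst (z t)) (snd (z t)))) (at t)"
    and du: "((\<lambda>t. K (fst (z t))) has_vector_derivative snd (z t)) (at t)" for j t
  proof -
    have sol: "linear_solution (\<lambda>t. G (z t)) (t - 1) z"
      using z(1)[of "t - 1"] unfolding solution_def .
    have "((\<lambda>t. coord (fst (z t)) j) has_real_derivative w j * coord (snd (z t)) j) (at t within {t - 1..})"
      "((\<lambda>t. coord (snd (z t)) j) has_real_derivative
          - w j * coord (fst (z t)) j - coord (snd (z t)) j + coord (G (z t)) j) (at t within {t - 1..})"
      using sol unfolding linear_solution_def by auto
    then show "((\<lambda>t. coord (fst (z t)) j) has_real_derivative w j * coord (snd (z t)) j) (at t)"
      "((\<lambda>t. coord (snd (z t)) j) has_real_derivative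
          - w j * coord (fst (z t)) j - coord (snd (z t)) j + coord (G (z t)) j) (at t)"
      by (auto intro: has_real_derivative_at_gt)
    show "((\<lambda>t. \<beta> (z t)) has_real_derivative - (2 * inner (fst (z t)) (snd (z t)))) (at t)"
      using solution_\<beta>_derivative[OF z(1)[of "t - 1"], of t] by (auto intro: has_real_derivative_at_gt)
    show "((\<lambda>t. K (fst (z t))) has_vector_derivative snd (z t)) (at t)"
      using linear_solution_position[OF sol, of t] at_within_interior[of t "{t - 1..}"]
      by (simp add: interior_Ici)
  qed
  have \<rho>: "norm (\<rho> t) \<le> B" for t
  proof -
    have "\<bar>\<beta> (z (t + h)) - \<beta> (z t)\<bar> \<le> 2 * R\<^sup>2 * \<bar>t + h - t\<bar>"
      using vector_derivative_lipschitz[where g = "\<lambda>t. \<beta> (z t)"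
          and g' = "\<lambda>t. - (2 * inner (fst (z t)) (snd (z t)))" and B = "2 * R\<^sup>2" and t = "t + h" and s = t]
        db abs_\<beta>_derivative_le[OF z(2)]
      by (auto simp: has_real_derivative_iff_has_vector_derivative)
    then have "\<bar>(\<beta> (z (t + h)) - \<beta> (z t)) / h\<bar> \<le> 2 * R\<^sup>2"
      using h by (simp add: field_simps)
    then have 1: "norm (((\<beta> (z (t + h)) - \<beta> (z t)) / h) *\<^sub>R fst (z t)) \<le> 2 * R\<^sup>2 * R"
      using norm_fst_snd_le[OF z(2)[of t]] unfolding norm_scaleR by (intro mult_mono) auto
    have "norm (K (fst (z (t + h))) - K (fst (z t))) \<le> R * \<bar>t + h - t\<bar>"
      by (rule vector_derivative_lipschitz[OF du]) (use norm_fst_snd_le[OF z(2)] in blast)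
    then have "norm (N (K (fst (z (t + h)))) - N (K (fst (z t)))) \<le> R * h"
      using N_lipschitz[of "K (fst (z (t + h)))" "K (fst (z t))"] h by simp
    then have "(k\<^sup>2 / h) * norm (N (K (fst (z (t + h)))) - N (K (fst (z t)))) \<le> (k\<^sup>2 / h) * (R * h)"
      using h by (intro mult_left_mono) auto
    then have 2: "norm ((k\<^sup>2 / h) *\<^sub>R (N (K (fst (z (t + h)))) - N (K (fst (z t))))) \<le> k\<^sup>2 * R"
      using h by simp
    show ?thesis
      unfolding \<rho>_def B_def
      using 1 2 norm_triangle_ineq4[of "((\<beta> (z (t + h)) - \<beta> (z t)) / h) *\<^sub>R fst (z t)"
          "(k\<^sup>2 / h) *\<^sub>R (N (K (fst (z (t + h)))) - N (K (fst (z t))))"] by linarith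
  qed
  have estimate: "(\<Sum>j\<in>F. (X j t)\<^sup>2 + (Y j t)\<^sup>2) \<le> 64 * B\<^sup>2 + 4 * exp (- (real n / 4)) * (2 * R / h)\<^sup>2" for n :: nat
  proof -
    \<comment> \<open>The estimate starts at \<open>t - n\<close>. There the quotient is bounded by
      \<open>2 * R / h\<close>, and with \<open>h\<close> fixed the exponential factor removes this
      contribution as \<open>n\<close> grows.\<close>
    define a where "a = t - real n"
    have "(\<Sum>j\<in>F. (X j t)\<^sup>2 + (Y j t)\<^sup>2)
      \<le> 64 * B\<^sup>2 + 4 * exp (- (t - a) / 4) * (\<Sum>j\<in>F. (X j a)\<^sup>2 + (Y j a)\<^sup>2)"
    proof (rule high_mode_decay[where X = X and Y = Y and \<omega> = w and C = "coefficient_bound R" and \<beta> = "\<lambda>t. \<beta> (z (t + h))"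
          and r = "\<lambda>j t. coord (\<rho> t) j"])
      have "(X j has_real_derivative (w j * coord (snd (z (s + h))) j - w j * coord (snd (z s)) j) / h)
          (at s within {a..})" for j s
        unfolding X_def
        by (rule has_field_derivative_at_within,
            intro DERIV_cdivide DERIV_diff dx[of j "s + h", unfolded DERIV_shift] dx[of j s])
      then show "(X j has_real_derivative w j * Y j s) (at s within {a..})" for j s
        unfolding Y_def by (simp only: right_diff_distrib times_divide_eq_right)
      have "(Y j has_real_derivative ((- w j * coord (fst (z (s + h))) j - coord (snd (z (s + h))) j + coord (G (z (s + h))) j)
          - (- w j * coord (fst (z s)) j - coord (snd (z s)) j + coord (G (z s)) j)) / h) (at s within {a..})" for j s
        unfolding Y_def
        by (rule has_field_derivative_at_within,
            intro DERIV_cdivide DERIV_diff dy[of j "s + h", unfolded DERIV_shift] dy[of j s])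
      moreover have "((- w j * coord (fst (z (s + h))) j - coord (snd (z (s + h))) j + coord (G (z (s + h))) j)
          - (- w j * coord (fst (z s)) j - coord (snd (z s)) j + coord (G (z s)) j)) / h
        = - w j * X j s - Y j s + \<beta> (z (s + h)) * X j s + coord (\<rho> s) j" for j s
        unfolding X_def Y_def \<rho>_def G_def using h by (simp add: field_simps)
      ultimately show "(Y j has_real_derivative - w j * X j s - Y j s + \<beta> (z (s + h)) * X j s + coord (\<rho> s) j)
          (at s within {a..})" for j s
        by simp
      show "((\<lambda>t. \<beta> (z (t + h))) has_real_derivative - (2 * inner (fst (z (s + h))) (snd (z (s + h))))) (at s within {a..})" for s
        using db[of "s + h"] unfolding DERIV_shift by (rule has_field_derivative_at_within)
      show "\<bar>\<beta> (z (s + h))\<bar> \<le> coefficient_bound R"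
        "\<bar>- (2 * inner (fst (z (s + h))) (snd (z (s + h))))\<bar> \<le> coefficient_bound R" for s
        by (rule coefficient_bound[OF z(2)])+
      show "(\<Sum>j\<in>F. (coord (\<rho> s) j)\<^sup>2) \<le> B\<^sup>2" for s
        using sum_coord_le[OF F(1), of "\<rho> s"] power_mono[OF \<rho>[of s], of 2] by simp
    qed (use F in \<open>auto simp: a_def\<close>)
    moreover have "(\<Sum>j\<in>F. (X j a)\<^sup>2 + (Y j a)\<^sup>2) \<le> (2 * R / h)\<^sup>2"
    proof -
      let ?\<delta> = "(1 / h) *\<^sub>R (z (a + h) - z a)"
      have "(\<Sum>j\<in>F. (X j a)\<^sup>2 + (Y j a)\<^sup>2) = (\<Sum>j\<in>F. (coord (fst ?\<delta>) j)\<^sup>2 + (coord (snd ?\<delta>) j)\<^sup>2)"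
        unfolding X_def Y_def by simp
      also have "\<dots> \<le> (norm ?\<delta>)\<^sup>2"
        by (rule sum_sq_phase_le[OF F(1)])
      also have "norm (z (a + h) - z a) \<le> 2 * R"
        using norm_triangle_ineq4[of "z (a + h)" "z a"] z(2)[of a] z(2)[of "a + h"] by linarith
      then have "(norm ?\<delta>)\<^sup>2 \<le> (2 * R / h)\<^sup>2"
        using h by (intro power_mono) (auto simp: divide_right_mono)
      finally show ?thesis .
    qed
    then have "4 * exp (- (t - a) / 4) * (\<Sum>j\<in>F. (X j a)\<^sup>2 + (Y j a)\<^sup>2) \<le> 4 * exp (- (t - a) / 4) * (2 * R / h)\<^sup>2"
      by (intro mult_left_mono) auto
    ultimately have "(\<Sum>j\<in>F. (X j t)\<^sup>2 + (Y j t)\<^sup>2) \<le> 64 * B\<^sup>2 + 4 * exp (- (t - a) / 4) * (2 * R / h)\<^sup>2"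
      by linarith
    moreover have "- (t - a) / 4 = - (real n / 4)"
      unfolding a_def by simp
    ultimately show ?thesis
      by (simp only:)
  qed
  have "(\<lambda>n. exp (- (real n / 4))) \<longlonglongrightarrow> 0"
    using filterlim_compose[OF exp_decay_tendsto_0[of "1 / 4"] filterlim_real_sequentially] by simp
  then have "(\<lambda>n. 64 * B\<^sup>2 + 4 * exp (- (real n / 4)) * (2 * R / h)\<^sup>2) \<longlonglongrightarrow> 64 * B\<^sup>2 + 4 * 0 * (2 * R / h)\<^sup>2"
    by (intro tendsto_intros)
  then have "(\<Sum>j\<in>F. (X j t)\<^sup>2 + (Y j t)\<^sup>2) \<le> 64 * B\<^sup>2 + 4 * 0 * (2 * R / h)\<^sup>2"
    by (rule LIMSEQ_le_const) (use estimate in blast)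
  then show ?thesis
    unfolding X_def Y_def B_def by simp
qed

text \<open>The limit of the quotients bounds the high modes of \<open>w y\<close> and of the
  derivative of \<open>y\<close>; the modes below \<Omega> cost at most
  \<open>\<Omega>\<^sup>2\<close> times the squared norm. Since \<open>x\<close> already contains
  one factor \<open>w\<close>, the weight \<open>w\<^sup>2\<close> measures \<open>u\<close> in
  \<open>H\<^sup>4\<close> and \<open>\<partial>\<^sub>t u\<close> in
  \<open>H\<^sup>2\<close>.\<close>

lemma complete_solution_regularity:
  "\<exists>R'. \<forall>z. (\<forall>a. solution a z) \<longrightarrow> (\<forall>t. norm (z t) \<le> R) \<longrightarrow>
    (\<forall>t n. (\<Sum>j<n. (w j)\<^sup>2 * ((coord (fst (z t)) j)\<^sup>2 + (coord (snd (z t)) j)\<^sup>2)) \<le> R')"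
proof (intro exI allI impI)
  fix z t and n :: nat
  assume z: "\<forall>a. solution a z" "\<forall>t. norm (z t) \<le> R"
  define B where "B = 64 * (2 * R\<^sup>2 * R + k\<^sup>2 * R)\<^sup>2"
  define \<Omega> where "\<Omega> = 16 * (1 + coefficient_bound R)"
  let ?x = "coord (fst (z t))" and ?y = "coord (snd (z t))" and ?g = "coord (G (z t))"
  define F where "F = {j \<in> {..<n}. \<Omega> \<le> w j}"
  have "(\<Sum>j\<in>F. (w j * ?y j)\<^sup>2 + (- w j * ?x j - ?y j + ?g j)\<^sup>2) \<le> B"
  proof (rule LIMSEQ_le_const2)
    let ?h = "\<lambda>m. inverse (real (Suc m))"
    have dx: "((\<lambda>t. coord (fst (z t)) j) has_real_derivative w j * ?y j) (at t)"
      and dy: "((\<lambda>t. coord (snd (z t)) j) has_real_derivative - w j * ?x j - ?y j + ?g j) (at t)" for j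
      using z(1) unfolding solution_def linear_solution_def
      by (auto intro!: has_real_derivative_at_gt[of _ _ t "t - 1"])
    show "(\<lambda>m. \<Sum>j\<in>F. ((coord (fst (z (t + ?h m))) j - ?x j) / ?h m)\<^sup>2 + ((coord (snd (z (t + ?h m))) j - ?y j) / ?h m)\<^sup>2)
      \<longlonglongrightarrow> (\<Sum>j\<in>F. (w j * ?y j)\<^sup>2 + (- w j * ?x j - ?y j + ?g j)\<^sup>2)"
      by (intro tendsto_sum tendsto_add tendsto_power DERIV_difference_quotient_sequence[OF dx]
          DERIV_difference_quotient_sequence[OF dy])
    have "(\<Sum>j\<in>F. ((coord (fst (z (t + ?h m))) j - ?x j) / ?h m)\<^sup>2 + ((coord (snd (z (t + ?h m))) j - ?y j) / ?h m)\<^sup>2) \<le> B" for m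
      unfolding B_def
      by (rule difference_quotient_high_modes) (use z in \<open>auto simp: F_def \<Omega>_def\<close>)
    then show "\<exists>M. \<forall>m\<ge>M. (\<Sum>j\<in>F. ((coord (fst (z (t + ?h m))) j - ?x j) / ?h m)\<^sup>2
        + ((coord (snd (z (t + ?h m))) j - ?y j) / ?h m)\<^sup>2) \<le> B"
      by blast
  qed
  then have high: "(\<Sum>j<n. if \<Omega> \<le> w j then (w j * ?y j)\<^sup>2 + (- w j * ?x j - ?y j + ?g j)\<^sup>2 else 0) \<le> B"
    unfolding F_def sum.inter_filter[OF finite_lessThan] .
  \<comment> \<open>For a high mode the equation is solved for \<open>w j * ?x j\<close>, which is
    minus the derivative of \<open>y\<close> plus \<open>?g j - ?y j\<close>.\<close>
  have pointwise: "(w j)\<^sup>2 * ((?x j)\<^sup>2 + (?y j)\<^sup>2)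
      \<le> 2 * (if \<Omega> \<le> w j then (w j * ?y j)\<^sup>2 + (- w j * ?x j - ?y j + ?g j)\<^sup>2 else 0)
        + 2 * (?g j - ?y j)\<^sup>2 + \<Omega>\<^sup>2 * ((?x j)\<^sup>2 + (?y j)\<^sup>2)" for j
  proof (cases "\<Omega> \<le> w j")
    case True
    have "(w j * ?x j)\<^sup>2 \<le> 2 * (- w j * ?x j - ?y j + ?g j)\<^sup>2 + 2 * (?g j - ?y j)\<^sup>2"
      using zero_le_power2[of "(- w j * ?x j - ?y j + ?g j) + (?g j - ?y j)"]
      by (simp add: power2_eq_square algebra_simps)
    moreover have "0 \<le> (w j * ?y j)\<^sup>2" "0 \<le> \<Omega>\<^sup>2 * ((?x j)\<^sup>2 + (?y j)\<^sup>2)"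
      by simp_all
    moreover have "(w j)\<^sup>2 * ((?x j)\<^sup>2 + (?y j)\<^sup>2) = (w j * ?x j)\<^sup>2 + (w j * ?y j)\<^sup>2"
      by (simp add: power_mult_distrib algebra_simps)
    moreover have "a + d \<le> 2 * (d + b) + 2 * c + e" if "a \<le> 2 * b + 2 * c" "0 \<le> d" "0 \<le> e"
      for a b c d e :: real
      using that by simp
    ultimately show ?thesis
      by (simp only: True if_True)
  next
    case False
    then have "(w j)\<^sup>2 \<le> \<Omega>\<^sup>2"
      using w_nonneg[of j] by (intro power_mono) auto
    then have "(w j)\<^sup>2 * ((?x j)\<^sup>2 + (?y j)\<^sup>2) \<le> \<Omega>\<^sup>2 * ((?x j)\<^sup>2 + (?y j)\<^sup>2)"
      by (intro mult_right_mono) auto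
    then show ?thesis
      using False by (simp add: add_increasing)
  qed
  have "(\<Sum>j<n. (w j)\<^sup>2 * ((?x j)\<^sup>2 + (?y j)\<^sup>2))
      \<le> 2 * (\<Sum>j<n. if \<Omega> \<le> w j then (w j * ?y j)\<^sup>2 + (- w j * ?x j - ?y j + ?g j)\<^sup>2 else 0)
        + 2 * (\<Sum>j<n. (?g j - ?y j)\<^sup>2) + \<Omega>\<^sup>2 * (\<Sum>j<n. (?x j)\<^sup>2 + (?y j)\<^sup>2)"
    unfolding sum_distrib_left sum.distrib[symmetric] by (rule sum_mono, rule pointwise)
  moreover have "(\<Sum>j<n. (?g j - ?y j)\<^sup>2) \<le> (Gbound R + R)\<^sup>2"
  proof -
    have "(\<Sum>j<n. (?g j - ?y j)\<^sup>2) \<le> (norm (G (z t) - snd (z t)))\<^sup>2"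
      using sum_coord_le[of "{..<n}" "G (z t) - snd (z t)"] by simp
    also have "norm (G (z t) - snd (z t)) \<le> Gbound R + R"
      using norm_triangle_ineq4[of "G (z t)" "snd (z t)"] z(2) norm_G_le[of "z t" R] norm_fst_snd_le[of "z t" R]
      by fastforce
    then have "(norm (G (z t) - snd (z t)))\<^sup>2 \<le> (Gbound R + R)\<^sup>2"
      by (intro power_mono) auto
    finally show ?thesis .
  qed
  moreover have "\<Omega>\<^sup>2 * (\<Sum>j<n. (?x j)\<^sup>2 + (?y j)\<^sup>2) \<le> \<Omega>\<^sup>2 * R\<^sup>2"
  proof (rule mult_left_mono)
    show "(\<Sum>j<n. (?x j)\<^sup>2 + (?y j)\<^sup>2) \<le> R\<^sup>2"
      using sum_sq_phase_le[of "{..<n}" "z t"] power_mono[of "norm (z t)" R 2] z(2) by force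
  qed simp
  ultimately show "(\<Sum>j<n. (w j)\<^sup>2 * ((?x j)\<^sup>2 + (?y j)\<^sup>2))
      \<le> 2 * (64 * (2 * R\<^sup>2 * R + k\<^sup>2 * R)\<^sup>2) + 2 * (Gbound R + R)\<^sup>2 + (16 * (1 + coefficient_bound R))\<^sup>2 * R\<^sup>2"
    using high unfolding B_def \<Omega>_def by linarith
qed

end

section \<open>The flow\<close>

context bridge
begin

lemma solution_cong:
  assumes z: "solution a z" and eq: "\<And>t. a \<le> t \<Longrightarrow> z' t = z t"
  shows "solution a z'"
proof -
  have "continuous_on {a..} z"
    using z unfolding solution_def linear_solution_def by blast
  then have "continuous_on {a..} z'"
    using continuous_on_cong[of "{a..}" "{a..}" z' z] eq by simp
  moreover from this have "continuous_on {a..} (\<lambda>t. G (z' t))"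
    by (rule continuous_on_G)
  moreover have "((\<lambda>t. coord (fst (z' t)) j) has_real_derivative w j * coord (snd (z' t)) j) (at t within {a..})"
    "((\<lambda>t. coord (snd (z' t)) j) has_real_derivative
      - w j * coord (fst (z' t)) j - coord (snd (z' t)) j + coord (G (z' t)) j) (at t within {a..})"
    if t: "a \<le> t" for t j
  proof -
    have transform: "(g' has_real_derivative D) (at t within {a..})"
      if "(g has_real_derivative D) (at t within {a..})" "\<And>s. a \<le> s \<Longrightarrow> g' s = g s" for g g' :: "real \<Rightarrow> real" and D
      by (rule has_field_derivative_transform_within[OF that(1) zero_less_one]) (use that(2) t in auto)
    have d: "((\<lambda>t. coord (fst (z t)) j) has_real_derivative w j * coord (snd (z t)) j) (at t within {a..})"
      "((\<lambda>t. coord (snd (z t)) j) has_real_derivative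
        - w j * coord (fst (z t)) j - coord (snd (z t)) j + coord (G (z t)) j) (at t within {a..})"
      using z t unfolding solution_def linear_solution_def by blast+
    show "((\<lambda>t. coord (fst (z' t)) j) has_real_derivative w j * coord (snd (z' t)) j) (at t within {a..})"
      unfolding eq[OF t] by (rule transform[OF d(1)]) (simp add: eq)
    show "((\<lambda>t. coord (snd (z' t)) j) has_real_derivative
        - w j * coord (fst (z' t)) j - coord (snd (z' t)) j + coord (G (z' t)) j) (at t within {a..})"
      unfolding eq[OF t] by (rule transform[OF d(2)]) (simp add: eq)
  qed
  ultimately show ?thesis
    using z eq unfolding solution_def linear_solution_def by auto
qed

lemma solution_shift:
  assumes z: "solution (a + s) z"
  shows "solution a (\<lambda>t. z (t + s))"
proof -
  have img: "(\<lambda>t. t + s) ` {a..} = {a + s..}"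
    by (auto simp: image_iff intro!: bexI[of _ "_ - s"])
  have deriv: "((\<lambda>t. g (t + s)) has_real_derivative D) (at t within {a..})"
    if "(g has_real_derivative D) (at (t + s) within {a + s..})" for g D t
  proof -
    have "(g \<circ> (\<lambda>t. t + s) has_real_derivative D * 1) (at t within {a..})"
      by (rule DERIV_image_chain) (use that img in \<open>auto intro!: derivative_eq_intros\<close>)
    then show ?thesis
      by (simp add: o_def)
  qed
  have cont: "continuous_on {a..} (\<lambda>t. g (t + s))" if "continuous_on {a + s..} g"
    for g :: "real \<Rightarrow> 'b :: topological_space"
    by (rule continuous_on_compose2[OF that]) (auto intro!: continuous_intros)
  show ?thesis
    using z unfolding solution_def linear_solution_def
    by (auto intro!: cont deriv)
qed

lemma solution_restrict:
  assumes z: "solution a z" and "a \<le> b"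
  shows "solution b z"
proof -
  have "{b..} \<subseteq> {a..}"
    using assms(2) by auto
  then show ?thesis
    using z assms(2) continuous_on_subset[of "{a..}" _ "{b..}"] has_field_derivative_subset[of _ _ _ "{a..}" "{b..}"]
    unfolding solution_def linear_solution_def by (meson order_trans)
qed

lemma solution_unique:
  assumes "solution a z" "solution a z'" "z a = z' a" "a \<le> t"
  shows "z t = z' t"
proof -
  obtain R where R: "\<And>z t. solution a z \<Longrightarrow> norm (z a) \<le> norm (z' a) \<Longrightarrow> a \<le> t \<Longrightarrow> norm (z t) \<le> R"
    using solution_uniformly_bounded[of "norm (z' a)"] by blast
  have "(norm (z t - z' t))\<^sup>2 \<le> exp (2 * Glip R * (t - a)) * (norm (z a - z' a))\<^sup>2"
    by (rule continuous_dependence) (use assms R in auto)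
  then show ?thesis
    using assms(3) by simp
qed

text \<open>The second equation at rest: multiplying \<open>x\<close> by \<open>w\<close> gives
  \<open>A u\<close>.\<close>

definition equilibria :: "(l2 \<times> l2) set" where
  "equilibria = {z \<in> phase. snd z = 0 \<and> (\<forall>j. coord (G z) j = w j * coord (fst z) j)}"

end

text \<open>\<open>S\<close> is some choice of solutions through the points of \<open>phase\<close>;
  the semigroup law and the continuity of each \<open>S t\<close> follow from
  \<open>continuous_dependence\<close>.\<close>

locale bridge_flow = bridge +
  fixes S :: "real \<Rightarrow> l2 \<times> l2 \<Rightarrow> l2 \<times> l2"
  assumes S_solution: "\<And>z. z \<in> phase \<Longrightarrow> solution 0 (\<lambda>t. S t z)"
    and S_initial: "\<And>z. z \<in> phase \<Longrightarrow> S 0 z = z"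
begin

lemma S_phase: "0 \<le> t \<Longrightarrow> z \<in> phase \<Longrightarrow> S t z \<in> phase"
  using S_solution unfolding solution_def linear_solution_def by blast

lemma S_semigroup:
  assumes "0 \<le> s" "0 \<le> t" "z \<in> phase"
  shows "S (s + t) z = S s (S t z)"
proof -
  have "solution 0 (\<lambda>s. S (s + t) z)"
    by (rule solution_shift, rule solution_restrict[OF S_solution]) (use assms in auto)
  moreover have "solution 0 (\<lambda>s. S s (S t z))"
    by (rule S_solution, rule S_phase) (use assms in auto)
  ultimately show ?thesis
    using solution_unique[where a = 0 and t = s and z = "\<lambda>s. S (s + t) z" and z' = "\<lambda>s. S s (S t z)"]
      S_initial[OF S_phase] assms by simp
qed

lemma S_bounded: "\<exists>R'. \<forall>z\<in>phase. \<forall>t\<ge>0. norm z \<le> R \<longrightarrow> norm (S t z) \<le> R'"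
proof -
  obtain R' where R': "\<And>z a t. solution a z \<Longrightarrow> norm (z a) \<le> R \<Longrightarrow> a \<le> t \<Longrightarrow> norm (z t) \<le> R'"
    using solution_uniformly_bounded[of R] by blast
  have "norm (S t z) \<le> R'" if "z \<in> phase" "0 \<le> t" "norm z \<le> R" for z t
    using R'[OF S_solution[OF that(1)], of t] S_initial[OF that(1)] that(2,3) by simp
  then show ?thesis by blast
qed

lemma S_continuous_on:
  assumes t: "0 \<le> t"
  shows "continuous_on phase (S t)"
  unfolding continuous_on_iff
proof (intro ballI allI impI)
  fix z and \<epsilon> :: real assume z: "z \<in> phase" and \<epsilon>: "0 < \<epsilon>"
  obtain R where R: "\<And>z' t. z' \<in> phase \<Longrightarrow> 0 \<le> t \<Longrightarrow> norm z' \<le> norm z + 1 \<Longrightarrow> norm (S t z') \<le> R"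
    using S_bounded[of "norm z + 1"] by blast
  define \<delta> where "\<delta> = min 1 (\<epsilon> / exp (Glip R * t))"
  have \<delta>: "0 < \<delta>" "\<delta> \<le> 1" "exp (Glip R * t) * \<delta> \<le> \<epsilon>"
    using \<epsilon> unfolding \<delta>_def by (auto simp: min_def field_simps)
  have "dist (S t z') (S t z) < \<epsilon>" if z': "z' \<in> phase" "dist z' z < \<delta>" for z'
  proof -
    have nz': "norm z' \<le> norm z + 1"
      using z'(2) \<delta>(2) norm_triangle_ineq2[of z' z] by (simp add: dist_norm)
    have "(norm (S t z' - S t z))\<^sup>2 \<le> exp (2 * Glip R * (t - 0)) * (norm (S 0 z' - S 0 z))\<^sup>2"
      by (rule continuous_dependence[OF S_solution[OF z'(1)] _ S_solution[OF z] _ t])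
        (use R z z' nz' in auto)
    also have "\<dots> = (exp (Glip R * t) * norm (z' - z))\<^sup>2"
      by (simp add: S_initial z z' power_mult_distrib flip: exp_double mult.assoc)
    finally have "norm (S t z' - S t z) \<le> exp (Glip R * t) * norm (z' - z)"
      by (rule power2_le_imp_le) simp
    also have "\<dots> < exp (Glip R * t) * \<delta>"
      using z'(2) by (simp add: dist_norm)
    finally show ?thesis
      using \<delta>(3) by (simp add: dist_norm)
  qed
  then show "\<exists>\<delta>>0. \<forall>z'\<in>phase. dist z' z < \<delta> \<longrightarrow> dist (S t z') (S t z) < \<epsilon>"
    using \<delta>(1) by blast
qed

text \<open>\<open>solution_tails\<close> is uniform over the solutions in a ball, so one
  \<open>n\<close> and one \<open>T\<close> serve the whole sequence of orbits, from the index on at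
  which the times exceed \<open>T\<close>.\<close>

lemma S_asymptotically_compact:
  fixes t :: "nat \<Rightarrow> real"
  assumes t: "\<And>n. real n \<le> t n" and x: "\<And>n. x n \<in> phase" "\<And>n. norm (x n) \<le> R"
  shows "\<exists>r l. strict_mono (r :: nat \<Rightarrow> nat) \<and> (\<lambda>n. S (t (r n)) (x (r n))) \<longlonglongrightarrow> l"
proof -
  have t0: "0 \<le> t n" for n
    using t[of n] by linarith
  obtain R' where R': "\<And>z t. z \<in> phase \<Longrightarrow> 0 \<le> t \<Longrightarrow> norm z \<le> R \<Longrightarrow> norm (S t z) \<le> R'"
    using S_bounded[of R] by blast
  show ?thesis
  proof (rule convergent_subsequence_of_small_tails[where W = "\<lambda>n. S (t n) (x n)"])
    show "norm (S (t n) (x n)) \<le> R'" for n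
      by (rule R'[OF x(1) t0 x(2)])
    fix \<epsilon> :: real assume "0 < \<epsilon>"
    then obtain n T where nT: "\<And>z t. solution 0 z \<Longrightarrow> (\<forall>t\<ge>0. norm (z t) \<le> R') \<Longrightarrow> 0 \<le> t \<Longrightarrow> T \<le> t \<Longrightarrow>
        norm (fst (z t) - trunc n (fst (z t))) \<le> \<epsilon> \<and> norm (snd (z t) - trunc n (snd (z t))) \<le> \<epsilon>"
      using solution_tails[of \<epsilon> R'] by blast
    have "norm (fst (S (t m) (x m)) - trunc n (fst (S (t m) (x m)))) \<le> \<epsilon> \<and>
        norm (snd (S (t m) (x m)) - trunc n (snd (S (t m) (x m)))) \<le> \<epsilon>" if m: "nat \<lceil>T\<rceil> \<le> m" for m
    proof (rule nT[OF S_solution[OF x(1)] _ t0])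
      show "\<forall>s\<ge>0. norm (S s (x m)) \<le> R'"
        using R' x by blast
      show "T \<le> t m"
        using m t[of m] by linarith
    qed
    then show "\<exists>n m0. \<forall>m\<ge>m0. norm (fst (S (t m) (x m)) - trunc n (fst (S (t m) (x m)))) \<le> \<epsilon> \<and>
        norm (snd (S (t m) (x m)) - trunc n (snd (S (t m) (x m)))) \<le> \<epsilon>"
      by blast
  qed
qed

sublocale dissipative_semigroup phase S absorbing_radius
proof
  show "\<exists>T\<ge>0. \<forall>t\<ge>T. \<forall>x\<in>phase. norm x \<le> R \<longrightarrow> norm (S t x) \<le> absorbing_radius" for R
  proof -
    obtain T where T: "0 \<le> T" "\<And>z a t. solution a z \<Longrightarrow> norm (z a) \<le> R \<Longrightarrow> a + T \<le> t \<Longrightarrow> norm (z t) \<le> absorbing_radius"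
      using solution_absorbed[of R] by blast
    have "norm (S t x) \<le> absorbing_radius" if "T \<le> t" "x \<in> phase" "norm x \<le> R" for t x
      using T(2)[OF S_solution[OF that(2)], of t] S_initial[OF that(2)] that by simp
    then show ?thesis
      using T(1) by blast
  qed
qed (fact closed_phase convex_phase S_phase S_initial S_semigroup S_continuous_on S_asymptotically_compact)+

lemma complete_orbit_solution:
  assumes "complete_orbit z"
  shows "solution a z"
proof (rule solution_cong)
  have "z a \<in> phase"
    using assms unfolding complete_orbit_def by blast
  then have "solution (a + - a) (\<lambda>t. S t (z a))"
    using S_solution by simp
  then show "solution a (\<lambda>t. S (t + - a) (z a))"
    by (rule solution_shift)
  show "z t = S (t + - a) (z a)" if "a \<le> t" for t
    using assms that unfolding complete_orbit_def by (metis add.assoc add.left_inverse add.right_neutral diff_ge_0_iff_ge uminus_add_conv_diff add.commute)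
qed

lemma attractor_regularity:
  "\<exists>R. \<forall>z\<in>attractor. \<forall>n. (\<Sum>j<n. (w j)\<^sup>2 * ((coord (fst z) j)\<^sup>2 + (coord (snd z) j)\<^sup>2)) \<le> R"
proof -
  obtain B where B: "\<And>z. z \<in> attractor \<Longrightarrow> norm z \<le> B"
    using compact_imp_bounded[OF compact_attractor] unfolding bounded_iff by blast
  obtain R where R: "\<And>z t n. (\<forall>a. solution a z) \<Longrightarrow> (\<forall>t. norm (z t) \<le> B) \<Longrightarrow>
      (\<Sum>j<n. (w j)\<^sup>2 * ((coord (fst (z t)) j)\<^sup>2 + (coord (snd (z t)) j)\<^sup>2)) \<le> R"
    using complete_solution_regularity[of B] by blast
  have "(\<Sum>j<n. (w j)\<^sup>2 * ((coord (fst y) j)\<^sup>2 + (coord (snd y) j)\<^sup>2)) \<le> R" if y: "y \<in> attractor" for y n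
  proof -
    obtain z where z: "complete_orbit z" "z 0 = y" "\<And>\<tau>. z \<tau> \<in> attractor"
      by (rule complete_orbit_through[OF y]) blast
    have "(\<Sum>j<n. (w j)\<^sup>2 * ((coord (fst (z 0)) j)\<^sup>2 + (coord (snd (z 0)) j)\<^sup>2)) \<le> R"
      by (rule R) (use complete_orbit_solution[OF z(1)] B z(3) in auto)
    then show ?thesis
      using z(2) by simp
  qed
  then show ?thesis by blast
qed

text \<open>A constant Lyapunov function has derivative 0, which forces
  \<open>\<partial>\<^sub>t u = 0\<close> and hence no motion; the second equation with vanishing
  \<open>y\<close> is then the stationary one.\<close>

lemma lyapunov_strict:
  assumes x: "x \<in> phase" and const: "\<And>t. 0 \<le> t \<Longrightarrow> lyapunov (S t x) = lyapunov x"
  shows "x \<in> equilibria"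
proof -
  note sol = S_solution[OF x]
  have pos: "snd (S t x) = 0" if t: "0 < t" for t
  proof -
    have "((\<lambda>t. lyapunov (S t x)) has_real_derivative - (norm (snd (S t x)))\<^sup>2) (at t)"
      using lyapunov_derivative[OF sol, of t] t by (auto intro: has_real_derivative_at_gt)
    moreover have "((\<lambda>t. lyapunov (S t x)) has_real_derivative 0) (at t)"
      by (rule has_field_derivative_transform_within_open[where f = "\<lambda>_. lyapunov x" and S = "{0<..}"])
        (use t const in auto)
    ultimately have "- (norm (snd (S t x)))\<^sup>2 = 0"
      by (rule DERIV_unique)
    then show ?thesis by simp
  qed
  \<comment> \<open>\<open>pos\<close> compares two-sided derivatives and so covers interior times;
    time 0 is reached by continuity.\<close>
  have zero: "snd x = 0"
  proof -
    have "continuous_on {0..} (\<lambda>t. S t x)"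
      using sol unfolding solution_def linear_solution_def by blast
    then have "(\<lambda>n. S (inverse (real (Suc n))) x) \<longlonglongrightarrow> S 0 x"
      by (rule continuous_on_tendsto_compose[OF _ LIMSEQ_inverse_real_of_nat]) auto
    then have "(\<lambda>n. snd (S (inverse (real (Suc n))) x)) \<longlonglongrightarrow> snd (S 0 x)"
      by (rule tendsto_snd)
    then have "(\<lambda>n. 0) \<longlonglongrightarrow> snd x"
      using pos S_initial[OF x] by simp
    then show ?thesis
      by (simp add: LIMSEQ_const_iff)
  qed
  have nonneg: "snd (S t x) = 0" if "0 \<le> t" for t
    using pos[of t] zero S_initial[OF x] that by (cases "t = 0") auto
  have dx: "((\<lambda>t. coord (fst (S t x)) j) has_real_derivative w j * coord (snd (S t x)) j) (at t within {0..})"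
    and dy: "((\<lambda>t. coord (snd (S t x)) j) has_real_derivative
      - w j * coord (fst (S t x)) j - coord (snd (S t x)) j + coord (G (S t x)) j) (at t within {0..})"
    if "0 \<le> t" for t j
    using sol that unfolding solution_def linear_solution_def by auto
  \<comment> \<open>The stationary equation is read off at time 1, an interior time, and transported
    back to \<open>x\<close> because the orbit does not move. Any positive time would do.\<close>
  have "S 1 x = x"
  proof (rule prod_eqI)
    show "fst (S 1 x) = fst x"
    proof (rule l2_eqI)
      fix j
      have "((\<lambda>t. w j * coord (snd (S t x)) j) has_integral coord (fst (S 1 x)) j - coord (fst (S 0 x)) j) {0..1}"
        by (rule derivative_has_integral_Ici[OF dx]) auto
      moreover have "((\<lambda>t. w j * coord (snd (S t x)) j) has_integral 0) {0..1}"
        by (rule has_integral_is_0) (simp add: nonneg)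
      ultimately have "coord (fst (S 1 x)) j - coord (fst (S 0 x)) j = 0"
        by (rule has_integral_unique)
      then show "coord (fst (S 1 x)) j = coord (fst x) j"
        using S_initial[OF x] by simp
    qed
    show "snd (S 1 x) = snd x"
      using nonneg[of 1] zero by simp
  qed
  moreover have "coord (G (S 1 x)) j = w j * coord (fst (S 1 x)) j" for j
  proof -
    have "((\<lambda>t. coord (snd (S t x)) j) has_real_derivative
      - w j * coord (fst (S 1 x)) j - coord (snd (S 1 x)) j + coord (G (S 1 x)) j) (at 1)"
      by (rule has_real_derivative_at_gt[OF dy]) auto
    moreover have "((\<lambda>t. coord (snd (S t x)) j) has_real_derivative 0) (at 1)"
      by (rule has_field_derivative_transform_within_open[where f = "\<lambda>_. 0" and S = "{0<..}"])
        (use pos in auto)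
    ultimately have "- w j * coord (fst (S 1 x)) j - coord (snd (S 1 x)) j + coord (G (S 1 x)) j = 0"
      by (rule DERIV_unique)
    then show ?thesis
      using nonneg[of 1] by simp
  qed
  ultimately show ?thesis
    unfolding equilibria_def using x zero by simp
qed

lemma attractor_orbit_to_equilibria:
  assumes "complete_orbit z" "\<And>\<tau>. z \<tau> \<in> attractor" "0 < \<epsilon>"
  shows "\<exists>T. \<forall>t\<ge>T. \<exists>s\<in>equilibria. dist (z (- t)) s < \<epsilon>"
proof (rule backward_limit_equilibria[OF assms(1,2) _ _ _ assms(3)])
  show "continuous_on phase lyapunov"
    by (rule continuous_on_subset[OF lyapunov_continuous]) simp
  show "lyapunov (S t x) \<le> lyapunov x" if "0 \<le> t" "x \<in> phase" for t x
    using nonincreasing_Ici[OF lyapunov_derivative[OF S_solution[OF that(2)]] _ that(1)]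
      S_initial[OF that(2)] by simp
  show "x \<in> equilibria" if "x \<in> phase" "\<And>t. 0 \<le> t \<Longrightarrow> lyapunov (S t x) = lyapunov x" for x
    using that by (rule lyapunov_strict)
qed

end

section \<open>Square integrable functions\<close>

lemma L2_measurable: "u \<in> L2 M \<Longrightarrow> u \<in> borel_measurable M"
  by (simp add: L2_def)

lemma L2_square_integrable: "u \<in> L2 M \<Longrightarrow> integrable M (\<lambda>x. (u x)\<^sup>2)"
  by (simp add: L2_def)

lemma L2_dominated:
  assumes "u \<in> borel_measurable M" "integrable M g" "\<And>x. (u x)\<^sup>2 \<le> g x"
  shows "u \<in> L2 M"
proof -
  have "integrable M (\<lambda>x. (u x)\<^sup>2)"
    by (rule Bochner_Integration.integrable_bound[OF assms(2)])
      (use assms(1,3) in \<open>auto intro!: always_eventually intro: order_trans[OF _ abs_ge_self]\<close>)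
  then show ?thesis
    using assms(1) by (simp add: L2_def)
qed

lemma L2_add:
  assumes "u \<in> L2 M" "v \<in> L2 M"
  shows "(\<lambda>x. u x + v x) \<in> L2 M"
proof (rule L2_dominated[where g = "\<lambda>x. 2 * (u x)\<^sup>2 + 2 * (v x)\<^sup>2"])
  show "(\<lambda>x. u x + v x) \<in> borel_measurable M"
    using assms L2_measurable by (intro borel_measurable_add)
  show "integrable M (\<lambda>x. 2 * (u x)\<^sup>2 + 2 * (v x)\<^sup>2)"
    using assms L2_square_integrable
    by (intro Bochner_Integration.integrable_add integrable_mult_right) auto
  show "(u x + v x)\<^sup>2 \<le> 2 * (u x)\<^sup>2 + 2 * (v x)\<^sup>2" for x
    using zero_le_power2[of "u x - v x"] by (simp add: power2_sum power2_diff)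
qed

lemma L2_scale: "u \<in> L2 M \<Longrightarrow> (\<lambda>x. c * u x) \<in> L2 M"
  by (auto simp: L2_def power_mult_distrib intro: borel_measurable_times)

lemma L2_diff:
  assumes "u \<in> L2 M" "v \<in> L2 M"
  shows "(\<lambda>x. u x - v x) \<in> L2 M"
  using L2_add[OF assms(1) L2_scale[OF assms(2), of "-1"]] by simp

lemma L2_zero: "(\<lambda>x. 0) \<in> L2 M"
  by (simp add: L2_def)

lemma L2_sum: "(\<And>j. j \<in> F \<Longrightarrow> g j \<in> L2 M) \<Longrightarrow> (\<lambda>x. \<Sum>j\<in>F. g j x) \<in> L2 M"
  by (induction F rule: infinite_finite_induct) (simp_all add: L2_zero L2_add)

lemma L2_mult_integrable:
  assumes "u \<in> L2 M" "v \<in> L2 M"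
  shows "integrable M (\<lambda>x. u x * v x)"
proof (rule Bochner_Integration.integrable_bound[where f = "\<lambda>x. (u x)\<^sup>2 + (v x)\<^sup>2"])
  show "integrable M (\<lambda>x. (u x)\<^sup>2 + (v x)\<^sup>2)"
    using assms L2_square_integrable by (intro Bochner_Integration.integrable_add) auto
  show "(\<lambda>x. u x * v x) \<in> borel_measurable M"
    using assms L2_measurable by (intro borel_measurable_times)
  have "\<bar>u x * v x\<bar> \<le> (u x)\<^sup>2 + (v x)\<^sup>2" for x
  proof -
    have "2 * (\<bar>u x\<bar> * \<bar>v x\<bar>) \<le> (u x)\<^sup>2 + (v x)\<^sup>2"
      using sum_squares_bound[of "\<bar>u x\<bar>" "\<bar>v x\<bar>"] by (simp add: mult.assoc)
    moreover have "0 \<le> \<bar>u x\<bar> * \<bar>v x\<bar>" by simp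
    ultimately show ?thesis
      unfolding abs_mult by linarith
  qed
  then show "AE x in M. norm (u x * v x) \<le> norm ((u x)\<^sup>2 + (v x)\<^sup>2)"
    by (auto intro!: always_eventually)
qed

abbreviation (input) sqdist :: "'w measure \<Rightarrow> ('w \<Rightarrow> real) \<Rightarrow> ('w \<Rightarrow> real) \<Rightarrow> real" where
  "sqdist M u v \<equiv> ip M (\<lambda>x. u x - v x) (\<lambda>x. u x - v x)"

lemma ip_commute: "ip M u v = ip M v u"
  by (simp add: ip_def mult.commute)

lemma ip_add_left: "u \<in> L2 M \<Longrightarrow> v \<in> L2 M \<Longrightarrow> w \<in> L2 M \<Longrightarrow> ip M (\<lambda>x. u x + v x) w = ip M u w + ip M v w"
  by (simp add: ip_def distrib_right L2_mult_integrable)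

lemma ip_diff_left: "u \<in> L2 M \<Longrightarrow> v \<in> L2 M \<Longrightarrow> w \<in> L2 M \<Longrightarrow> ip M (\<lambda>x. u x - v x) w = ip M u w - ip M v w"
  by (simp add: ip_def left_diff_distrib L2_mult_integrable)

lemma ip_scale_left: "ip M (\<lambda>x. c * u x) w = c * ip M u w"
  by (simp add: ip_def mult.assoc)

lemma ip_zero_left: "ip M (\<lambda>x. 0) w = 0"
  by (simp add: ip_def)

lemma ip_sum_left:
  assumes "\<And>j. j \<in> F \<Longrightarrow> g j \<in> L2 M" "v \<in> L2 M"
  shows "ip M (\<lambda>x. \<Sum>j\<in>F. g j x) v = (\<Sum>j\<in>F. ip M (g j) v)"
  using assms by (induction F rule: infinite_finite_induct) (simp_all add: ip_zero_left ip_add_left L2_sum)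

lemma ip_self_nonneg: "0 \<le> ip M u u"
  by (simp add: ip_def)

lemma nrm_sq: "(nrm M u)\<^sup>2 = ip M u u"
  by (simp add: nrm_def ip_self_nonneg)

lemma nrm_nonneg: "0 \<le> nrm M u"
  by (simp add: nrm_def ip_self_nonneg)

lemma ip_mono:
  assumes "u \<in> L2 M" "v \<in> L2 M" "\<And>x. (u x)\<^sup>2 \<le> (v x)\<^sup>2"
  shows "ip M u u \<le> ip M v v"
  unfolding ip_def using assms(3)
  by (intro integral_mono L2_mult_integrable assms(1,2)) (simp add: power2_eq_square)

lemma nrm_mono:
  assumes "u \<in> L2 M" "v \<in> L2 M" "\<And>x. \<bar>u x\<bar> \<le> \<bar>v x\<bar>"
  shows "nrm M u \<le> nrm M v"
  unfolding nrm_def using assms by (intro real_sqrt_le_mono ip_mono) (auto simp: abs_le_square_iff)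

lemma ip_triangle:
  assumes "u \<in> L2 M" "v \<in> L2 M"
  shows "ip M (\<lambda>x. u x + v x) (\<lambda>x. u x + v x) \<le> 2 * ip M u u + 2 * ip M v v"
proof -
  have "ip M (\<lambda>x. u x + v x) (\<lambda>x. u x + v x) \<le> integral\<^sup>L M (\<lambda>x. 2 * (u x * u x) + 2 * (v x * v x))"
    unfolding ip_def
  proof (rule integral_mono)
    show "integrable M (\<lambda>x. (u x + v x) * (u x + v x))"
      by (intro L2_mult_integrable L2_add assms)
    show "integrable M (\<lambda>x. 2 * (u x * u x) + 2 * (v x * v x))"
      using L2_mult_integrable[OF assms(1,1)] L2_mult_integrable[OF assms(2,2)]
      by (intro Bochner_Integration.integrable_add integrable_mult_right)
    show "(u x + v x) * (u x + v x) \<le> 2 * (u x * u x) + 2 * (v x * v x)" for x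
      using zero_le_power2[of "u x - v x"] by (simp add: power2_eq_square algebra_simps)
  qed
  also have "\<dots> = 2 * ip M u u + 2 * ip M v v"
    unfolding ip_def by (simp add: L2_mult_integrable assms)
  finally show ?thesis .
qed

text \<open>The coefficients \<open>c\<close> are arbitrary: Fourier coefficients give Bessel's
  inequality, and \<open>u = 0\<close> gives the norm of a finite combination.\<close>

lemma ip_orthonormal_residual:
  assumes F: "finite F" and e: "\<And>j. j \<in> F \<Longrightarrow> e j \<in> L2 M"
      "\<And>i j. i \<in> F \<Longrightarrow> j \<in> F \<Longrightarrow> ip M (e i) (e j) = (if i = j then 1 else 0)"
    and u: "u \<in> L2 M"
  shows "ip M (\<lambda>x. u x - (\<Sum>j\<in>F. c j * e j x)) (\<lambda>x. u x - (\<Sum>j\<in>F. c j * e j x))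
    = ip M u u - 2 * (\<Sum>j\<in>F. c j * ip M u (e j)) + (\<Sum>j\<in>F. (c j)\<^sup>2)"
proof -
  let ?s = "\<lambda>x. \<Sum>j\<in>F. c j * e j x"
  have s: "?s \<in> L2 M"
    by (intro L2_sum L2_scale e)
  have s_ip: "ip M ?s v = (\<Sum>j\<in>F. c j * ip M (e j) v)" if "v \<in> L2 M" for v
    using that e by (subst ip_sum_left) (auto simp: ip_scale_left L2_scale)
  have "ip M ?s ?s = (\<Sum>j\<in>F. c j * (\<Sum>i\<in>F. c i * ip M (e i) (e j)))"
    unfolding s_ip[OF s] by (intro sum.cong refl arg_cong2[where f = "(*)"]) (simp add: ip_commute[of _ "e _" "?s"] s_ip e)
  also have "\<dots> = (\<Sum>j\<in>F. (c j)\<^sup>2)"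
    using F by (intro sum.cong refl) (simp add: e(2) power2_eq_square if_distrib[of "(*) _"] sum.delta cong: if_cong)
  finally have ss: "ip M ?s ?s = (\<Sum>j\<in>F. (c j)\<^sup>2)" .
  have su: "ip M ?s u = (\<Sum>j\<in>F. c j * ip M u (e j))"
    unfolding s_ip[OF u] by (simp add: ip_commute)
  have d: "(\<lambda>x. u x - ?s x) \<in> L2 M"
    by (rule L2_diff[OF u s])
  have "sqdist M u ?s = ip M u (\<lambda>x. u x - ?s x) - ip M ?s (\<lambda>x. u x - ?s x)"
    by (rule ip_diff_left[OF u s d])
  also have "\<dots> = ip M (\<lambda>x. u x - ?s x) u - ip M (\<lambda>x. u x - ?s x) ?s"
    by (simp only: ip_commute)
  also have "\<dots> = ip M u u - ip M ?s u - (ip M u ?s - ip M ?s ?s)"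
    by (simp only: ip_diff_left[OF u s u] ip_diff_left[OF u s s])
  finally show ?thesis
    unfolding ss su ip_commute[of M u ?s] by simp
qed

text \<open>A subsequence with \<open>\<parallel>d\<^sub>k\<parallel>\<^sup>2 \<le> 8\<^sup>-\<^sup>k\<close> for its increments converges almost
  everywhere because \<open>\<bar>d\<^sub>k\<bar> \<le> 2\<^sup>k d\<^sub>k\<^sup>2 + 2\<^sup>-\<^sup>k\<close>; Fatou's lemma identifies the limit.\<close>

lemma L2_complete:
  assumes s: "\<And>n. s n \<in> L2 M"
    and Cauchy: "\<And>\<epsilon>. 0 < \<epsilon> \<Longrightarrow>
      \<exists>n0. \<forall>m\<ge>n0. \<forall>n\<ge>n0. sqdist M (s m) (s n) \<le> \<epsilon>"
  shows "\<exists>u\<in>L2 M. (\<lambda>n. sqdist M u (s n)) \<longlonglongrightarrow> 0"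
proof -
  have "\<forall>k. \<exists>n0. \<forall>m\<ge>n0. \<forall>n\<ge>n0. sqdist M (s m) (s n) \<le> (1 / 8) ^ k"
    using Cauchy by simp
  then obtain N where N: "\<And>k m n. N k \<le> m \<Longrightarrow> N k \<le> n \<Longrightarrow>
      sqdist M (s m) (s n) \<le> (1 / 8) ^ k"
    by metis
  \<comment> \<open>Summing all earlier \<open>N i\<close> makes \<open>r k\<close> and
    \<open>r (Suc k)\<close> dominate \<open>N k\<close> even if \<open>N\<close> is not monotone;
    the summand \<open>k\<close> makes the indices tend to infinity.\<close>
  define r where "r k = k + (\<Sum>i\<le>k. N i)" for k
  have r: "k \<le> r k" "N k \<le> r k" "N k \<le> r (Suc k)" for k
  proof -
    have "N k \<le> (\<Sum>i\<le>k. N i)"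
      by (rule member_le_sum) auto
    then show "k \<le> r k" "N k \<le> r k" "N k \<le> r (Suc k)"
      unfolding r_def by auto
  qed
  define d where "d k x = s (r (Suc k)) x - s (r k) x" for k x
  have meas [measurable]: "s n \<in> borel_measurable M" for n
    using s by (rule L2_measurable)
  have d_int: "integrable M (\<lambda>x. (d k x)\<^sup>2)" for k
    unfolding d_def by (rule L2_square_integrable[OF L2_diff[OF s s]])
  have d_le: "integral\<^sup>L M (\<lambda>x. (d k x)\<^sup>2) \<le> (1 / 8) ^ k" for k
    using N[OF r(3) r(2), of k] unfolding d_def ip_def by (simp add: power2_eq_square)
  have "(\<integral>\<^sup>+x. (\<Sum>k. ennreal (2 ^ k * (d k x)\<^sup>2)) \<partial>M) = (\<Sum>k. \<integral>\<^sup>+x. ennreal (2 ^ k * (d k x)\<^sup>2) \<partial>M)"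
    unfolding d_def by (intro nn_integral_suminf) measurable
  also have "\<dots> \<le> (\<Sum>k. ennreal ((1 / 4) ^ k))"
  proof (rule suminf_le)
    fix k
    have "(\<integral>\<^sup>+x. ennreal (2 ^ k * (d k x)\<^sup>2) \<partial>M) = ennreal (integral\<^sup>L M (\<lambda>x. 2 ^ k * (d k x)\<^sup>2))"
      by (intro nn_integral_eq_integral integrable_mult_right d_int) auto
    also have "\<dots> \<le> ennreal ((1 / 4) ^ k)"
    proof (rule ennreal_leI)
      have "integral\<^sup>L M (\<lambda>x. 2 ^ k * (d k x)\<^sup>2) \<le> 2 ^ k * (1 / 8) ^ k"
        using d_le[of k] by simp
      also have "\<dots> = (1 / 4) ^ k"
        by (simp flip: power_mult_distrib)
      finally show "integral\<^sup>L M (\<lambda>x. 2 ^ k * (d k x)\<^sup>2) \<le> (1 / 4) ^ k" .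
    qed
    finally show "(\<integral>\<^sup>+x. ennreal (2 ^ k * (d k x)\<^sup>2) \<partial>M) \<le> ennreal ((1 / 4) ^ k)" .
  qed auto
  also have "\<dots> = ennreal (\<Sum>k. (1 / 4) ^ k)"
    by (rule suminf_ennreal2) (auto intro: summable_geometric)
  also have "\<dots> < \<infinity>"
    by simp
  finally have "(\<integral>\<^sup>+x. (\<Sum>k. ennreal (2 ^ k * (d k x)\<^sup>2)) \<partial>M) \<noteq> \<infinity>"
    by simp
  then have "AE x in M. (\<Sum>k. ennreal (2 ^ k * (d k x)\<^sup>2)) \<noteq> \<infinity>"
    unfolding d_def by (intro nn_integral_PInf_AE) measurable
  then have AE_conv: "AE x in M. convergent (\<lambda>k. s (r k) x)"
  proof eventually_elim
    case (elim x)
    then have "summable (\<lambda>k. 2 ^ k * (d k x)\<^sup>2)"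
      by (intro summable_suminf_not_top) auto
    then have "summable (\<lambda>k. 2 ^ k * (d k x)\<^sup>2 + (1 / 2) ^ k)"
      by (intro summable_add summable_geometric) auto
    then have "summable (\<lambda>k. d k x)"
    proof (rule summable_comparison_test'[where N = 0])
      fix k :: nat
      let ?t = "2 ^ k * \<bar>d k x\<bar>"
      have "?t \<le> ?t\<^sup>2 + 1"
        using zero_le_power2[of "?t - 1 / 2"] by (simp add: power2_diff power_divide)
      then have "(1 / 2) ^ k * ?t \<le> (1 / 2) ^ k * (?t\<^sup>2 + 1)"
        by (intro mult_left_mono) auto
      then show "norm (d k x) \<le> 2 ^ k * (d k x)\<^sup>2 + (1 / 2) ^ k"
        by (simp add: power_one_over power2_eq_square field_simps)
    qed
    then have "(\<lambda>k. s (r 0) x + (\<Sum>i<k. d i x)) \<longlonglongrightarrow> s (r 0) x + (\<Sum>i. d i x)"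
      by (intro tendsto_intros summable_LIMSEQ)
    moreover have "s (r 0) x + (\<Sum>i<k. d i x) = s (r k) x" for k
      unfolding d_def using sum_lessThan_telescope[of "\<lambda>i. s (r i) x" k] by simp
    ultimately show ?case
      by (auto simp: convergent_def)
  qed
  \<comment> \<open>\<open>lim\<close> is total, so \<open>u\<close> is defined and measurable
    everywhere; its values on the null set without convergence do not affect the integrals.\<close>
  define u where "u x = lim (\<lambda>k. s (r k) x)" for x
  have u_meas [measurable]: "u \<in> borel_measurable M"
    unfolding u_def by measurable
  have AE_lim: "AE x in M. (\<lambda>k. s (r k) x) \<longlonglongrightarrow> u x"
    using AE_conv unfolding u_def by (simp add: convergent_LIMSEQ_iff)
  have est: "(\<lambda>x. u x - s n x) \<in> L2 M \<and> sqdist M u (s n) \<le> \<epsilon>"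
    if \<epsilon>: "0 < \<epsilon>" and n0: "\<forall>m\<ge>n0. \<forall>n\<ge>n0. sqdist M (s m) (s n) \<le> \<epsilon>"
      and n: "n0 \<le> n" for \<epsilon> n0 n
  proof -
    have "(\<integral>\<^sup>+x. ennreal ((u x - s n x)\<^sup>2) \<partial>M) = (\<integral>\<^sup>+x. liminf (\<lambda>k. ennreal ((s (r k) x - s n x)\<^sup>2)) \<partial>M)"
    proof (rule nn_integral_cong_AE)
      show "AE x in M. ennreal ((u x - s n x)\<^sup>2) = liminf (\<lambda>k. ennreal ((s (r k) x - s n x)\<^sup>2))"
        using AE_lim
      proof eventually_elim
        case (elim x)
        then have "(\<lambda>k. ennreal ((s (r k) x - s n x)\<^sup>2)) \<longlonglongrightarrow> ennreal ((u x - s n x)\<^sup>2)"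
          by (intro tendsto_ennrealI tendsto_intros)
        then show ?case
          by (intro lim_imp_Liminf[symmetric]) auto
      qed
    qed
    also have "\<dots> \<le> liminf (\<lambda>k. \<integral>\<^sup>+x. ennreal ((s (r k) x - s n x)\<^sup>2) \<partial>M)"
      by (rule nn_integral_liminf) measurable
    also have "\<dots> \<le> limsup (\<lambda>k. \<integral>\<^sup>+x. ennreal ((s (r k) x - s n x)\<^sup>2) \<partial>M)"
      by (rule Liminf_le_Limsup) simp
    also have "\<dots> \<le> ennreal \<epsilon>"
    proof (rule Limsup_bounded)
      have "(\<integral>\<^sup>+x. ennreal ((s (r k) x - s n x)\<^sup>2) \<partial>M) \<le> ennreal \<epsilon>" if "n0 \<le> k" for k
      proof -
        have "(\<integral>\<^sup>+x. ennreal ((s (r k) x - s n x)\<^sup>2) \<partial>M) = ennreal (ip M (\<lambda>x. s (r k) x - s n x) (\<lambda>x. s (r k) x - s n x))"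
          unfolding ip_def power2_eq_square
          by (intro nn_integral_eq_integral L2_mult_integrable L2_diff s) auto
        also have "\<dots> \<le> ennreal \<epsilon>"
          using n0 n that r(1)[of k] by (intro ennreal_leI) auto
        finally show ?thesis .
      qed
      then show "\<forall>\<^sub>F k in sequentially. (\<integral>\<^sup>+x. ennreal ((s (r k) x - s n x)\<^sup>2) \<partial>M) \<le> ennreal \<epsilon>"
        unfolding eventually_sequentially by blast
    qed
    finally have le: "(\<integral>\<^sup>+x. ennreal ((u x - s n x)\<^sup>2) \<partial>M) \<le> ennreal \<epsilon>" .
    have int: "integrable M (\<lambda>x. (u x - s n x)\<^sup>2)"
      by (rule integrableI_nonneg) (use le in \<open>auto intro: le_less_trans\<close>)
    then have "ennreal (integral\<^sup>L M (\<lambda>x. (u x - s n x)\<^sup>2)) \<le> ennreal \<epsilon>"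
      using le by (subst (asm) nn_integral_eq_integral) auto
    then have "sqdist M u (s n) \<le> \<epsilon>"
      using \<epsilon> by (simp add: ip_def power2_eq_square)
    with int show ?thesis
      by (simp add: L2_def)
  qed
  obtain n1 where n1: "\<forall>m\<ge>n1. \<forall>n\<ge>n1. sqdist M (s m) (s n) \<le> 1"
    using Cauchy[of 1] by auto
  \<comment> \<open>Fatou's lemma controls differences only, so the square integrability of
    \<open>u\<close> is recovered from that of one difference.\<close>
  have "(\<lambda>x. (u x - s n1 x) + s n1 x) \<in> L2 M"
    using est[OF zero_less_one n1 order_refl] s by (intro L2_add) auto
  then have "u \<in> L2 M"
    by simp
  moreover have "(\<lambda>n. sqdist M u (s n)) \<longlonglongrightarrow> 0"
  proof (rule LIMSEQ_I)
    fix \<epsilon> :: real assume \<epsilon>: "0 < \<epsilon>"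
    then obtain n0 where n0: "\<forall>m\<ge>n0. \<forall>n\<ge>n0. sqdist M (s m) (s n) \<le> \<epsilon> / 2"
      using Cauchy[of "\<epsilon> / 2"] by auto
    have "norm (sqdist M u (s n) - 0) < \<epsilon>" if "n0 \<le> n" for n
      using est[OF _ n0 that] \<epsilon> ip_self_nonneg[of M "\<lambda>x. u x - s n x"] by auto
    then show "\<exists>n0. \<forall>n\<ge>n0. norm (sqdist M u (s n) - 0) < \<epsilon>"
      by blast
  qed
  ultimately show ?thesis by blast
qed

section \<open>Eigenfunction expansions\<close>

locale spectral =
  fixes M :: "'w measure" and J :: "nat set" and e :: "nat \<Rightarrow> 'w \<Rightarrow> real" and lam :: "nat \<Rightarrow> real"
  assumes spectral: "spectral_data M J e lam"
begin

lemma e_L2: "j \<in> J \<Longrightarrow> e j \<in> L2 M"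
  and e_orthonormal: "i \<in> J \<Longrightarrow> j \<in> J \<Longrightarrow> ip M (e i) (e j) = (if i = j then 1 else 0)"
  and e_complete: "u \<in> L2 M \<Longrightarrow> (\<And>j. j \<in> J \<Longrightarrow> coef M e j u = 0) \<Longrightarrow> nrm M u = 0"
  and lam_pos: "j \<in> J \<Longrightarrow> 0 < lam j"
  and lam_finite: "finite {j \<in> J. lam j \<le> c}"
  using spectral unfolding spectral_data_def by blast+

definition expansion :: "('w \<Rightarrow> real) \<Rightarrow> l2" where
  "expansion u = Abs_l2 (\<lambda>j. if j \<in> J then coef M e j u else 0)"

definition supported :: "l2 \<Rightarrow> bool" where
  "supported a \<longleftrightarrow> (\<forall>j. j \<notin> J \<longrightarrow> coord a j = 0)"

definition partial_sum :: "l2 \<Rightarrow> nat \<Rightarrow> 'w \<Rightarrow> real" where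
  "partial_sum a n x = (\<Sum>j\<in>{..<n} \<inter> J. coord a j * e j x)"

lemma residual:
  assumes "finite F" "F \<subseteq> J" "u \<in> L2 M"
  shows "ip M (\<lambda>x. u x - (\<Sum>j\<in>F. c j * e j x)) (\<lambda>x. u x - (\<Sum>j\<in>F. c j * e j x))
    = ip M u u - 2 * (\<Sum>j\<in>F. c j * coef M e j u) + (\<Sum>j\<in>F. (c j)\<^sup>2)"
  unfolding coef_def
  by (rule ip_orthonormal_residual) (use assms e_L2 e_orthonormal in \<open>auto simp: subset_eq\<close>)

lemma bessel:
  assumes "finite F" "F \<subseteq> J" "u \<in> L2 M"
  shows "(\<Sum>j\<in>F. (coef M e j u)\<^sup>2) \<le> ip M u u"
  using residual[OF assms, of "\<lambda>j. coef M e j u"]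
    ip_self_nonneg[of M "\<lambda>x. u x - (\<Sum>j\<in>F. coef M e j u * e j x)"]
  by (simp add: power2_eq_square)

lemma coord_expansion:
  assumes "u \<in> L2 M"
  shows "coord (expansion u) j = (if j \<in> J then coef M e j u else 0)"
proof -
  have "(\<Sum>j<n. (if j \<in> J then coef M e j u else 0)\<^sup>2) \<le> ip M u u" for n
  proof -
    have "(\<Sum>j<n. (if j \<in> J then coef M e j u else 0)\<^sup>2) = (\<Sum>j\<in>{..<n} \<inter> J. (coef M e j u)\<^sup>2)"
      by (rule sum.mono_neutral_cong_right) auto
    then show ?thesis
      using bessel[of "{..<n} \<inter> J" u] assms by simp
  qed
  then have "summable (\<lambda>j. (if j \<in> J then coef M e j u else 0)\<^sup>2)"
    by (intro summable_of_bounded_partial_sums) auto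
  then show ?thesis
    by (simp add: expansion_def coord_Abs_l2)
qed

lemma supported_expansion: "u \<in> L2 M \<Longrightarrow> supported (expansion u)"
  by (simp add: supported_def coord_expansion)

lemma coef_diff: "u \<in> L2 M \<Longrightarrow> v \<in> L2 M \<Longrightarrow> j \<in> J \<Longrightarrow>
    coef M e j (\<lambda>x. u x - v x) = coef M e j u - coef M e j v"
  by (simp add: coef_def ip_diff_left e_L2)

lemma expansion_diff:
  assumes "u \<in> L2 M" "v \<in> L2 M"
  shows "expansion (\<lambda>x. u x - v x) = expansion u - expansion v"
  by (rule l2_eqI) (simp add: coord_expansion assms L2_diff coef_diff)

lemma partial_sum_L2: "partial_sum a n \<in> L2 M"
  unfolding partial_sum_def by (intro L2_sum L2_scale e_L2) simp

lemma sum_Int_J: "supported a \<Longrightarrow> (\<Sum>j\<in>{..<n} \<inter> J. (coord a j)\<^sup>2) = (\<Sum>j<n. (coord a j)\<^sup>2)"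
  by (rule sum.mono_neutral_left) (auto simp: supported_def)

lemma coef_partial_sum:
  assumes "j \<in> J"
  shows "coef M e j (partial_sum a n) = (if j < n then coord a j else 0)"
proof -
  have "coef M e j (partial_sum a n) = (\<Sum>i\<in>{..<n} \<inter> J. coord a i * ip M (e i) (e j))"
    unfolding coef_def partial_sum_def
    using assms by (subst ip_sum_left) (auto simp: ip_scale_left L2_scale e_L2)
  also have "\<dots> = (\<Sum>i\<in>{..<n} \<inter> J. if i = j then coord a i else 0)"
    using assms by (intro sum.cong refl) (auto simp: e_orthonormal)
  also have "\<dots> = (if j < n then coord a j else 0)"
    using assms by (simp add: sum.delta)
  finally show ?thesis .
qed

text \<open>The residual formula for the zero function.\<close>

lemma ip_partial_sum:
  assumes "supported a"
  shows "ip M (partial_sum a n) (partial_sum a n) = (\<Sum>j<n. (coord a j)\<^sup>2)"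
proof -
  have "ip M (\<lambda>x. 0 - (\<Sum>j\<in>{..<n} \<inter> J. coord a j * e j x)) (\<lambda>x. 0 - (\<Sum>j\<in>{..<n} \<inter> J. coord a j * e j x))
    = (\<Sum>j\<in>{..<n} \<inter> J. (coord a j)\<^sup>2)"
    by (subst residual) (auto simp: L2_zero ip_zero_left coef_def)
  then show ?thesis
    by (simp add: ip_def partial_sum_def[abs_def] sum_Int_J[OF assms])
qed

lemma ip_diff_partial_sum:
  assumes u: "u \<in> L2 M"
  shows "ip M (\<lambda>x. u x - partial_sum (expansion u) n x) (\<lambda>x. u x - partial_sum (expansion u) n x)
    = ip M u u - (\<Sum>j<n. (coord (expansion u) j)\<^sup>2)"
proof -
  let ?a = "expansion u" and ?F = "{..<n} \<inter> J"
  have "(\<Sum>j\<in>?F. coord ?a j * coef M e j u) = (\<Sum>j\<in>?F. (coord ?a j)\<^sup>2)"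
    by (intro sum.cong refl) (simp add: coord_expansion u power2_eq_square)
  then show ?thesis
    unfolding partial_sum_def using residual[of ?F u "coord ?a"] u
    by (simp add: sum_Int_J[OF supported_expansion[OF u]])
qed

lemma expansion_partial_sum: "supported a \<Longrightarrow> expansion (partial_sum a n) = trunc n a"
  by (rule l2_eqI) (auto simp: coord_expansion partial_sum_L2 coef_partial_sum supported_def)

text \<open>The longer partial sum is itself a function whose expansion is known, and the shorter
  one is its truncated expansion, so Pythagoras applies.\<close>

lemma ip_partial_sums_le:
  assumes a: "supported a" and "n \<le> m"
  shows "sqdist M (partial_sum a m) (partial_sum a n)
    = (\<Sum>j<m. (coord a j)\<^sup>2) - (\<Sum>j<n. (coord a j)\<^sup>2)"
proof -
  have "partial_sum (expansion (partial_sum a m)) n = partial_sum a n"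
    unfolding expansion_partial_sum[OF a] partial_sum_def
    by (intro ext sum.cong) (use assms(2) in auto)
  moreover have "(\<Sum>j<n. (coord (expansion (partial_sum a m)) j)\<^sup>2) = (\<Sum>j<n. (coord a j)\<^sup>2)"
    unfolding expansion_partial_sum[OF a] by (intro sum.cong) (use assms(2) in auto)
  ultimately show ?thesis
    using ip_diff_partial_sum[OF partial_sum_L2, of a m n] by (simp add: ip_partial_sum[OF a])
qed

text \<open>The partial sums are Cauchy by \<open>ip_partial_sums_le\<close>. The coefficients of
  the limit come from Bessel's inequality for the single index \<open>j\<close>, because the partial
  sums have the right coefficient as soon as \<open>j < n\<close>.\<close>

lemma riesz_fischer:
  assumes a: "supported a"
  shows "\<exists>u\<in>L2 M. expansion u = a \<and>
    (\<lambda>n. sqdist M u (partial_sum a n)) \<longlonglongrightarrow> 0"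
proof -
  let ?S = "\<lambda>n. \<Sum>j<n. (coord a j)\<^sup>2"
  have "\<exists>u\<in>L2 M. (\<lambda>n. sqdist M u (partial_sum a n)) \<longlonglongrightarrow> 0"
  proof (rule L2_complete[OF partial_sum_L2])
    fix \<epsilon> :: real assume \<epsilon>: "0 < \<epsilon>"
    have "Cauchy ?S"
      using norm_l2_sums[of a] unfolding sums_def by (rule LIMSEQ_imp_Cauchy)
    then obtain n0 where n0: "\<And>m n. n0 \<le> m \<Longrightarrow> n0 \<le> n \<Longrightarrow> dist (?S m) (?S n) < \<epsilon>"
      using \<epsilon> unfolding Cauchy_def by blast
    have le: "sqdist M (partial_sum a m) (partial_sum a n) \<le> \<epsilon>"
      if "n0 \<le> n" "n \<le> m" for m n
      using n0[of m n] that by (simp add: ip_partial_sums_le[OF a that(2)] dist_real_def)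
    have "sqdist M (partial_sum a m) (partial_sum a n) \<le> \<epsilon>"
      if "n0 \<le> m" "n0 \<le> n" for m n
    proof (cases "n \<le> m")
      case False
      have "sqdist M (partial_sum a m) (partial_sum a n)
          = sqdist M (partial_sum a n) (partial_sum a m)"
        unfolding ip_def by (intro Bochner_Integration.integral_cong refl) (simp add: algebra_simps)
      then show ?thesis
        using le[of m n] that False by simp
    qed (use le that in simp)
    then show "\<exists>n0. \<forall>m\<ge>n0. \<forall>n\<ge>n0.
        sqdist M (partial_sum a m) (partial_sum a n) \<le> \<epsilon>"
      by blast
  qed
  then obtain u where u: "u \<in> L2 M"
    "(\<lambda>n. sqdist M u (partial_sum a n)) \<longlonglongrightarrow> 0"
    by blast
  have "coef M e j u = coord a j" if j: "j \<in> J" for j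
  proof -
    have "(coef M e j u - coord a j)\<^sup>2 \<le> 0"
    proof (rule LIMSEQ_le_const[OF u(2)])
      have "(coef M e j u - coord a j)\<^sup>2
          \<le> sqdist M u (partial_sum a n)" if "Suc j \<le> n" for n
        using bessel[of "{j}" "\<lambda>x. u x - partial_sum a n x"] j that
        by (simp add: L2_diff u(1) partial_sum_L2 coef_diff coef_partial_sum)
      then show "\<exists>N. \<forall>n\<ge>N. (coef M e j u - coord a j)\<^sup>2
          \<le> sqdist M u (partial_sum a n)"
        by blast
    qed
    then show ?thesis by simp
  qed
  then have "expansion u = a"
    using a by (intro l2_eqI) (simp add: coord_expansion u(1) supported_def)
  with u show ?thesis by blast
qed

text \<open>Completeness is given in the form that a function with zero coefficients has norm 0.
  Hence \<open>riesz_fischer\<close> is used to build some \<open>v\<close> with the coefficients of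
  \<open>u\<close>; the difference has norm 0, and the partial sums converge to \<open>u\<close> as
  well.\<close>

lemma norm_expansion:
  assumes u: "u \<in> L2 M"
  shows "norm (expansion u) = nrm M u"
proof -
  let ?a = "expansion u"
  let ?s = "partial_sum ?a"
  obtain v where v: "v \<in> L2 M" "expansion v = ?a"
    "(\<lambda>n. sqdist M v (?s n)) \<longlonglongrightarrow> 0"
    using riesz_fischer[OF supported_expansion[OF u]] by blast
  have "coef M e j (\<lambda>x. u x - v x) = 0" if "j \<in> J" for j
  proof -
    have "coord (expansion u) j = coord (expansion v) j"
      using v(2) by simp
    then show ?thesis
      using that by (simp add: coef_diff u v(1) coord_expansion)
  qed
  then have "nrm M (\<lambda>x. u x - v x) = 0"
    by (rule e_complete[OF L2_diff[OF u v(1)]])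
  then have d: "sqdist M u v = 0"
    by (metis nrm_sq power_zero_numeral)
  have "(\<lambda>n. sqdist M u (?s n)) \<longlonglongrightarrow> 0"
  proof (rule tendsto_sandwich[OF _ _ tendsto_const])
    show "\<forall>\<^sub>F n in sequentially. 0 \<le> sqdist M u (?s n)"
      by (simp add: ip_self_nonneg)
    show "\<forall>\<^sub>F n in sequentially. sqdist M u (?s n)
        \<le> 2 * sqdist M v (?s n)"
    proof (intro always_eventually allI)
      fix n
      show "sqdist M u (?s n) \<le> 2 * sqdist M v (?s n)"
        using ip_triangle[OF L2_diff[OF u v(1)] L2_diff[OF v(1) partial_sum_L2[of ?a n]]] d by simp
    qed
    show "(\<lambda>n. 2 * sqdist M v (?s n)) \<longlonglongrightarrow> 0"
      using tendsto_mult_right_zero[OF v(3)] .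
  qed
  then have "(\<lambda>n. ip M u u - (\<Sum>j<n. (coord ?a j)\<^sup>2)) \<longlonglongrightarrow> 0"
    by (simp add: ip_diff_partial_sum[OF u])
  moreover have "(\<lambda>n. ip M u u - (\<Sum>j<n. (coord ?a j)\<^sup>2)) \<longlonglongrightarrow> ip M u u - (norm ?a)\<^sup>2"
    using norm_l2_sums[of ?a] unfolding sums_def by (intro tendsto_intros)
  ultimately have "ip M u u - (norm ?a)\<^sup>2 = 0"
    using LIMSEQ_unique by blast
  then have "(norm ?a)\<^sup>2 = (nrm M u)\<^sup>2"
    by (simp add: nrm_sq)
  then show ?thesis
    by (simp add: power2_eq_iff_nonneg nrm_nonneg)
qed

text \<open>Polarisation of \<open>norm_expansion\<close>.\<close>

lemma inner_expansion:
  assumes u: "u \<in> L2 M" and v: "v \<in> L2 M"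
  shows "inner (expansion u) (expansion v) = ip M u v"
proof -
  have d: "(\<lambda>x. u x - v x) \<in> L2 M"
    by (rule L2_diff[OF u v])
  have "(norm (expansion u - expansion v))\<^sup>2 = sqdist M u v"
    using norm_expansion[OF d] by (simp add: expansion_diff u v nrm_sq)
  also have "\<dots> = ip M (\<lambda>x. u x - v x) u - ip M (\<lambda>x. u x - v x) v"
    unfolding ip_diff_left[OF u v d] by (simp only: ip_commute)
  also have "\<dots> = ip M u u - ip M v u - (ip M u v - ip M v v)"
    by (simp only: ip_diff_left[OF u v u] ip_diff_left[OF u v v])
  also have "\<dots> = (norm (expansion u))\<^sup>2 + (norm (expansion v))\<^sup>2 - 2 * ip M u v"
    by (simp add: norm_expansion u v nrm_sq ip_commute[of M v u])
  finally show ?thesis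
    by (simp add: power2_norm_eq_inner inner_simps inner_commute[of "expansion v" "expansion u"])
qed

section \<open>Synthesis and the positive part on coefficients\<close>

definition synthesis :: "l2 \<Rightarrow> 'w \<Rightarrow> real" where
  "synthesis a = (SOME u. u \<in> L2 M \<and> expansion u = a)"

lemma synthesis:
  assumes "supported a"
  shows "synthesis a \<in> L2 M" "expansion (synthesis a) = a"
proof -
  have "\<exists>u. u \<in> L2 M \<and> expansion u = a"
    using riesz_fischer[OF assms] by blast
  then have "synthesis a \<in> L2 M \<and> expansion (synthesis a) = a"
    unfolding synthesis_def by (rule someI_ex)
  then show "synthesis a \<in> L2 M" "expansion (synthesis a) = a"
    by auto
qed

definition restrict_J :: "l2 \<Rightarrow> l2" where
  "restrict_J = diag (\<lambda>j. if j \<in> J then 1 else 0)"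

lemma coord_restrict_J: "coord (restrict_J a) j = (if j \<in> J then coord a j else 0)"
  unfolding restrict_J_def by (subst coord_diag[where B = 1]) auto

lemma supported_restrict_J: "supported (restrict_J a)"
  by (simp add: supported_def coord_restrict_J)

lemma restrict_J_id: "supported a \<Longrightarrow> restrict_J a = a"
  by (rule l2_eqI) (simp add: coord_restrict_J supported_def)

lemma restrict_J_diff: "restrict_J a - restrict_J b = restrict_J (a - b)"
  by (rule l2_eqI) (simp add: coord_restrict_J)

lemma norm_restrict_J_le: "norm (restrict_J a) \<le> norm a"
  using norm_diag_le[of "\<lambda>j. if j \<in> J then 1 else 0" 1 a] by (simp add: restrict_J_def)

lemma pos_L2:
  assumes "u \<in> L2 M"
  shows "pos u \<in> L2 M"
proof (rule L2_dominated[OF _ L2_square_integrable[OF assms]])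
  show "pos u \<in> borel_measurable M"
    unfolding pos_def using L2_measurable[OF assms] by (intro borel_measurable_max) auto
  show "(pos u x)\<^sup>2 \<le> (u x)\<^sup>2" for x
    by (auto simp: pos_def max_def)
qed

text \<open>\<open>bridge\<close> expects a map on all coefficient sequences, so coordinates outside
  \<open>J\<close> are projected away before the synthesis.\<close>

definition pos_map :: "l2 \<Rightarrow> l2" where
  "pos_map a = expansion (pos (synthesis (restrict_J a)))"

abbreviation (input) syn :: "l2 \<Rightarrow> 'w \<Rightarrow> real" where
  "syn a \<equiv> synthesis (restrict_J a)"

lemma syn: "syn a \<in> L2 M" "expansion (syn a) = restrict_J a"
  by (rule synthesis[OF supported_restrict_J])+

lemma norm_expansion_pos_diff_le:
  assumes u: "u \<in> L2 M" and v: "v \<in> L2 M"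
  shows "norm (expansion (pos u) - expansion (pos v)) \<le> norm (expansion u - expansion v)"
proof -
  have "nrm M (\<lambda>x. pos u x - pos v x) \<le> nrm M (\<lambda>x. u x - v x)"
    by (intro nrm_mono L2_diff pos_L2 u v) (simp add: pos_def max_def)
  then show ?thesis
    using norm_expansion[OF L2_diff[OF u v]] norm_expansion[OF L2_diff[OF pos_L2[OF u] pos_L2[OF v]]]
    by (simp add: expansion_diff u v pos_L2)
qed

text \<open>By the contraction property, functions with equal expansions have positive parts with
  equal expansions, so the arbitrary choice made in \<open>synthesis\<close> is harmless.\<close>

lemma pos_map_expansion:
  assumes u: "u \<in> L2 M"
  shows "pos_map (expansion u) = expansion (pos u)"
proof -
  have "expansion (syn (expansion u)) = expansion u"
    using syn(2)[of "expansion u"] unfolding restrict_J_id[OF supported_expansion[OF u]] .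
  then have "norm (pos_map (expansion u) - expansion (pos u)) \<le> 0"
    unfolding pos_map_def using norm_expansion_pos_diff_le[OF syn(1) u, of "expansion u"] by simp
  then show ?thesis by simp
qed

lemma pos_map_lipschitz: "norm (pos_map a - pos_map b) \<le> norm (a - b)"
proof -
  have "norm (pos_map a - pos_map b) \<le> norm (expansion (syn a) - expansion (syn b))"
    unfolding pos_map_def by (rule norm_expansion_pos_diff_le[OF syn(1) syn(1)])
  also have "\<dots> \<le> norm (a - b)"
    unfolding syn(2) restrict_J_diff by (rule norm_restrict_J_le)
  finally show ?thesis .
qed

lemma supported_pos_map: "supported (pos_map a)"
  unfolding pos_map_def by (rule supported_expansion[OF pos_L2[OF syn(1)]])

lemma inner_pos_map: "inner (pos_map a) b = ip M (pos (syn a)) (syn b)"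
proof -
  have "inner (pos_map a) b = inner (pos_map a) (restrict_J b)"
  proof -
    have "(\<lambda>j. coord (pos_map a) j * coord b j) = (\<lambda>j. coord (pos_map a) j * coord (restrict_J b) j)"
      using supported_pos_map[of a] by (auto simp: supported_def coord_restrict_J)
    then show ?thesis
      by (simp only: inner_l2_def)
  qed
  also have "\<dots> = ip M (pos (syn a)) (syn b)"
    unfolding pos_map_def using inner_expansion[OF pos_L2[OF syn(1)] syn(1), of a b] by (simp only: syn(2))
  finally show ?thesis .
qed

lemma pos_map_nonneg: "0 \<le> inner (pos_map a) a"
  unfolding inner_pos_map ip_def
  by (rule Bochner_Integration.integral_nonneg) (simp add: pos_def max_def)

text \<open>Pointwise, \<open>max s 0 * s / 2\<close> is a convex primitive of
  \<open>max s 0\<close>, which has Lipschitz constant 1. The Taylor remainder therefore lies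
  between 0 and half the squared increment, and integration preserves both bounds.\<close>

lemma pos_map_potential:
  "\<bar>inner (pos_map b) b / 2 - inner (pos_map a) a / 2 - inner (pos_map a) (b - a)\<bar> \<le> (norm (b - a))\<^sup>2 / 2"
proof -
  let ?u = "syn a" and ?v = "syn b"
  let ?h = "\<lambda>x. pos ?v x * ?v x / 2 - pos ?u x * ?u x / 2 - (pos ?u x * ?v x - pos ?u x * ?u x)"
  have int: "integrable M (\<lambda>x. pos ?v x * ?v x)" "integrable M (\<lambda>x. pos ?u x * ?u x)"
    "integrable M (\<lambda>x. pos ?u x * ?v x)"
    by (intro L2_mult_integrable pos_L2 syn(1))+
  have h_int: "integrable M ?h"
    using int by (intro Bochner_Integration.integrable_diff integrable_divide) auto
  have sq_int: "integrable M (\<lambda>x. (?v x - ?u x)\<^sup>2 / 2)"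
    by (intro integrable_divide L2_square_integrable L2_diff syn(1))
  have "inner (pos_map b) b / 2 - inner (pos_map a) a / 2 - inner (pos_map a) (b - a)
      = inner (pos_map b) b / 2 - inner (pos_map a) a / 2 - (inner (pos_map a) b - inner (pos_map a) a)"
    by (simp add: inner_diff_right)
  also have "\<dots> = integral\<^sup>L M ?h"
    unfolding inner_pos_map ip_def
    by (intro has_bochner_integral_integral_eq[symmetric] has_bochner_integral_diff
        has_bochner_integral_divide_zero has_bochner_integral_integrable int)
  finally have eq: "inner (pos_map b) b / 2 - inner (pos_map a) a / 2 - inner (pos_map a) (b - a) = integral\<^sup>L M ?h" .
  have h: "0 \<le> ?h x" "?h x \<le> (?v x - ?u x)\<^sup>2 / 2" for x
  proof -
    have "0 \<le> max d 0 * d / 2 - max c 0 * c / 2 - (max c 0 * d - max c 0 * c) \<and>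
        max d 0 * d / 2 - max c 0 * c / 2 - (max c 0 * d - max c 0 * c) \<le> (d - c)\<^sup>2 / 2" (is "?P") for c d :: real
    proof -
      have expand: "(d - c)\<^sup>2 = d * d - 2 * (c * d) + c * c"
        by (simp add: power2_eq_square algebra_simps)
      have "0 \<le> (d - c)\<^sup>2" "0 \<le> c * c" "0 \<le> d * d"
        by simp_all
      note sq = expand this
      consider "0 \<le> c" "0 \<le> d" | "0 \<le> c" "d \<le> 0" | "c \<le> 0" "0 \<le> d" | "c \<le> 0" "d \<le> 0"
        by linarith
      then show ?P
      proof cases
        case 1
        then have "max c 0 = c" "max d 0 = d"
          by auto
        then show ?thesis
          using sq by (simp only:) argo
      next
        case 2
        then have "max c 0 = c" "max d 0 = 0" "c * d \<le> 0"
          by (auto simp: mult_nonneg_nonpos)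
        then show ?thesis
          using sq by (simp only: mult_zero_left) argo
      next
        case 3
        then have "max c 0 = 0" "max d 0 = d" "c * d \<le> 0"
          by (auto simp: mult_nonpos_nonneg)
        then show ?thesis
          using sq by (simp only: mult_zero_left) argo
      next
        case 4
        then have "max c 0 = 0" "max d 0 = 0"
          by auto
        then show ?thesis
          using sq(2) by (simp only: mult_zero_left) argo
      qed
    qed
    then show "0 \<le> ?h x" "?h x \<le> (?v x - ?u x)\<^sup>2 / 2"
      unfolding pos_def by blast+
  qed
  have nonneg: "0 \<le> integral\<^sup>L M ?h"
    by (rule Bochner_Integration.integral_nonneg) (rule h(1))
  have "integral\<^sup>L M ?h \<le> integral\<^sup>L M (\<lambda>x. (?v x - ?u x)\<^sup>2 / 2)"
    by (rule integral_mono[OF h_int sq_int h(2)])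
  also have "\<dots> = (nrm M (\<lambda>x. ?v x - ?u x))\<^sup>2 / 2"
    unfolding nrm_sq ip_def by (simp add: power2_eq_square)
  also have "nrm M (\<lambda>x. ?v x - ?u x) = norm (restrict_J (b - a))"
    using norm_expansion[OF L2_diff[OF syn(1)[of b] syn(1)[of a]]]
    by (simp add: expansion_diff syn restrict_J_diff)
  also have "(norm (restrict_J (b - a)))\<^sup>2 / 2 \<le> (norm (b - a))\<^sup>2 / 2"
    by (intro divide_right_mono power_mono norm_restrict_J_le) simp_all
  finally show ?thesis
    unfolding eq abs_of_nonneg[OF nonneg] .
qed

end

section \<open>The suspension bridge equation\<close>

text \<open>The norms of the statement are unordered sums over \<open>J\<close>, those of the
  coefficient space ordered series over all indices; for nonnegative terms the two agree.\<close>

lemma has_sum_of_sums_on: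
  fixes g :: "nat \<Rightarrow> real"
  assumes "(\<lambda>j. if j \<in> J then g j else 0) sums s" "\<And>j. j \<in> J \<Longrightarrow> 0 \<le> g j"
  shows "(g has_sum s) J"
proof -
  have "((\<lambda>j. if j \<in> J then g j else 0) has_sum s) UNIV"
    by (rule sums_nonneg_imp_has_sum[OF assms(1)]) (use assms(2) in auto)
  then show ?thesis
    by (subst (asm) has_sum_cong_neutral[of J UNIV g]) auto
qed

lemma summable_on_imp_summable_on_nat:
  fixes g :: "nat \<Rightarrow> real"
  assumes "g summable_on J"
  shows "summable (\<lambda>j. if j \<in> J then g j else 0)"
proof -
  have "(\<lambda>j. if j \<in> J then g j else 0) summable_on UNIV"
    using assms summable_on_cong_neutral[of J UNIV g "\<lambda>j. if j \<in> J then g j else 0"] by auto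
  then show ?thesis
    by (rule summable_on_imp_summable)
qed

locale suspension_bridge = spectral M J e lam
  for M :: "'w measure" and J :: "nat set" and e :: "nat \<Rightarrow> 'w \<Rightarrow> real" and lam :: "nat \<Rightarrow> real" +
  fixes p k :: real and force :: "'w \<Rightarrow> real"
  assumes force_L2: "force \<in> L2 M"
    and weak_solution_exists: "\<And>z. z \<in> PH M J e lam \<Longrightarrow> \<exists>sol. weak_sol M J e lam p k force z sol"
begin

text \<open>The value 0 marks an index outside \<open>J\<close>; this is what \<open>phase\<close>
  tests.\<close>

definition freq :: "nat \<Rightarrow> real" where
  "freq j = (if j \<in> J then sqrt (lam j) else 0)"

lemma freq_J: "j \<in> J \<Longrightarrow> 0 < freq j" "j \<in> J \<Longrightarrow> (freq j)\<^sup>2 = lam j"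
    "j \<in> J \<Longrightarrow> lam j = freq j * freq j" "freq j = 0 \<longleftrightarrow> j \<notin> J"
  using lam_pos[of j] by (auto simp: freq_def)

lemma lam_powr:
  assumes "j \<in> J"
  shows "lam j powr (1 / 2) = freq j" "lam j powr (2 / 2) = (freq j)\<^sup>2" "lam j powr (4 / 2) = ((freq j)\<^sup>2)\<^sup>2"
  using lam_pos[OF assms] assms by (simp_all add: freq_def powr_half_sqrt powr_numeral)

sublocale bridge freq p k "expansion force" pos_map
proof
  show "0 \<le> freq j" for j
    using lam_pos[of j] by (auto simp: freq_def)
  show "finite {j. 0 < freq j \<and> freq j \<le> c}" for c
  proof (rule finite_subset[OF _ lam_finite[of "c\<^sup>2"]])
    show "{j. 0 < freq j \<and> freq j \<le> c} \<subseteq> {j \<in> J. lam j \<le> c\<^sup>2}"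
    proof safe
      fix j assume j: "0 < freq j" "freq j \<le> c"
      show J: "j \<in> J"
        using j(1) freq_J(4)[of j] by auto
      show "lam j \<le> c\<^sup>2"
        using power_mono[OF j(2), of 2] j(1) freq_J(2)[OF J] by simp
    qed
  qed
qed (fact pos_map_lipschitz pos_map_nonneg pos_map_potential)+

section \<open>Representatives and coefficients\<close>

definition half_power :: "('w \<Rightarrow> real) \<Rightarrow> l2" where
  "half_power u = Abs_l2 (\<lambda>j. freq j * coord (expansion u) j)"

text \<open>Applying \<open>A\<^sup>1\<^sup>/\<^sup>2\<close> to the first component turns the
  \<open>H\<^sup>2\<close> norm into the plain coefficient norm. The map is therefore isometric
  (\<open>dPH_embed\<close>) and identifies exactly the representatives at distance 0.\<close>

definition embed :: "('w \<Rightarrow> real) \<times> ('w \<Rightarrow> real) \<Rightarrow> l2 \<times> l2" where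
  "embed z = (half_power (fst z), expansion (snd z))"

abbreviation (input) H :: "(('w \<Rightarrow> real) \<times> ('w \<Rightarrow> real)) set" where
  "H \<equiv> PH M J e lam"

lemma Hr_L2: "u \<in> Hr M J e lam r \<Longrightarrow> u \<in> L2 M"
  by (simp add: Hr_def)

lemma PH_iff: "z \<in> H \<longleftrightarrow> fst z \<in> Hr M J e lam 2 \<and> snd z \<in> L2 M"
  by (cases z) (simp add: PH_def)

lemma coord_half_power:
  assumes "u \<in> Hr M J e lam 2"
  shows "coord (half_power u) j = freq j * coord (expansion u) j"
proof -
  have "summable (\<lambda>j. if j \<in> J then lam j powr (2 / 2) * (coef M e j u)\<^sup>2 else 0)"
    using assms by (intro summable_on_imp_summable_on_nat) (simp add: Hr_def)
  moreover have "(if j \<in> J then lam j powr (2 / 2) * (coef M e j u)\<^sup>2 else 0) = (freq j * coord (expansion u) j)\<^sup>2" for j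
    by (cases "j \<in> J") (simp_all only: lam_powr coord_expansion[OF Hr_L2[OF assms]] power_mult_distrib, simp_all)
  ultimately have "summable (\<lambda>j. (freq j * coord (expansion u) j)\<^sup>2)"
    by simp
  then show ?thesis
    by (simp add: half_power_def coord_Abs_l2)
qed

lemma K_half_power: "u \<in> Hr M J e lam 2 \<Longrightarrow> K (half_power u) = expansion u"
  by (rule l2_eqI) (use freq_J(4) in \<open>auto simp: coord_K coord_half_power coord_expansion Hr_L2\<close>)

lemma Hnorm2_diff:
  assumes u: "u \<in> Hr M J e lam 2" and v: "v \<in> Hr M J e lam 2"
  shows "Hnorm2 M J e lam 2 (\<lambda>x. u x - v x) = (norm (half_power u - half_power v))\<^sup>2"
  unfolding Hnorm2_def
proof (rule infsumI, rule has_sum_of_sums_on)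
  have "(if j \<in> J then lam j powr (2 / 2) * (coef M e j (\<lambda>x. u x - v x))\<^sup>2 else 0)
      = (coord (half_power u - half_power v) j)\<^sup>2" for j
  proof (cases "j \<in> J")
    case True
    then have "coord (half_power u - half_power v) j = freq j * coef M e j (\<lambda>x. u x - v x)"
      by (simp add: coord_half_power u v coord_expansion Hr_L2[OF u] Hr_L2[OF v] coef_diff right_diff_distrib)
    then show ?thesis
      using True lam_powr(2)[OF True] by (simp only: if_True power_mult_distrib)
  next
    case False
    then show ?thesis
      by (simp add: coord_half_power u v coord_expansion Hr_L2[OF u] Hr_L2[OF v])
  qed
  then show "(\<lambda>j. if j \<in> J then lam j powr (2 / 2) * (coef M e j (\<lambda>x. u x - v x))\<^sup>2 else 0)
      sums (norm (half_power u - half_power v))\<^sup>2"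
    using norm_l2_sums[of "half_power u - half_power v"] by simp
qed simp

lemma Hr_zero: "(\<lambda>x. 0) \<in> Hr M J e lam 2"
  by (simp add: Hr_def L2_zero coef_def ip_zero_left)

lemma half_power_zero: "half_power (\<lambda>x. 0) = 0"
  by (rule l2_eqI) (simp add: coord_half_power Hr_zero coord_expansion L2_zero coef_def ip_zero_left)

lemma expansion_zero: "expansion (\<lambda>x. 0) = 0"
  by (rule l2_eqI) (simp add: coord_expansion L2_zero coef_def ip_zero_left)

lemma Hnorm2_stretch:
  assumes u: "u \<in> Hr M J e lam 2"
  shows "p - Hnorm2 M J e lam 1 u = \<beta> (half_power u, v)"
proof -
  have "Hnorm2 M J e lam 1 u = inner (K (half_power u)) (half_power u)"
    unfolding Hnorm2_def
  proof (rule infsumI, rule has_sum_of_sums_on)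
    have "(if j \<in> J then lam j powr (1 / 2) * (coef M e j u)\<^sup>2 else 0)
        = coord (K (half_power u)) j * coord (half_power u) j" for j
      by (cases "j \<in> J") (simp_all only: lam_powr K_half_power[OF u] coord_half_power[OF u]
          coord_expansion[OF Hr_L2[OF u]], simp_all add: power2_eq_square)
    then show "(\<lambda>j. if j \<in> J then lam j powr (1 / 2) * (coef M e j u)\<^sup>2 else 0)
        sums inner (K (half_power u)) (half_power u)"
      using inner_l2_sums by simp
  qed simp
  then show ?thesis
    by (simp add: \<beta>_def)
qed

lemma embed_phase: "z \<in> H \<Longrightarrow> embed z \<in> phase"
  unfolding phase_def embed_def
  using freq_J(4) by (auto simp: PH_iff coord_half_power coord_expansion Hr_L2)

lemma dPH_embed:
  assumes "z \<in> H" "z' \<in> H"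
  shows "dPH M J e lam z z' = dist (embed z) (embed z')"
proof -
  have "nrm M (\<lambda>x. snd z x - snd z' x) = norm (expansion (snd z) - expansion (snd z'))"
    using assms norm_expansion[OF L2_diff[of "snd z" M "snd z'"]] by (simp add: PH_iff expansion_diff)
  then show ?thesis
    using assms by (simp add: dPH_def Hnorm2_diff PH_iff embed_def dist_norm norm_Pair)
qed

lemma normPH_embed:
  assumes "z \<in> H"
  shows "normPH M J e lam z = norm (embed z)"
  using assms Hnorm2_diff[of "fst z" "\<lambda>x. 0"]
  by (simp add: normPH_def PH_iff Hr_zero half_power_zero norm_expansion embed_def norm_Pair)

lemma coef_synthesis: "supported a \<Longrightarrow> j \<in> J \<Longrightarrow> coef M e j (synthesis a) = coord a j"
  using synthesis[of a] coord_expansion[of "synthesis a" j] by simp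

lemma phase_supported: "\<zeta> \<in> phase \<Longrightarrow> supported (K (fst \<zeta>))" "\<zeta> \<in> phase \<Longrightarrow> supported (snd \<zeta>)"
  unfolding phase_def supported_def using freq_J(4) by (auto simp: coord_K)

lemma synthesis_Hr:
  assumes \<zeta>: "\<zeta> \<in> phase"
  shows "synthesis (K (fst \<zeta>)) \<in> Hr M J e lam 2" "half_power (synthesis (K (fst \<zeta>))) = fst \<zeta>"
proof -
  let ?u = "synthesis (K (fst \<zeta>))"
  note u = synthesis[OF phase_supported(1)[OF \<zeta>]]
  have x: "freq j * coord (K (fst \<zeta>)) j = coord (fst \<zeta>) j" for j
    using \<zeta> unfolding phase_def coord_K by (cases "freq j = 0") auto
  have "(if j \<in> J then lam j powr (2 / 2) * (coef M e j ?u)\<^sup>2 else 0) = (coord (fst \<zeta>) j)\<^sup>2" for j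
  proof (cases "j \<in> J")
    case True
    then have "coord (fst \<zeta>) j = freq j * coef M e j ?u"
      using x[of j] by (simp add: coef_synthesis phase_supported \<zeta>)
    then show ?thesis
      using True lam_powr(2)[OF True] by (simp only: if_True power_mult_distrib)
  next
    case False
    then show ?thesis
      using x[of j] freq_J(4)[of j] by simp
  qed
  then have "((\<lambda>j. lam j powr (2 / 2) * (coef M e j ?u)\<^sup>2) has_sum (norm (fst \<zeta>))\<^sup>2) J"
    using norm_l2_sums by (intro has_sum_of_sums_on) simp_all
  then show Hr: "?u \<in> Hr M J e lam 2"
    unfolding Hr_def using u(1) has_sum_imp_summable by blast
  show "half_power ?u = fst \<zeta>"
    by (rule l2_eqI) (simp only: coord_half_power[OF Hr] u(2) x)
qed

text \<open>A right inverse of \<open>embed\<close> on \<open>phase\<close>, obtained by choosing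
  representatives.\<close>

definition lift :: "l2 \<times> l2 \<Rightarrow> ('w \<Rightarrow> real) \<times> ('w \<Rightarrow> real)" where
  "lift \<zeta> = (synthesis (K (fst \<zeta>)), synthesis (snd \<zeta>))"

lemma lift:
  assumes "\<zeta> \<in> phase"
  shows "lift \<zeta> \<in> H" "embed (lift \<zeta>) = \<zeta>"
  using synthesis_Hr[OF assms] synthesis[OF phase_supported(2)[OF assms]]
  by (simp_all add: lift_def PH_iff embed_def)

lemma coord_G_embed:
  assumes z: "z \<in> H" and j: "j \<in> J"
  shows "coord (G (embed z)) j = coef M e j force
    + (p - Hnorm2 M J e lam 1 (fst z)) * sqrt (lam j) * coef M e j (fst z) - k\<^sup>2 * coef M e j (pos (fst z))"
proof -
  have u: "fst z \<in> Hr M J e lam 2" "fst z \<in> L2 M"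
    using z Hr_L2 by (auto simp: PH_iff)
  have "coord (pos_map (K (half_power (fst z)))) j = coef M e j (pos (fst z))"
    using j by (simp add: K_half_power u pos_map_expansion coord_expansion pos_L2)
  then show ?thesis
    using j unfolding G_def embed_def Hnorm2_stretch[OF u(1), of "expansion (snd z)"]
    by (simp add: coord_expansion force_L2 coord_half_power u freq_def)
qed

text \<open>In coefficient form the integrands are continuous in time, so the integrated weak
  equation can be differentiated. Indices outside \<open>J\<close> are not tested by
  \<open>weak_sol\<close>; there all coordinates, including those of \<open>G\<close>, are
  0.\<close>

lemma weak_sol_solution:
  assumes "weak_sol M J e lam p k force z s"
  shows "solution 0 (\<lambda>t. embed (s t))"
proof -
  let ?rhs = "\<lambda>j \<tau>. coef M e j force - lam j * coef M e j (fst (s \<tau>)) - coef M e j (snd (s \<tau>))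
             + (p - Hnorm2 M J e lam 1 (fst (s \<tau>))) * sqrt (lam j) * coef M e j (fst (s \<tau>))
             - k\<^sup>2 * coef M e j (pos (fst (s \<tau>)))"
  have sH: "s t \<in> H" if "0 \<le> t" for t
    using assms that unfolding weak_sol_def by blast
  have s_cont: "\<exists>\<delta>>0. \<forall>s'\<ge>0. \<bar>s' - t\<bar> < \<delta> \<longrightarrow> dPH M J e lam (s s') (s t) < \<epsilon>" if "0 \<le> t" "0 < \<epsilon>" for t \<epsilon>
    using assms that unfolding weak_sol_def by blast
  have eq1: "coef M e j (fst (s t)) = coef M e j (fst (s 0)) + integral {0..t} (\<lambda>\<tau>. coef M e j (snd (s \<tau>)))"
    and eq2: "coef M e j (snd (s t)) = coef M e j (snd (s 0)) + integral {0..t} (?rhs j)" if "j \<in> J" "0 \<le> t" for j t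
    using assms that unfolding weak_sol_def by blast+
  define z where "z t = embed (s t)" for t
  have phase: "z t \<in> phase" if "0 \<le> t" for t
    unfolding z_def by (rule embed_phase[OF sH[OF that]])
  have cont: "continuous_on {0..} z"
    unfolding continuous_on_iff
  proof (intro ballI allI impI)
    fix t \<epsilon> :: real assume t: "t \<in> {0..}" and \<epsilon>: "0 < \<epsilon>"
    then obtain \<delta> where \<delta>: "0 < \<delta>" "\<And>s'. 0 \<le> s' \<Longrightarrow> \<bar>s' - t\<bar> < \<delta> \<Longrightarrow> dPH M J e lam (s s') (s t) < \<epsilon>"
      using s_cont[of t \<epsilon>] by auto
    have "dist (z t') (z t) < \<epsilon>" if "t' \<in> {0..}" "dist t' t < \<delta>" for t'
      using \<delta>(2)[of t'] that t dPH_embed[OF sH sH, of t' t] by (simp add: z_def dist_real_def)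
    then show "\<exists>\<delta>>0. \<forall>t'\<in>{0..}. dist t' t < \<delta> \<longrightarrow> dist (z t') (z t) < \<epsilon>"
      using \<delta>(1) by blast
  qed
  have coords: "coord (fst (z t)) j = freq j * coef M e j (fst (s t))"
      "coord (snd (z t)) j = coef M e j (snd (s t))"
      "lam j * coef M e j (fst (s t)) = freq j * coord (fst (z t)) j" if "0 \<le> t" "j \<in> J" for t j
  proof -
    have u: "fst (s t) \<in> Hr M J e lam 2" and v: "snd (s t) \<in> L2 M"
      using sH[OF that(1)] by (auto simp: PH_iff)
    show "coord (fst (z t)) j = freq j * coef M e j (fst (s t))"
      using that(2) by (simp add: z_def embed_def coord_half_power u coord_expansion Hr_L2[OF u])
    then show "lam j * coef M e j (fst (s t)) = freq j * coord (fst (z t)) j"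
      using freq_J(3)[OF that(2)] by simp
    show "coord (snd (z t)) j = coef M e j (snd (s t))"
      using that(2) by (simp add: z_def embed_def coord_expansion v)
  qed
  have dx: "((\<lambda>t. coord (fst (z t)) j) has_real_derivative freq j * coord (snd (z t)) j) (at t within {0..})"
    and dy: "((\<lambda>t. coord (snd (z t)) j) has_real_derivative
        - freq j * coord (fst (z t)) j - coord (snd (z t)) j + coord (G (z t)) j) (at t within {0..})"
    if t: "0 \<le> t" for t j
  proof -
    have contx: "continuous_on {0..} (\<lambda>t. freq j * coord (snd (z t)) j)"
      and conty: "continuous_on {0..} (\<lambda>t. - freq j * coord (fst (z t)) j - coord (snd (z t)) j + coord (G (z t)) j)"
      using continuous_on_G[OF cont] cont
      by (auto intro!: continuous_on_coord continuous_intros)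
    have "(coord (fst (z t')) j = coord (fst (z 0)) j + integral {0..t'} (\<lambda>t. freq j * coord (snd (z t)) j)) \<and>
        (coord (snd (z t')) j = coord (snd (z 0)) j + integral {0..t'} (\<lambda>t. - freq j * coord (fst (z t)) j
          - coord (snd (z t)) j + coord (G (z t)) j))" if t': "0 \<le> t'" for t'
    proof (cases "j \<in> J")
      case True
      have "coord (fst (z t')) j = freq j * (coef M e j (fst (s 0)) + integral {0..t'} (\<lambda>\<tau>. coef M e j (snd (s \<tau>))))"
        using coords(1)[OF t' True] eq1[OF True t'] by simp
      also have "\<dots> = coord (fst (z 0)) j + integral {0..t'} (\<lambda>\<tau>. freq j * coef M e j (snd (s \<tau>)))"
        using coords(1)[OF order_refl True] by (simp add: distrib_left)
      also have "integral {0..t'} (\<lambda>\<tau>. freq j * coef M e j (snd (s \<tau>))) = integral {0..t'} (\<lambda>t. freq j * coord (snd (z t)) j)"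
        by (rule integral_cong) (use coords(2) True in simp)
      finally have 1: "coord (fst (z t')) j = coord (fst (z 0)) j + integral {0..t'} (\<lambda>t. freq j * coord (snd (z t)) j)" .
      have "integral {0..t'} (?rhs j)
          = integral {0..t'} (\<lambda>t. - freq j * coord (fst (z t)) j - coord (snd (z t)) j + coord (G (z t)) j)"
      proof (rule integral_cong)
        fix \<tau> assume "\<tau> \<in> {0..t'}"
        then have \<tau>: "0 \<le> \<tau>" by simp
        show "?rhs j \<tau>
            = - freq j * coord (fst (z \<tau>)) j - coord (snd (z \<tau>)) j + coord (G (z \<tau>)) j"
          using coord_G_embed[OF sH[OF \<tau>] True] coords(2,3)[OF \<tau> True] by (simp add: z_def)
      qed
      then have 2: "coord (snd (z t')) j = coord (snd (z 0)) j + integral {0..t'} (\<lambda>t. - freq j * coord (fst (z t)) j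
          - coord (snd (z t)) j + coord (G (z t)) j)"
        using coords(2)[OF t' True] coords(2)[OF order_refl True] eq2[OF True t'] by simp
      from 1 2 show ?thesis ..
    next
      case False
      then have w0: "freq j = 0"
        using freq_J(4) by blast
      have zero: "coord (fst (z t)) j = 0" "coord (snd (z t)) j = 0" if "0 \<le> t" for t
        using phase[OF that] w0 unfolding phase_def by auto
      have "coord (expansion force) j = 0" "coord (pos_map a) j = 0" for a
        using False supported_pos_map[of a] supported_expansion[OF force_L2] unfolding supported_def by auto
      then have "coord (G (z t)) j = 0" if "0 \<le> t" for t
        using zero[OF that] by (simp add: G_def)
      then have "integral {0..t'} (\<lambda>t. - freq j * coord (fst (z t)) j - coord (snd (z t)) j + coord (G (z t)) j) = integral {0..t'} (\<lambda>t. 0)"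
        by (intro integral_cong) (simp add: zero)
      then show ?thesis
        using zero[OF t'] zero[OF order_refl] w0 by simp
    qed
    then have 1: "coord (fst (z t')) j = coord (fst (z 0)) j + integral {0..t'} (\<lambda>t. freq j * coord (snd (z t)) j)"
      and 2: "coord (snd (z t')) j = coord (snd (z 0)) j + integral {0..t'} (\<lambda>t. - freq j * coord (fst (z t)) j
          - coord (snd (z t)) j + coord (G (z t)) j)" if "0 \<le> t'" for t'
      using that by blast+
    show "((\<lambda>t. coord (fst (z t)) j) has_real_derivative freq j * coord (snd (z t)) j) (at t within {0..})"
      by (rule integral_has_real_derivative_Ici[OF contx 1 t])
    show "((\<lambda>t. coord (snd (z t)) j) has_real_derivative
        - freq j * coord (fst (z t)) j - coord (snd (z t)) j + coord (G (z t)) j) (at t within {0..})"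
      by (rule integral_has_real_derivative_Ici[OF conty 2 t])
  qed
  have "solution 0 z"
    unfolding solution_def linear_solution_def
    using cont continuous_on_G[OF cont] phase dx dy by blast
  then show ?thesis
    unfolding z_def .
qed

section \<open>The semigroup of the equation and its attractor\<close>

abbreviation (input) flow :: "real \<Rightarrow> ('w \<Rightarrow> real) \<times> ('w \<Rightarrow> real) \<Rightarrow> ('w \<Rightarrow> real) \<times> ('w \<Rightarrow> real)" where
  "flow \<equiv> Sg M J e lam p k force"

lemma flow:
  assumes z: "z \<in> H"
  shows "solution 0 (\<lambda>t. embed (flow t z))" "0 \<le> t \<Longrightarrow> flow t z \<in> H" "embed (flow 0 z) = embed z"
proof -
  have *: "weak_sol M J e lam p k force z (\<lambda>t. flow t z)"
    unfolding Sg_def using someI_ex[OF weak_solution_exists[OF z]] by simp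
  show "solution 0 (\<lambda>t. embed (flow t z))"
    by (rule weak_sol_solution[OF *])
  show H: "flow t z \<in> H" if "0 \<le> t" for t
    using * that unfolding weak_sol_def by blast
  have "dPH M J e lam (flow 0 z) z = 0"
    using * unfolding weak_sol_def by blast
  then show "embed (flow 0 z) = embed z"
    using dPH_embed[OF H[OF order_refl] z] by simp
qed

sublocale bridge_flow freq p k "expansion force" pos_map "\<lambda>t \<zeta>. embed (flow t (lift \<zeta>))"
  by standard (use flow lift in auto)

text \<open>\<open>flow\<close> chooses a solution separately for each representative; equal images
  of the initial data force the images of these solutions to agree, by
  \<open>solution_unique\<close>.\<close>

lemma embed_flow:
  assumes z: "z \<in> H" and t: "0 \<le> t"
  shows "embed (flow t z) = embed (flow t (lift (embed z)))"
proof (rule solution_unique[OF flow(1)[OF z] S_solution[OF embed_phase[OF z]] _ t])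
  show "embed (flow 0 z) = embed (flow 0 (lift (embed z)))"
    using flow(3)[OF z] S_initial[OF embed_phase[OF z]] by simp
qed

text \<open>Every representative of a class is included, so \<open>flow\<close> maps the set into
  itself whichever representative it returns.\<close>

definition global_attr :: "(('w \<Rightarrow> real) \<times> ('w \<Rightarrow> real)) set" where
  "global_attr = {z \<in> H. embed z \<in> attractor}"

lemma lift_attractor: "\<zeta> \<in> attractor \<Longrightarrow> lift \<zeta> \<in> global_attr \<and> embed (lift \<zeta>) = \<zeta>"
proof -
  assume \<zeta>: "\<zeta> \<in> attractor"
  then have "\<zeta> \<in> phase"
    using attractor_subset by blast
  from lift[OF this] \<zeta> show ?thesis
    unfolding global_attr_def by simp
qed

lemma compactH_attractor: "compactH M J e lam global_attr"
  unfolding compactH_def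
proof (intro conjI allI impI)
  show "global_attr \<subseteq> H"
    unfolding global_attr_def by blast
  fix x :: "nat \<Rightarrow> ('w \<Rightarrow> real) \<times> ('w \<Rightarrow> real)"
  assume x: "\<forall>n. x n \<in> global_attr"
  then have "\<forall>n. embed (x n) \<in> attractor"
    unfolding global_attr_def by blast
  then obtain l r where r: "l \<in> attractor" "strict_mono (r :: nat \<Rightarrow> nat)" "((\<lambda>n. embed (x n)) \<circ> r) \<longlonglongrightarrow> l"
    using compact_attractor unfolding compact_eq_seq_compact_metric seq_compact_def by metis
  have y: "lift l \<in> global_attr" "embed (lift l) = l"
    using lift_attractor[OF r(1)] by auto
  have "dPH M J e lam (x (r n)) (lift l) = dist (embed (x (r n))) l" for n
    using dPH_embed[of "x (r n)" "lift l"] x y unfolding global_attr_def by simp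
  moreover have "(\<lambda>n. dist (embed (x (r n))) l) \<longlonglongrightarrow> 0"
    using r(3) unfolding tendsto_dist_iff[of _ l] o_def .
  ultimately have "(\<lambda>n. dPH M J e lam (x (r n)) (lift l)) \<longlonglongrightarrow> 0"
    by simp
  then show "\<exists>r y. strict_mono (r :: nat \<Rightarrow> nat) \<and> y \<in> global_attr \<and> (\<lambda>n. dPH M J e lam (x (r n)) y) \<longlonglongrightarrow> 0"
    using r(2) y(1) by blast
qed

lemma global_attractor_attr: "global_attractor M J e lam p k force global_attr"
  unfolding global_attractor_def
proof (intro conjI allI impI)
  show "compactH M J e lam global_attr"
    by (rule compactH_attractor)
next
  fix B and \<epsilon> :: real
  assume B: "boundedH M J e lam B" and \<epsilon>: "0 < \<epsilon>"
  then obtain R where R: "B \<subseteq> H" "\<And>b. b \<in> B \<Longrightarrow> normPH M J e lam b \<le> R"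
    unfolding boundedH_def by blast
  obtain T where T: "0 \<le> T" "\<And>t \<zeta>. T \<le> t \<Longrightarrow> \<zeta> \<in> phase \<Longrightarrow> norm \<zeta> \<le> R \<Longrightarrow>
      \<exists>a\<in>attractor. dist (embed (flow t (lift \<zeta>))) a < \<epsilon>"
    using attracts[OF \<epsilon>, of R] by blast
  have "\<exists>a\<in>global_attr. dPH M J e lam (flow t b) a < \<epsilon>" if t: "T \<le> t" and b: "b \<in> B" for t b
  proof -
    have bH: "b \<in> H" and t0: "0 \<le> t"
      using R(1) b t T(1) by auto
    obtain a where a: "a \<in> attractor" "dist (embed (flow t (lift (embed b)))) a < \<epsilon>"
      using T(2)[OF t embed_phase[OF bH]] R(2)[OF b] normPH_embed[OF bH] by auto
    have "dPH M J e lam (flow t b) (lift a) = dist (embed (flow t b)) (embed (lift a))"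
      by (rule dPH_embed[OF flow(2)[OF bH t0]]) (use lift_attractor[OF a(1)] in \<open>auto simp: global_attr_def\<close>)
    then show ?thesis
      using a(2) lift_attractor[OF a(1)] embed_flow[OF bH t0] by (intro bexI[of _ "lift a"]) simp_all
  qed
  then show "\<exists>T. \<forall>t\<ge>T. \<forall>b\<in>B. \<exists>a\<in>global_attr. dPH M J e lam (flow t b) a < \<epsilon>"
    by blast
next
  fix t :: real assume t: "0 \<le> t"
  have inv: "flow t a \<in> global_attr" if "a \<in> global_attr" for a
    using that S_in_attractor[OF t, of "embed a"] embed_flow[OF _ t, of a] flow(2)[OF _ t, of a]
    unfolding global_attr_def by simp
  have self: "dPH M J e lam x x = 0" if "x \<in> global_attr" for x
    using that dPH_embed[of x x] unfolding global_attr_def by simp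
  show "set_eqH M J e lam (flow t ` global_attr) global_attr"
    unfolding set_eqH_def
  proof (intro conjI ballI)
    fix x assume "x \<in> flow t ` global_attr"
    then have "x \<in> global_attr"
      using inv by blast
    then show "\<exists>y\<in>global_attr. dPH M J e lam x y = 0"
      using self by blast
  next
    fix y assume y: "y \<in> global_attr"
    then obtain w where w: "w \<in> attractor" "embed (flow t (lift w)) = embed y"
      using attractor_preimage[OF t, of "embed y"] unfolding global_attr_def by blast
    have "flow t (lift w) \<in> global_attr"
      using inv lift_attractor[OF w(1)] by blast
    then have "dPH M J e lam (flow t (lift w)) y = 0"
      using dPH_embed[of "flow t (lift w)" y] w(2) y unfolding global_attr_def by simp
    then show "\<exists>x\<in>flow t ` global_attr. dPH M J e lam x y = 0"
      using lift_attractor[OF w(1)] by blast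
  qed
qed

lemma connectedH_attr: "connectedH M J e lam global_attr"
  unfolding connectedH_def
proof (intro notI, elim exE conjE)
  fix U V
  assume U: "openH M J e lam U" and V: "openH M J e lam V"
    and UV: "global_attr \<subseteq> U \<union> V" "U \<inter> V \<inter> global_attr = {}" "U \<inter> global_attr \<noteq> {}" "V \<inter> global_attr \<noteq> {}"
  \<comment> \<open>An open set of coefficients whose preimage under \<open>embed\<close> is the
    given \<open>openH\<close> set: the union of balls with the radii that witness openness. A
    separation of \<open>global_attr\<close> thus becomes one of \<open>attractor\<close>.\<close>
  define saturation where "saturation U = \<Union>{ball (embed x) \<epsilon> |x \<epsilon>. x \<in> U \<and> 0 < \<epsilon> \<and> (\<forall>y\<in>H. dPH M J e lam x y < \<epsilon> \<longrightarrow> y \<in> U)}" for U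
  have saturation_open: "open (saturation W)" for W
    unfolding saturation_def by (rule open_Union) auto
  have saturation_iff: "embed y \<in> saturation W \<longleftrightarrow> y \<in> W" if W: "openH M J e lam W" and y: "y \<in> H" for W y
  proof
    assume "embed y \<in> saturation W"
    then obtain x \<epsilon> where x: "x \<in> W" "\<forall>y\<in>H. dPH M J e lam x y < \<epsilon> \<longrightarrow> y \<in> W" "dist (embed x) (embed y) < \<epsilon>"
      unfolding saturation_def by auto
    moreover have "x \<in> H"
      using x(1) W unfolding openH_def by blast
    ultimately show "y \<in> W"
      using dPH_embed[of x y] y by simp
  next
    assume "y \<in> W"
    moreover from this obtain \<epsilon> where "0 < \<epsilon>" "\<forall>y'\<in>H. dPH M J e lam y y' < \<epsilon> \<longrightarrow> y' \<in> W"
      using W unfolding openH_def by blast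
    ultimately show "embed y \<in> saturation W"
      unfolding saturation_def by (intro UnionI[of "ball (embed y) \<epsilon>"] CollectI exI[of _ y] exI[of _ \<epsilon>]) simp_all
  qed
  have attr: "\<exists>y\<in>global_attr. \<zeta> = embed y" if "\<zeta> \<in> attractor" for \<zeta>
    using lift_attractor[OF that] by metis
  have mem: "embed y \<in> attractor" "y \<in> H" if "y \<in> global_attr" for y
    using that unfolding global_attr_def by auto
  have "attractor \<subseteq> saturation U \<union> saturation V"
  proof
    fix \<zeta> assume "\<zeta> \<in> attractor"
    then obtain y where "y \<in> global_attr" "\<zeta> = embed y"
      using attr by blast
    then show "\<zeta> \<in> saturation U \<union> saturation V"
      using UV(1) mem(2) saturation_iff[OF U] saturation_iff[OF V] by blast
  qed
  moreover have "saturation U \<inter> saturation V \<inter> attractor = {}"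
  proof (rule ccontr)
    assume "saturation U \<inter> saturation V \<inter> attractor \<noteq> {}"
    then obtain y where "y \<in> global_attr" "embed y \<in> saturation U" "embed y \<in> saturation V"
      using attr by blast
    then show False
      using UV(2) mem(2) saturation_iff[OF U] saturation_iff[OF V] by blast
  qed
  moreover have "saturation U \<inter> attractor \<noteq> {}" "saturation V \<inter> attractor \<noteq> {}"
    using UV(3,4) mem saturation_iff[OF U] saturation_iff[OF V] by blast+
  ultimately show False
    using connectedD[OF connected_attractor saturation_open[of U] saturation_open[of V]] by blast
qed

text \<open>The partial sums are bounded uniformly over the attractor; this gives summability and,
  in the limit, the same bound for the full norms.\<close>

lemma regularity_attr:
  "\<exists>R. \<forall>z\<in>global_attr. fst z \<in> Hr M J e lam 4 \<and> snd z \<in> Hr M J e lam 2 \<and>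
    Hnorm2 M J e lam 4 (fst z) + Hnorm2 M J e lam 2 (snd z) \<le> R"
proof -
  obtain R where R: "\<And>\<zeta> n. \<zeta> \<in> attractor \<Longrightarrow>
      (\<Sum>j<n. (freq j)\<^sup>2 * ((coord (fst \<zeta>) j)\<^sup>2 + (coord (snd \<zeta>) j)\<^sup>2)) \<le> R"
    using attractor_regularity by blast
  have "fst z \<in> Hr M J e lam 4 \<and> snd z \<in> Hr M J e lam 2 \<and>
    Hnorm2 M J e lam 4 (fst z) + Hnorm2 M J e lam 2 (snd z) \<le> R" if z: "z \<in> global_attr" for z
  proof -
    have zH: "fst z \<in> Hr M J e lam 2" "fst z \<in> L2 M" "snd z \<in> L2 M" and zA: "embed z \<in> attractor"
      using z Hr_L2 unfolding global_attr_def PH_iff by auto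
    define a b where "a j = (freq j)\<^sup>2 * (coord (fst (embed z)) j)\<^sup>2"
      and "b j = (freq j)\<^sup>2 * (coord (snd (embed z)) j)\<^sup>2" for j
    have nonneg: "0 \<le> a j" "0 \<le> b j" for j
      unfolding a_def b_def by simp_all
    have ab: "(\<Sum>j<n. a j) + (\<Sum>j<n. b j) \<le> R" for n
      using R[OF zA, of n] unfolding a_def b_def by (simp add: sum.distrib distrib_left)
    have "summable a"
    proof (rule summable_of_bounded_partial_sums[where B = R])
      show "sum a {..<n} \<le> R" for n
        using ab[of n] sum_nonneg[of "{..<n}" b] nonneg(2) by simp
    qed (rule nonneg(1))
    moreover have "summable b"
    proof (rule summable_of_bounded_partial_sums[where B = R])
      show "sum b {..<n} \<le> R" for n
        using ab[of n] sum_nonneg[of "{..<n}" a] nonneg(1) by simp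
    qed (rule nonneg(2))
    ultimately have sums: "a sums suminf a" "b sums suminf b"
      by (simp_all add: summable_sums)
    have a: "a = (\<lambda>j. if j \<in> J then lam j powr (4 / 2) * (coef M e j (fst z))\<^sup>2 else 0)"
    proof
      fix j
      show "a j = (if j \<in> J then lam j powr (4 / 2) * (coef M e j (fst z))\<^sup>2 else 0)"
        using lam_pos[of j] freq_J(2)[of j] freq_J(4)[of j]
        by (auto simp: a_def embed_def coord_half_power zH coord_expansion power_mult_distrib powr_numeral power2_eq_square)
    qed
    have b: "b = (\<lambda>j. if j \<in> J then lam j powr (2 / 2) * (coef M e j (snd z))\<^sup>2 else 0)"
    proof
      fix j
      show "b j = (if j \<in> J then lam j powr (2 / 2) * (coef M e j (snd z))\<^sup>2 else 0)"
        using lam_pos[of j] freq_J(2)[of j] freq_J(4)[of j]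
        by (auto simp: b_def embed_def coord_expansion zH)
    qed
    have ha: "((\<lambda>j. lam j powr (4 / 2) * (coef M e j (fst z))\<^sup>2) has_sum suminf a) J"
      by (rule has_sum_of_sums_on) (use sums(1) in \<open>simp_all flip: a\<close>)
    have hb: "((\<lambda>j. lam j powr (2 / 2) * (coef M e j (snd z))\<^sup>2) has_sum suminf b) J"
      by (rule has_sum_of_sums_on) (use sums(2) in \<open>simp_all flip: b\<close>)
    have "(\<lambda>n. (\<Sum>j<n. a j) + (\<Sum>j<n. b j)) \<longlonglongrightarrow> suminf a + suminf b"
      using sums unfolding sums_def by (rule tendsto_add)
    then have "suminf a + suminf b \<le> R"
      by (rule LIMSEQ_le_const2) (use ab in blast)
    then have "Hnorm2 M J e lam 4 (fst z) + Hnorm2 M J e lam 2 (snd z) \<le> R"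
      unfolding Hnorm2_def infsumI[OF ha] infsumI[OF hb] .
    moreover have "fst z \<in> Hr M J e lam 4" "snd z \<in> Hr M J e lam 2"
      unfolding Hr_def using zH has_sum_imp_summable[OF ha] has_sum_imp_summable[OF hb] by blast+
    ultimately show ?thesis by blast
  qed
  then show ?thesis by blast
qed

text \<open>The representative is built with the velocity literally \<open>\<lambda>x. 0\<close>, as
  \<open>stationary\<close> demands; \<open>lift\<close> would return some function of norm
  0.\<close>

lemma equilibria_stationary:
  assumes "\<zeta> \<in> equilibria"
  shows "\<exists>s\<in>stationary M J e lam p k force. s \<in> H \<and> embed s = \<zeta>"
proof -
  have \<zeta>: "\<zeta> \<in> phase" "snd \<zeta> = 0" "\<And>j. coord (G \<zeta>) j = freq j * coord (fst \<zeta>) j"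
    using assms unfolding equilibria_def by auto
  let ?u = "synthesis (K (fst \<zeta>))"
  let ?s = "(?u, \<lambda>x. 0 :: real)"
  note u = synthesis_Hr[OF \<zeta>(1)]
  have sH: "?s \<in> H" and emb: "embed ?s = \<zeta>"
    using u \<zeta>(2) by (simp_all add: PH_iff L2_zero embed_def expansion_zero prod_eq_iff)
  have "lam j * coef M e j ?u - (p - Hnorm2 M J e lam 1 ?u) * sqrt (lam j) * coef M e j ?u
      + k\<^sup>2 * coef M e j (pos ?u) = coef M e j force" if j: "j \<in> J" for j
  proof -
    have "coord (fst \<zeta>) j = freq j * coef M e j ?u"
      using coord_half_power[OF u(1), of j] u(2) j by (simp add: coord_expansion Hr_L2[OF u(1)])
    then have "lam j * coef M e j ?u = coord (G \<zeta>) j"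
      using \<zeta>(3)[of j] freq_J(3)[OF j] by simp
    then show ?thesis
      using coord_G_embed[OF sH j] emb by simp
  qed
  then have "?s \<in> stationary M J e lam p k force"
    unfolding stationary_def using u(1) by blast
  with sH emb show ?thesis by blast
qed

text \<open>From left to right, a complete orbit of coefficients is lifted at each time
  independently, which \<open>complete_traj\<close> permits because it compares states by distance.
  From right to left, the boundedness of a complete trajectory places it in the attractor.\<close>

lemma attr_eq_unstable_set:
  "set_eqH M J e lam global_attr (unstable_set M J e lam p k force)"
  unfolding set_eqH_def
proof (intro conjI ballI)
  fix x assume x: "x \<in> global_attr"
  then have xH: "x \<in> H" and xA: "embed x \<in> attractor"
    unfolding global_attr_def by auto
  obtain z where z: "complete_orbit z" "z 0 = embed x" "\<And>\<tau>. z \<tau> \<in> attractor"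
    by (rule complete_orbit_through[OF xA]) blast
  define y where "y t = lift (z t)" for t
  have y: "y t \<in> H" "embed (y t) = z t" for t
    using lift_attractor[OF z(3)] unfolding y_def global_attr_def by auto
  have "complete_traj M J e lam p k force y"
    unfolding complete_traj_def
  proof (intro conjI allI impI)
    fix t \<tau> :: real assume t: "0 \<le> t"
    have "embed (flow t (y \<tau>)) = z (t + \<tau>)"
      using z(1) t unfolding complete_orbit_def y_def by blast
    then show "dPH M J e lam (flow t (y \<tau>)) (y (t + \<tau>)) = 0"
      using dPH_embed[OF flow(2)[OF y(1) t] y(1)] y(2) by simp
  qed (rule y(1))
  moreover obtain R where "\<And>\<zeta>. \<zeta> \<in> attractor \<Longrightarrow> norm \<zeta> \<le> R"
    using compact_imp_bounded[OF compact_attractor] unfolding bounded_iff by blast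
  then have "\<forall>t. normPH M J e lam (y t) \<le> R"
    using normPH_embed[OF y(1)] y(2) z(3) by simp
  moreover have "\<exists>T. \<forall>t\<ge>T. \<exists>s\<in>stationary M J e lam p k force. dPH M J e lam (y (- t)) s < \<epsilon>" if \<epsilon>: "0 < \<epsilon>" for \<epsilon>
  proof -
    obtain T where T: "\<And>t. T \<le> t \<Longrightarrow> \<exists>\<zeta>\<in>equilibria. dist (z (- t)) \<zeta> < \<epsilon>"
      using attractor_orbit_to_equilibria[OF z(1,3) \<epsilon>] by blast
    have "\<exists>s\<in>stationary M J e lam p k force. dPH M J e lam (y (- t)) s < \<epsilon>" if t: "T \<le> t" for t
    proof -
      obtain \<zeta> where \<zeta>: "\<zeta> \<in> equilibria" "dist (z (- t)) \<zeta> < \<epsilon>"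
        using T[OF t] by blast
      obtain s where s: "s \<in> stationary M J e lam p k force" "s \<in> H" "embed s = \<zeta>"
        using equilibria_stationary[OF \<zeta>(1)] by blast
      have "dPH M J e lam (y (- t)) s < \<epsilon>"
        using dPH_embed[OF y(1) s(2), of "- t"] y(2) s(3) \<zeta>(2) by simp
      with s(1) show ?thesis by blast
    qed
    then show ?thesis by blast
  qed
  ultimately have "y 0 \<in> unstable_set M J e lam p k force"
    unfolding unstable_set_def by blast
  moreover have "dPH M J e lam x (y 0) = 0"
    using dPH_embed[OF xH y(1)] y(2) z(2) by simp
  ultimately show "\<exists>y\<in>unstable_set M J e lam p k force. dPH M J e lam x y = 0"
    by blast
next
  fix y assume "y \<in> unstable_set M J e lam p k force"
  then obtain z R where z: "y = z 0" "complete_traj M J e lam p k force z" "\<And>t. normPH M J e lam (z t) \<le> R"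
    unfolding unstable_set_def by blast
  have zH: "z t \<in> H" for t
    using z(2) unfolding complete_traj_def by blast
  have "complete_orbit (\<lambda>t. embed (z t))"
    unfolding complete_orbit_def
  proof (intro conjI allI impI)
    show "embed (z \<tau>) \<in> phase" for \<tau>
      by (rule embed_phase[OF zH])
    fix t \<tau> :: real assume t: "0 \<le> t"
    have "dPH M J e lam (flow t (z \<tau>)) (z (t + \<tau>)) = 0"
      using z(2) t unfolding complete_traj_def by blast
    then show "embed (flow t (lift (embed (z \<tau>)))) = embed (z (t + \<tau>))"
      using dPH_embed[OF flow(2)[OF zH t] zH] embed_flow[OF zH t] by simp
  qed
  then have "embed (z 0) \<in> attractor"
    by (rule bounded_complete_orbit_in_attractor[where R = R]) (use z(3) normPH_embed[OF zH] in simp)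
  then have "y \<in> global_attr" "dPH M J e lam y y = 0"
    using zH dPH_embed[OF zH zH, of 0 0] unfolding global_attr_def z(1) by auto
  then show "\<exists>x\<in>global_attr. dPH M J e lam x y = 0"
    by blast
qed

end

theorem theorem4p1:
  fixes M :: "'w measure" and J :: "nat set" and e :: "nat \<Rightarrow> 'w \<Rightarrow> real"
    and lam :: "nat \<Rightarrow> real" and p k :: real and f :: "'w \<Rightarrow> real"
  assumes A: "spectral_data M J e lam"
    and f: "f \<in> L2 M"
    and exist: "\<forall>z\<in>PH M J e lam. \<exists>sol. weak_sol M J e lam p k f z sol"
    and uniq: "\<forall>z\<in>PH M J e lam. \<forall>sol1 sol2. weak_sol M J e lam p k f z sol1
                  \<and> weak_sol M J e lam p k f z sol2
                  \<longrightarrow> (\<forall>t\<ge>0. dPH M J e lam (sol1 t) (sol2 t) = 0)"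
  shows "\<exists>At. global_attractor M J e lam p k f At
            \<and> connectedH M J e lam At
            \<and> At \<subseteq> Hr M J e lam 4 \<times> Hr M J e lam 2
            \<and> (\<exists>R. \<forall>(u, v)\<in>At. Hnorm2 M J e lam 4 u + Hnorm2 M J e lam 2 v \<le> R)
            \<and> set_eqH M J e lam At (unstable_set M J e lam p k f)"
proof -
  interpret suspension_bridge M J e lam p k f
    by standard (use A f exist in auto)
  obtain R where R: "\<And>z. z \<in> global_attr \<Longrightarrow> fst z \<in> Hr M J e lam 4 \<and> snd z \<in> Hr M J e lam 2 \<and>
    Hnorm2 M J e lam 4 (fst z) + Hnorm2 M J e lam 2 (snd z) \<le> R"
    using regularity_attr by blast
  have "global_attr \<subseteq> Hr M J e lam 4 \<times> Hr M J e lam 2"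
    "\<forall>(u, v)\<in>global_attr. Hnorm2 M J e lam 4 u + Hnorm2 M J e lam 2 v \<le> R"
    using R by (auto simp: mem_Times_iff)
  then show ?thesis
    using global_attractor_attr connectedH_attr attr_eq_unstable_set by blast
qed

end
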